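(* Let $Y=\mathbb{P}^n\times\dots\times\mathbb{P}^n$ ($k$ factors), and let $A\subset\mathbb{P}^n$ be a zero-dimensional scheme of degree $\deg(A)=c+1$. Let $\mathcal{J}_A$ be the ideal sheaf of $A$ in $\mathbb{P}^n$ and assume that $h^1(\mathcal{J}_A(e))=0$ for some $e\le k/2$. Take $T\in\langle v_k(A)\rangle$ such that $T\notin\langle v_k(A')\rangle$ for any $A'\subsetneq A$. Then $T$ has cactus rank equal to $c+1$. If $A$ is reduced (i.e. it is a finite set of points), then $T$ also has rank $c+1$.
   Context: The base field is $\mathbb{C}$. $\nu:Y\to\mathbb{P}^M$, $M=-1+(n+1)^k$, is the Segre embedding and $X=\nu(Y)$. The restriction of $\nu$ to the diagonal $\Delta\cong\mathbb{P}^n$ of $Y$ is identified with the degree-$k$ Veronese map $v_k:\mathbb{P}^n\to\mathbb{P}^D$, $D+1=\binom{n+k}{k}$, where $\mathbb{P}^D\subset\mathbb{P}^M$ is the subspace of symmetric tensors. $\langle Z\rangle$ denotes the linear span of a subscheme $Z$ of a projective space; $\deg$ of a zero-dimensional scheme is its length. Rank and cactus rank are taken with respect to the Segre variety (not the Veronese variety): the rank of $T\in\mathbb{P}^M$ is the minimal cardinality of a finite reduced set $S\subset Y$ with $T\in\langle\nu(S)\rangle$; the cactus rank of $T$ is the minimal degree of a zero-dimensional subscheme $\Gamma\subset X$ with $T\in\langle\Gamma\rangle$. *)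

theory Defs
  imports "HOL-Analysis.Analysis" "HOL-Library.Poly_Mapping"
begin

text \<open>
  The projective space with homogeneous coordinates indexed by a finite type \<open>'v\<close> has dimension
  \<open>CARD('v) - 1\<close>.  With \<open>CARD('n) = n + 1\<close> and \<open>CARD('k) = k\<close>, the target of the Segre embedding of
  \<open>k\<close> copies of the \<open>n\<close>-dimensional projective space has coordinates indexed by \<open>'k \<Rightarrow> 'n\<close>, a type
  with \<open>(n + 1) ^ k\<close> elements.
\<close>

definition proj_space :: "(complex ^ 'v) set set" where
  "proj_space = {L. vec.subspace L \<and> vec.dim L = 1}"

definition points_span :: "(complex ^ 'v) set set \<Rightarrow> (complex ^ 'v) set set" where
  "points_span S = {L \<in> proj_space. L \<subseteq> vec.span (\<Union>S)}"

definition multi_proj_space :: "('k \<Rightarrow> (complex ^ 'n) set) set" where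
  "multi_proj_space = {y. \<forall>j. y j \<in> proj_space}"

definition pure_tensor :: "('k::finite \<Rightarrow> complex ^ 'n) \<Rightarrow> complex ^ ('k \<Rightarrow> 'n)" where
  "pure_tensor x = (\<chi> I. \<Prod>j\<in>UNIV. x j $ I j)"

text \<open>
  For lines \<open>y j\<close>, the set of all tensors \<open>x\<^sub>1 \<otimes> \<dots> \<otimes> x\<^sub>k\<close> with \<open>x\<^sub>j \<in> y j\<close> is again a line.
\<close>

definition segre :: "('k::finite \<Rightarrow> (complex ^ 'n) set) \<Rightarrow> (complex ^ ('k \<Rightarrow> 'n)) set" where
  "segre y = {pure_tensor x | x. \<forall>j. x j \<in> y j}"

definition tensor_rank :: "(complex ^ ('k::finite \<Rightarrow> 'n::finite)) set \<Rightarrow> nat" where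
  "tensor_rank T = (LEAST r. \<exists>S. finite S \<and> S \<subseteq> multi_proj_space \<and> card S = r \<and>
     T \<in> points_span (segre ` S))"

type_synonym 'v cpoly = "('v \<Rightarrow>\<^sub>0 nat) \<Rightarrow>\<^sub>0 complex"
type_synonym 'v claurent = "('v \<Rightarrow>\<^sub>0 int) \<Rightarrow>\<^sub>0 complex"

definition mdeg :: "('v::finite \<Rightarrow>\<^sub>0 'e::comm_monoid_add) \<Rightarrow> 'e" where
  "mdeg t = (\<Sum>v\<in>UNIV. Poly_Mapping.lookup t v)"

definition homogeneous :: "'e \<Rightarrow> (('v::finite \<Rightarrow>\<^sub>0 'e::comm_monoid_add) \<Rightarrow>\<^sub>0 complex) \<Rightarrow> bool" where
  "homogeneous d p \<longleftrightarrow> (\<forall>t\<in>Poly_Mapping.keys p. mdeg t = d)"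

definition homogeneous_part :: "nat \<Rightarrow> 'v::finite cpoly \<Rightarrow> 'v cpoly" where
  "homogeneous_part d p =
     (\<Sum>t\<in>{t \<in> Poly_Mapping.keys p. mdeg t = d}. Poly_Mapping.single t (Poly_Mapping.lookup p t))"

definition const :: "complex \<Rightarrow> ('t::zero \<Rightarrow>\<^sub>0 complex)" where
  "const c = Poly_Mapping.single 0 c"

definition var :: "'v \<Rightarrow> (('v \<Rightarrow>\<^sub>0 'e::zero_neq_one) \<Rightarrow>\<^sub>0 complex)" where
  "var v = Poly_Mapping.single (Poly_Mapping.single v 1) 1"

text \<open>
  The value of \<open>p\<close> when the coefficients are mapped by \<open>h\<close> and \<open>\<alpha> v\<close> is substituted for the
  variable \<open>v\<close>.
\<close>

definition poly_subst ::
  "(complex \<Rightarrow> 'r::comm_ring_1) \<Rightarrow> ('v::finite \<Rightarrow> 'r) \<Rightarrow> 'v cpoly \<Rightarrow> 'r" where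
  "poly_subst h \<alpha> p =
     (\<Sum>t\<in>Poly_Mapping.keys p.
        h (Poly_Mapping.lookup p t) * (\<Prod>v\<in>UNIV. \<alpha> v ^ Poly_Mapping.lookup t v))"

definition poly_at :: "'v::finite cpoly \<Rightarrow> complex ^ 'v \<Rightarrow> complex" where
  "poly_at p x = poly_subst (\<lambda>c. c) (\<lambda>v. x $ v) p"

definition to_laurent :: "'v::finite cpoly \<Rightarrow> 'v claurent" where
  "to_laurent p = poly_subst const var p"

text \<open>
  A closed subscheme \<open>Z\<close> is represented by its saturated homogeneous ideal \<open>\<Oplus>\<^sub>d H\<^sup>0(\<J>\<^sub>Z(d))\<close> in the
  homogeneous coordinate ring; \<open>Z' \<subseteq> Z\<close> is then the reverse inclusion of ideals.  The unit ideal
  represents the empty scheme.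
\<close>

definition closed_subscheme :: "'v::finite cpoly set \<Rightarrow> bool" where
  "closed_subscheme I \<longleftrightarrow>
     0 \<in> I \<and> (\<forall>p\<in>I. \<forall>q\<in>I. p + q \<in> I) \<and> (\<forall>p\<in>I. \<forall>r. r * p \<in> I) \<and>
     (\<forall>p\<in>I. \<forall>d. homogeneous_part d p \<in> I) \<and>
     (\<forall>p. (\<exists>m. \<forall>v. var v ^ m * p \<in> I) \<longrightarrow> p \<in> I)"

definition reduced_subscheme :: "'v::finite cpoly set \<Rightarrow> bool" where
  "reduced_subscheme I \<longleftrightarrow> (\<forall>p m. p ^ m \<in> I \<longrightarrow> p \<in> I)"

definition scheme_span :: "'v::finite cpoly set \<Rightarrow> (complex ^ 'v) set set" where
  "scheme_span I = {L \<in> proj_space. \<forall>l\<in>I. homogeneous 1 l \<longrightarrow> (\<forall>x\<in>L. poly_at l x = 0)}"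

text \<open>
  \<open>sections I W d\<close> is the module of sections of \<open>\<J>\<^sub>Z(d)\<close> over \<open>{x. \<forall>v\<in>W. x\<^sub>v \<noteq> 0}\<close> for nonempty \<open>W\<close>,
  i.e. the degree \<open>d\<close> part of the localization of \<open>I\<close> at \<open>\<Prod>v\<in>W. x\<^sub>v\<close>, realized inside the ring of
  Laurent polynomials, so that restriction maps are inclusions.  For \<open>I = UNIV\<close> it consists of
  the sections of \<open>\<O>(d)\<close>.
\<close>

definition sections :: "'v::finite cpoly set \<Rightarrow> 'v set \<Rightarrow> int \<Rightarrow> 'v claurent set" where
  "sections I W d =
     {f. homogeneous d f \<and> (\<exists>m. (\<Prod>v\<in>W. var v) ^ m * f \<in> to_laurent ` I)}"

text \<open>
  \<open>quotient_dim sc V U d\<close>: the quotient of complex vector spaces \<open>V / U\<close> has dimension \<open>d\<close>, that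
  is, some \<open>b\<^sub>0, \<dots>, b\<^bsub>d-1\<^esub>\<close> in \<open>V\<close> induce a basis of it.
\<close>

definition quotient_dim ::
  "(complex \<Rightarrow> 'm \<Rightarrow> 'm::ab_group_add) \<Rightarrow> 'm set \<Rightarrow> 'm set \<Rightarrow> nat \<Rightarrow> bool" where
  "quotient_dim sc V U d \<longleftrightarrow>
     (\<exists>b :: nat \<Rightarrow> 'm. (\<forall>i<d. b i \<in> V) \<and>
        (\<forall>f\<in>V. \<exists>!c. c \<in> {..<d} \<rightarrow>\<^sub>E UNIV \<and> f - (\<Sum>i<d. sc (c i) (b i)) \<in> U))"

text \<open>
  A scheme of finite type over the complex numbers has dimension at most \<open>0\<close> iff the coordinate
  rings of its affine charts are finite-dimensional vector spaces (empty schemes, of length \<open>0\<close>,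
  are allowed).
\<close>

definition zero_dimensional :: "'v::finite cpoly set \<Rightarrow> bool" where
  "zero_dimensional I \<longleftrightarrow>
     (\<forall>v. \<exists>d. quotient_dim (\<lambda>c f. const c * f) (sections UNIV {v} 0) (sections I {v} 0) d)"

text \<open>
  The length of \<open>Z\<close> is the dimension of \<open>H\<^sup>0(\<O>\<^sub>Z)\<close>: a global section of \<open>\<O>\<^sub>Z\<close> is a family of
  functions on the standard charts agreeing on overlaps modulo \<open>\<J>\<^sub>Z\<close>, and it is \<open>0\<close> if all members
  lie in \<open>\<J>\<^sub>Z\<close>.
\<close>

definition has_length :: "'v::finite cpoly set \<Rightarrow> nat \<Rightarrow> bool" where
  "has_length I d \<longleftrightarrow>
     quotient_dim (\<lambda>c f. const c *s f)
       {f :: 'v claurent ^ 'v. (\<forall>i. f $ i \<in> sections UNIV {i} 0) \<and>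
          (\<forall>i j. f $ i - f $ j \<in> sections I {i, j} 0)}
       {f. \<forall>i. f $ i \<in> sections I {i} 0}
       d"

text \<open>
  \<open>has_h1 I e h\<close> states \<open>h\<^sup>1(\<J>\<^sub>Z(e)) = h\<close>, the cohomology being computed by the (non-alternating)
  Cech complex of the standard affine cover.
\<close>

definition cech_cocycles1 :: "'v::finite cpoly set \<Rightarrow> int \<Rightarrow> ('v claurent ^ ('v \<times> 'v)) set" where
  "cech_cocycles1 I e =
     {f. (\<forall>i j. f $ (i, j) \<in> sections I {i, j} e) \<and>
         (\<forall>i j l. f $ (j, l) - f $ (i, l) + f $ (i, j) = 0)}"

definition cech_coboundaries1 :: "'v::finite cpoly set \<Rightarrow> int \<Rightarrow> ('v claurent ^ ('v \<times> 'v)) set" where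
  "cech_coboundaries1 I e =
     {(\<chi> ij. g (snd ij) - g (fst ij)) | g. \<forall>i. g i \<in> sections I {i} e}"

definition has_h1 :: "'v::finite cpoly set \<Rightarrow> int \<Rightarrow> nat \<Rightarrow> bool" where
  "has_h1 I e h \<longleftrightarrow>
     quotient_dim (\<lambda>c f. const c *s f) (cech_cocycles1 I e) (cech_coboundaries1 I e) h"

text \<open>
  The scheme-theoretic image of \<open>Z\<close> under the Segre embedding restricted to the diagonal, i.e. under
  the Veronese map of degree \<open>k\<close> into the symmetric tensors: its ideal is the preimage of the ideal of
  \<open>Z\<close> under \<open>z\<^sub>I \<mapsto> \<Prod>j. x\<^bsub>I j\<^esub>\<close>.
\<close>

definition veronese_image :: "'n::finite cpoly set \<Rightarrow> ('k::finite \<Rightarrow> 'n) cpoly set" where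
  "veronese_image I = {p. poly_subst const (\<lambda>K. \<Prod>j\<in>UNIV. var (K j)) p \<in> I}"

definition segre_ideal :: "('k::finite \<Rightarrow> 'n::finite) cpoly set" where
  "segre_ideal = {p. \<forall>y\<in>multi_proj_space. \<forall>t\<in>segre y. poly_at p t = 0}"

definition cactus_rank :: "(complex ^ ('k::finite \<Rightarrow> 'n::finite)) set \<Rightarrow> nat" where
  "cactus_rank T = (LEAST r. \<exists>G. closed_subscheme G \<and> segre_ideal \<subseteq> G \<and> zero_dimensional G \<and>
     has_length G r \<and> T \<in> scheme_span G)"

end

theory Submission
  imports Defs "HOL-Computational_Algebra.Fundamental_Theorem_Algebra"
begin

text \<open>
  Split the \<open>k\<close> tensor factors into sets of sizes \<open>\<lfloor>k/2\<rfloor>\<close> and \<open>\<lceil>k/2\<rceil>\<close>, both at least \<open>e\<close>, and let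
  \<open>B\<close> be the homogeneous coordinate ring of \<open>A\<close>.  Since \<open>h\<^sup>1(\<J>\<^sub>A(e)) = 0\<close>, the graded pieces of \<open>B\<close>
  in these two degrees have full dimension \<open>c + 1\<close>.  The tensor \<open>T\<close> is a functional on the degree \<open>k\<close>
  piece, and by minimality of \<open>A\<close> the pairing that it induces between the two pieces is
  nondegenerate; so the corresponding flattening of \<open>T\<close> has rank \<open>c + 1\<close>.  On the other hand, let
  \<open>\<Gamma>\<close> be a subscheme of the Segre variety with \<open>T \<in> \<langle>\<Gamma>\<rangle>\<close>.  On the Segre variety
  \<open>(e \<otimes> g\<^sub>0)(f \<otimes> g) = (f \<otimes> g\<^sub>0)(e \<otimes> g)\<close>, and for general \<open>g\<^sub>0\<close> the forms \<open>e \<otimes> g\<^sub>0\<close> have no common zero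
  on \<open>\<Gamma>\<close>; so if \<open>f \<otimes> g\<^sub>0\<close> vanishes on \<open>\<Gamma>\<close>, then so does every \<open>f \<otimes> g\<close>.  Hence \<open>f \<mapsto> f \<otimes> g\<^sub>0\<close> embeds
  the image of the flattening into the linear forms on \<open>\<Gamma>\<close>, and \<open>c + 1 \<le> deg \<Gamma>\<close>.  The bound is
  attained by the image of \<open>A\<close> itself and, if \<open>A\<close> is reduced, by its points.
\<close>

section \<open>Dimensions of quotients\<close>

text \<open>The definitions speak of charts and Cech cocycles, while the argument needs only Hilbert
  functions of saturated ideals. The bridge is a general linear form \<open>l\<close>: it misses a
  zero-dimensional scheme Z, so it is a nonzerodivisor modulo the ideal, and dividing by its powers
  identifies all twists O_Z(d). Hence the Hilbert function is nondecreasing and its maximum is the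
  length, which bounds the number of independent linear forms on \<Gamma> by deg \<Gamma>. Vanishing
  of h^1 in degree e implies that the maximum is reached in every degree from e on. The two halves
  of the factors use this differently: one degree supplies c + 1 forms to be tested against T; in
  the other it ensures that adjoining a form y to the ideal of A and saturating adds, in degree k,
  nothing but multiples of y, which is what lets minimality of A speak about the flattening. So both
  halves have to be at least e. Dimensions are compared through \<open>codim_ge\<close>, the
  existence of \<open>n\<close> elements independent modulo \<open>U\<close>; such lower bounds pass
  between quotients before finiteness is known.\<close>

definition codim_ge ::
  "(complex \<Rightarrow> 'm \<Rightarrow> 'm::ab_group_add) \<Rightarrow> 'm set \<Rightarrow> 'm set \<Rightarrow> nat \<Rightarrow> bool" where
  "codim_ge sc V U n \<longleftrightarrow> (\<exists>b. (\<forall>i<n. b i \<in> V) \<and>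
     (\<forall>c. (\<Sum>i<n. sc (c i) (b i)) \<in> U \<longrightarrow> (\<forall>i<n. c i = 0)))"

text \<open>Induction on the equations. Dropping any one unknown leaves the induction hypothesis
  applicable, so the smaller system has several solutions, and two of them are combined to satisfy
  the new equation.\<close>

lemma homogeneous_system:
  fixes c :: "'i \<Rightarrow> 'j \<Rightarrow> 'a::field"
  assumes "finite J" "finite I" "card J < card I"
  shows "\<exists>x. (\<exists>i\<in>I. x i \<noteq> 0) \<and> (\<forall>i. i \<notin> I \<longrightarrow> x i = 0) \<and> (\<forall>j\<in>J. (\<Sum>i\<in>I. x i * c i j) = 0)"
  using assms
proof (induction J arbitrary: I rule: finite_induct)
  case empty
  then obtain i where "i \<in> I" by fastforce
  then show ?case by (intro exI[of _ "\<lambda>k. if k = i then 1 else 0"]) auto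
next
  case (insert j J)
  have smaller: "\<exists>x. (\<exists>i\<in>I. x i \<noteq> 0) \<and> (\<forall>i. i \<notin> I - {k} \<longrightarrow> x i = 0)
      \<and> (\<forall>j\<in>J. (\<Sum>i\<in>I. x i * c i j) = 0)" if "k \<in> I" for k
  proof -
    have "card J < card (I - {k})" using insert that by simp
    then obtain x where x: "\<exists>i\<in>I - {k}. x i \<noteq> 0" "\<forall>i. i \<notin> I - {k} \<longrightarrow> x i = 0"
      "\<forall>j\<in>J. (\<Sum>i\<in>I - {k}. x i * c i j) = 0"
      using insert.IH[of "I - {k}"] insert.prems by auto
    have "(\<Sum>i\<in>I. x i * c i j) = (\<Sum>i\<in>I - {k}. x i * c i j)" for j
      using x(2) insert.prems that by (subst sum.remove[of I k]) auto
    with x show ?thesis by auto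
  qed
  obtain k where "k \<in> I" using insert.prems by fastforce
  from smaller[OF this] obtain x where x: "\<exists>i\<in>I. x i \<noteq> 0" "\<forall>i. i \<notin> I \<longrightarrow> x i = 0"
    "\<forall>j\<in>J. (\<Sum>i\<in>I. x i * c i j) = 0" by auto
  then obtain m where m: "m \<in> I" "x m \<noteq> 0" by auto
  \<comment> \<open>Dropping the unknown \<open>m\<close>, at which \<open>x\<close> is nonzero,
    keeps the later combination \<open>t * x i - s * y i\<close> nontrivial: at \<open>m\<close> it
    equals \<open>t * x m\<close>.\<close>
  from smaller[OF m(1)] obtain y where y: "\<exists>i\<in>I. y i \<noteq> 0" "\<forall>i. i \<notin> I \<longrightarrow> y i = 0" "y m = 0"
    "\<forall>j\<in>J. (\<Sum>i\<in>I. y i * c i j) = 0" by auto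
  define s t where "s = (\<Sum>i\<in>I. x i * c i j)" and "t = (\<Sum>i\<in>I. y i * c i j)"
  show ?case
  proof (cases "t = 0")
    case True
    then show ?thesis using y by (intro exI[of _ y]) (auto simp: t_def)
  next
    case False
    let ?z = "\<lambda>i. t * x i - s * y i"
    have sum_z: "(\<Sum>i\<in>I. ?z i * c i j') = t * (\<Sum>i\<in>I. x i * c i j') - s * (\<Sum>i\<in>I. y i * c i j')" for j'
      by (simp add: sum_distrib_left sum_subtractf left_diff_distrib mult.assoc)
    have "?z m \<noteq> 0" using False m y by simp
    then have "\<exists>i\<in>I. ?z i \<noteq> 0" using m by blast
    moreover have "\<forall>i. i \<notin> I \<longrightarrow> ?z i = 0" using x y by simp
    moreover have "(\<Sum>i\<in>I. ?z i * c i j') = 0" if "j' \<in> insert j J" for j'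
    proof (cases "j' = j")
      case True
      show ?thesis unfolding sum_z True s_def[symmetric] t_def[symmetric] by simp
    next
      case False
      with that show ?thesis unfolding sum_z using x(3) y(4) by simp
    qed
    ultimately show ?thesis by (intro exI[of _ ?z] conjI ballI)
  qed
qed

lemma homogeneous_system_nat:
  fixes c :: "nat \<Rightarrow> 'j \<Rightarrow> 'a::field"
  assumes "finite J" "card J < n"
  obtains x where "\<exists>i<n. x i \<noteq> 0" "\<And>j. j \<in> J \<Longrightarrow> (\<Sum>i<n. x i * c i j) = 0"
  using homogeneous_system[of J "{..<n}" c] assms by auto

lemma codim_geI:
  assumes "\<And>i. i < n \<Longrightarrow> b i \<in> V"
    and "\<And>c. (\<Sum>i<n. sc (c i) (b i)) \<in> U \<Longrightarrow> \<forall>i<n. c i = 0"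
  shows "codim_ge sc V U n"
  using assms unfolding codim_ge_def by blast

lemma codim_ge_mono:
  assumes "vector_space sc" and "codim_ge sc V U n" "m \<le> n"
  shows "codim_ge sc V U m"
proof -
  interpret vector_space sc by fact
  obtain b where b: "\<forall>i<n. b i \<in> V" "\<And>c. (\<Sum>i<n. sc (c i) (b i)) \<in> U \<Longrightarrow> \<forall>i<n. c i = 0"
    using assms unfolding codim_ge_def by blast
  show ?thesis
  proof (rule codim_geI)
    fix c assume c: "(\<Sum>i<m. sc (c i) (b i)) \<in> U"
    have "(\<Sum>i<n. sc (if i < m then c i else 0) (b i)) = (\<Sum>i<m. sc (c i) (b i))"
      using \<open>m \<le> n\<close> by (intro sum.mono_neutral_cong_right) auto
    with c have "\<forall>i<n. (if i < m then c i else 0) = 0" by (intro b(2)) (simp only:)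
    with \<open>m \<le> n\<close> show "\<forall>i<m. c i = 0" by (auto split: if_splits)
  qed (use b \<open>m \<le> n\<close> in auto)
qed

text \<open>
  The coordinate changes between quotients (dehomogenization, multiplication by a nonzerodivisor)
  are only defined modulo the ideal, hence the formulation with a linear relation.
\<close>

lemma codim_ge_transfer:
  assumes "codim_ge sc V U n"
    and tot: "\<And>v. v \<in> V \<Longrightarrow> \<exists>v'\<in>V'. R v v'"
    and sum: "\<And>c b b'. (\<And>i. i < n \<Longrightarrow> b i \<in> V) \<Longrightarrow> (\<And>i. i < n \<Longrightarrow> b' i \<in> V') \<Longrightarrow>
       (\<And>i. i < n \<Longrightarrow> R (b i) (b' i)) \<Longrightarrow> (\<Sum>i<n. sc' (c i) (b' i)) \<in> U' \<Longrightarrow>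
         (\<Sum>i<n. sc (c i) (b i)) \<in> U"
  shows "codim_ge sc' V' U' n"
proof -
  obtain b where b: "\<forall>i<n. b i \<in> V" "\<And>c. (\<Sum>i<n. sc (c i) (b i)) \<in> U \<Longrightarrow> \<forall>i<n. c i = 0"
    using assms(1) unfolding codim_ge_def by blast
  have "\<forall>i. \<exists>v'. i < n \<longrightarrow> v' \<in> V' \<and> R (b i) v'" using b tot by blast
  then obtain b' where b': "\<And>i. i < n \<Longrightarrow> b' i \<in> V' \<and> R (b i) (b' i)" by metis
  show ?thesis
    by (rule codim_geI[of n b']) (use b b' sum in blast)+
qed

text \<open>Since \<open>Suc d\<close> independent elements do not exist, adding \<open>f\<close>
  creates a relation. It involves \<open>f\<close>, because the \<open>b i\<close> alone admit none,
  and can be solved for \<open>f\<close>.\<close>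

lemma dependent_extension:
  assumes "vector_space sc" and U: "module.subspace sc U"
    and b: "\<And>i. i < d \<Longrightarrow> b i \<in> V" "\<And>c. (\<Sum>i<d. sc (c i) (b i)) \<in> U \<Longrightarrow> \<forall>i<d. c i = 0"
    and max: "\<not> codim_ge sc V U (Suc d)" and "f \<in> V"
  shows "\<exists>c. f - (\<Sum>i<d. sc (c i) (b i)) \<in> U"
proof -
  interpret vector_space sc by fact
  let ?b = "\<lambda>i. if i < d then b i else f"
  have "\<not> (\<forall>c. (\<Sum>i<Suc d. sc (c i) (?b i)) \<in> U \<longrightarrow> (\<forall>i<Suc d. c i = 0))"
  proof
    assume "\<forall>c. (\<Sum>i<Suc d. sc (c i) (?b i)) \<in> U \<longrightarrow> (\<forall>i<Suc d. c i = 0)"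
    then have "codim_ge sc V U (Suc d)" using b(1) \<open>f \<in> V\<close> by (intro codim_geI[of _ ?b]) auto
    with max show False by simp
  qed
  then obtain c where c: "(\<Sum>i<d. sc (c i) (b i)) + sc (c d) f \<in> U" "\<exists>i<Suc d. c i \<noteq> 0" by auto
  have "c d \<noteq> 0"
  proof
    assume "c d = 0"
    with c b(2)[of c] show False by (auto simp: less_Suc_eq)
  qed
  have "sc (inverse (c d)) ((\<Sum>i<d. sc (c i) (b i)) + sc (c d) f) \<in> U"
    using c(1) U by (intro subspace_scale)
  also have "sc (inverse (c d)) ((\<Sum>i<d. sc (c i) (b i)) + sc (c d) f)
      = f - (\<Sum>i<d. sc (- (c i / c d)) (b i))"
    using \<open>c d \<noteq> 0\<close> by (simp add: scale_right_distrib scale_sum_right sum_negf field_simps)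
  finally show ?thesis by (intro exI[of _ "\<lambda>i. - (c i / c d)"])
qed

lemma quotient_dimI:
  assumes "vector_space sc" and U: "module.subspace sc U"
    and "codim_ge sc V U d" "\<not> codim_ge sc V U (Suc d)"
  shows "quotient_dim sc V U d"
proof -
  interpret vector_space sc by fact
  obtain b where b: "\<And>i. i < d \<Longrightarrow> b i \<in> V" "\<And>c. (\<Sum>i<d. sc (c i) (b i)) \<in> U \<Longrightarrow> \<forall>i<d. c i = 0"
    using assms unfolding codim_ge_def by blast
  have "\<exists>!c. c \<in> {..<d} \<rightarrow>\<^sub>E UNIV \<and> f - (\<Sum>i<d. sc (c i) (b i)) \<in> U" if "f \<in> V" for f
  proof (rule ex_ex1I)
    have "\<exists>c. f - (\<Sum>i<d. sc (c i) (b i)) \<in> U"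
      by (rule dependent_extension[OF assms(1) U b(1) b(2) assms(4) \<open>f \<in> V\<close>])
    then obtain c where "f - (\<Sum>i<d. sc (c i) (b i)) \<in> U" ..
    then show "\<exists>c. c \<in> {..<d} \<rightarrow>\<^sub>E UNIV \<and> f - (\<Sum>i<d. sc (c i) (b i)) \<in> U"
      by (intro exI[of _ "restrict c {..<d}"]) auto
  next
    fix c c' assume c: "c \<in> {..<d} \<rightarrow>\<^sub>E UNIV \<and> f - (\<Sum>i<d. sc (c i) (b i)) \<in> U"
      and c': "c' \<in> {..<d} \<rightarrow>\<^sub>E UNIV \<and> f - (\<Sum>i<d. sc (c' i) (b i)) \<in> U"
    have "(f - (\<Sum>i<d. sc (c' i) (b i))) - (f - (\<Sum>i<d. sc (c i) (b i))) \<in> U"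
      by (rule subspace_diff[OF U conjunct2[OF c'] conjunct2[OF c]])
    then have "(\<Sum>i<d. sc (c i - c' i) (b i)) \<in> U"
      by (simp add: scale_left_diff_distrib sum_subtractf)
    then have "\<forall>i<d. c i - c' i = 0" by (rule b(2))
    with c c' show "c = c'" by (intro PiE_ext[of c _ _ c' ]) auto
  qed
  with b(1) show ?thesis unfolding quotient_dim_def by (intro exI[of _ b]) simp
qed

text \<open>The zero vector has the coefficients 0, and uniqueness leaves no others; so the
  \<open>b i\<close> admit no nontrivial relation modulo \<open>U\<close>.\<close>

lemma quotient_dim_imp_codim_ge:
  assumes "vector_space sc" and "0 \<in> V" and U: "module.subspace sc U" and "quotient_dim sc V U d"
  shows "codim_ge sc V U d"
proof -
  interpret vector_space sc by fact
  obtain b where b: "\<forall>i<d. b i \<in> V"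
    "\<forall>f\<in>V. \<exists>!c. c \<in> {..<d} \<rightarrow>\<^sub>E UNIV \<and> f - (\<Sum>i<d. sc (c i) (b i)) \<in> U"
    using assms(4) unfolding quotient_dim_def by (elim exE conjE)
  show ?thesis
  proof (rule codim_geI)
    fix c assume "(\<Sum>i<d. sc (c i) (b i)) \<in> U"
    then have "- (\<Sum>i<d. sc (c i) (b i)) \<in> U" using U by (rule subspace_neg[rotated])
    \<comment> \<open>\<open>quotient_dim\<close> only compares coefficient families that are
      extensional on \<open>{..<d}\<close>, so both candidates are restricted before uniqueness is
      applied.\<close>
    then have neg: "0 - (\<Sum>i<d. sc (restrict c {..<d} i) (b i)) \<in> U" by simp
    define P where "P c \<longleftrightarrow> c \<in> {..<d} \<rightarrow>\<^sub>E UNIV \<and> 0 - (\<Sum>i<d. sc (c i) (b i)) \<in> U" for c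
    have "\<exists>!c. P c" unfolding P_def using b(2) \<open>0 \<in> V\<close> by (rule bspec)
    moreover have "P (restrict c {..<d})" unfolding P_def using neg by simp
    moreover have "P (restrict (\<lambda>_. 0) {..<d})" unfolding P_def using subspace_0[OF U] by simp
    ultimately have "restrict c {..<d} = restrict (\<lambda>_. 0) {..<d}" by blast
    then show "\<forall>i<d. c i = 0" by (metis lessThan_iff restrict_apply')
  qed (use b in auto)
qed

lemma quotient_dim_spanning:
  assumes "quotient_dim sc V U d"
  shows "\<exists>b. \<forall>f\<in>V. \<exists>c. f - (\<Sum>j<d. sc (c j) (b j)) \<in> U"
proof -
  obtain b where b: "\<forall>f\<in>V. \<exists>!c. c \<in> {..<d} \<rightarrow>\<^sub>E UNIV \<and> f - (\<Sum>j<d. sc (c j) (b j)) \<in> U"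
    using assms unfolding quotient_dim_def by (elim exE conjE)
  have "\<exists>c. f - (\<Sum>j<d. sc (c j) (b j)) \<in> U" if "f \<in> V" for f
    using ex1_implies_ex[OF bspec[OF b that]] by (elim exE conjE) (rule exI)
  then show ?thesis by (intro exI[of _ b] ballI)
qed

lemma quotient_dim_bound:
  assumes "vector_space sc" and U: "module.subspace sc U"
    and "quotient_dim sc V U d" "codim_ge sc V U n"
  shows "n \<le> d"
proof (rule ccontr)
  interpret vector_space sc by fact
  assume "\<not> n \<le> d"
  obtain b where b: "\<forall>f\<in>V. \<exists>c. f - (\<Sum>j<d. sc (c j) (b j)) \<in> U"
    using quotient_dim_spanning[OF assms(3)] ..
  obtain a where a: "\<And>i. i < n \<Longrightarrow> a i \<in> V" "\<And>c. (\<Sum>i<n. sc (c i) (a i)) \<in> U \<Longrightarrow> \<forall>i<n. c i = 0"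
    using assms unfolding codim_ge_def by blast
  have "\<exists>c. \<forall>i. i < n \<longrightarrow> a i - (\<Sum>j<d. sc (c i j) (b j)) \<in> U"
    by (rule choice) (use a(1) b in simp)
  then obtain c where c: "\<And>i. i < n \<Longrightarrow> a i - (\<Sum>j<d. sc (c i j) (b j)) \<in> U" by blast
  obtain x where x: "\<exists>i<n. x i \<noteq> 0" "\<And>j. j \<in> {..<d} \<Longrightarrow> (\<Sum>i<n. x i * c i j) = 0"
    using homogeneous_system_nat[of "{..<d}" n c] \<open>\<not> n \<le> d\<close> by auto
  have "(\<Sum>i<n. sc (x i) (a i - (\<Sum>j<d. sc (c i j) (b j)))) \<in> U"
    using c U by (intro subspace_sum subspace_scale) auto
  moreover have "(\<Sum>i<n. sc (x i) (\<Sum>j<d. sc (c i j) (b j))) = (\<Sum>j<d. sc (\<Sum>i<n. x i * c i j) (b j))"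
    unfolding scale_sum_right scale_scale scale_sum_left by (rule sum.swap)
  ultimately have "(\<Sum>i<n. sc (x i) (a i)) \<in> U"
    using x(2) by (simp add: scale_right_diff_distrib sum_subtractf)
  with a(2) x(1) show False by blast
qed

lemma ex_quotient_dim:
  assumes "vector_space sc" and U: "module.subspace sc U" and "\<And>n. codim_ge sc V U n \<Longrightarrow> n \<le> N"
  shows "\<exists>d. quotient_dim sc V U d"
proof -
  interpret vector_space sc by fact
  have 0: "codim_ge sc V U 0" by (rule codim_geI) auto
  define d where "d = (GREATEST n. codim_ge sc V U n)"
  have "codim_ge sc V U d" 
    unfolding d_def using 0 assms(3) by (rule GreatestI_nat)
  moreover have "\<not> codim_ge sc V U (Suc d)"
    using Greatest_le_nat[of "codim_ge sc V U" "Suc d" N] assms(3) Suc_n_not_le_n[of d]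
    unfolding d_def by blast
  ultimately show ?thesis using quotient_dimI[OF assms(1,2)] by blast
qed

section \<open>Homogeneous polynomials and substitution\<close>

lemma const_simps [simp]:
  "const 0 = 0" "const 1 = 1" "const (a + b) = const a + const b" "const (a * b) = const a * const b"
  "const (- a) = - const a" "const (a - b) = const a - const b"
  by (auto simp: const_def single_add mult_single single_uminus single_diff)

lemma const_power [simp]: "const (a ^ n) = const a ^ n"
  by (induction n) auto

lemma const_sum: "const (sum f X) = (\<Sum>x\<in>X. const (f x))"
  by (induction X rule: infinite_finite_induct) auto

lemma const_prod: "const (prod f X) = (\<Prod>x\<in>X. const (f x))"
  by (induction X rule: infinite_finite_induct) auto

lemma const_mult_cancel:
  assumes "a \<noteq> 0" shows "const (inverse a) * (const a * p) = p"
  using assms unfolding mult.assoc[symmetric] const_simps(4)[symmetric] by simp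

lemma vector_space_const:
  "vector_space (\<lambda>c (f :: 't::comm_monoid_add \<Rightarrow>\<^sub>0 complex). const c * f)"
  by unfold_locales (auto simp: algebra_simps)

lemma vector_space_const_vec:
  "vector_space (\<lambda>c (f :: ('t::comm_monoid_add \<Rightarrow>\<^sub>0 complex) ^ 'n). const c *s f)"
  by unfold_locales (auto simp: vec_eq_iff algebra_simps)

lemma poly_eq_sum_single: "p = (\<Sum>t\<in>Poly_Mapping.keys p. Poly_Mapping.single t (Poly_Mapping.lookup p t))"
  by (rule poly_mapping_eqI)
    (simp add: lookup_sum lookup_single when_def in_keys_iff)

lemma mdeg_zero [simp]: "mdeg 0 = 0"
  by (simp add: mdeg_def)

lemma mdeg_add: "mdeg (s + t) = mdeg s + mdeg t"
  by (simp add: mdeg_def lookup_add sum.distrib)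

lemma mdeg_single [simp]: "mdeg (Poly_Mapping.single v a) = a"
  by (simp add: mdeg_def lookup_single when_def)

lemma homogeneous_zero [simp]: "homogeneous d 0"
  by (simp add: homogeneous_def)

lemma homogeneous_add: "homogeneous d p \<Longrightarrow> homogeneous d q \<Longrightarrow> homogeneous d (p + q)"
  using keys_add[of p q] unfolding homogeneous_def by blast

lemma homogeneous_uminus: "homogeneous d p \<Longrightarrow> homogeneous d (- p)"
  by (simp add: homogeneous_def in_keys_iff)

lemma homogeneous_diff: "homogeneous d p \<Longrightarrow> homogeneous d q \<Longrightarrow> homogeneous d (p - q)"
  using homogeneous_add[of d p "- q"] homogeneous_uminus[of d q] by simp

lemma homogeneous_sum: "(\<And>x. x \<in> X \<Longrightarrow> homogeneous d (f x)) \<Longrightarrow> homogeneous d (sum f X)"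
  by (induction X rule: infinite_finite_induct) (auto intro: homogeneous_add)

lemma homogeneous_mult: "homogeneous d p \<Longrightarrow> homogeneous d' q \<Longrightarrow> homogeneous (d + d') (p * q)"
  using keys_mult[of p q] unfolding homogeneous_def by (fastforce simp: mdeg_add)

lemma homogeneous_single: "mdeg t = d \<Longrightarrow> homogeneous d (Poly_Mapping.single t c)"
  by (simp add: homogeneous_def)

lemma homogeneous_const [simp]: "homogeneous 0 (const c)"
  by (simp add: const_def homogeneous_single)


lemma homogeneous_1 [simp]: "homogeneous 0 1"
  using homogeneous_const[of 1] by simp

lemma homogeneous_const_mult: "homogeneous d p \<Longrightarrow> homogeneous d (const c * p)"
  using homogeneous_mult[of 0 "const c" d p] by simp

lemma homogeneous_var [simp]:
  "homogeneous 1 (var v :: ('v::finite \<Rightarrow>\<^sub>0 'e::{comm_monoid_add, zero_neq_one}) \<Rightarrow>\<^sub>0 complex)"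
  by (simp add: var_def homogeneous_single)

lemma homogeneous_var_nat [simp]: "homogeneous (Suc 0) (var v :: 'v::finite cpoly)"
  using homogeneous_var by (metis One_nat_def)

lemma homogeneous_power: "homogeneous d p \<Longrightarrow> homogeneous (of_nat n * d) (p ^ n)"
  for d :: "'e::comm_semiring_1"
  by (induction n) (auto simp: distrib_right intro: homogeneous_mult)

lemma homogeneous_linear_power: "homogeneous 1 p \<Longrightarrow> homogeneous n (p ^ n)" for p :: "'v::finite cpoly"
  using homogeneous_power[of 1 p n] by simp

lemma homogeneous_prod:
  assumes "\<And>x. x \<in> X \<Longrightarrow> homogeneous (d x) (f x)"
  shows "homogeneous (\<Sum>x\<in>X. d x) (prod f X)"
  using assms by (induction X rule: infinite_finite_induct) (auto intro: homogeneous_mult)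

lemma lookup_homogeneous_part:
  "Poly_Mapping.lookup (homogeneous_part d p) t = (if mdeg t = d then Poly_Mapping.lookup p t else 0)"
  by (auto simp: homogeneous_part_def lookup_sum lookup_single when_def in_keys_iff)

lemma homogeneous_homogeneous_part [simp]: "homogeneous d (homogeneous_part d p)"
  by (auto simp: homogeneous_def in_keys_iff lookup_homogeneous_part split: if_splits)

lemma homogeneous_part_add: "homogeneous_part d (p + q) = homogeneous_part d p + homogeneous_part d q"
  by (rule poly_mapping_eqI) (simp add: lookup_homogeneous_part lookup_add)

lemma homogeneous_part_diff: "homogeneous_part d (p - q) = homogeneous_part d p - homogeneous_part d q"
  by (rule poly_mapping_eqI) (simp add: lookup_homogeneous_part lookup_minus)

lemma homogeneous_part_id: "homogeneous d p \<Longrightarrow> homogeneous_part d p = p"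
  by (rule poly_mapping_eqI) (auto simp: lookup_homogeneous_part homogeneous_def in_keys_iff)

lemma homogeneous_part_sum: "homogeneous_part d (sum f X) = (\<Sum>x\<in>X. homogeneous_part d (f x))"
  by (rule poly_mapping_eqI) (simp add: lookup_homogeneous_part lookup_sum)

lemma homogeneous_part_other: "homogeneous e p \<Longrightarrow> e \<noteq> d \<Longrightarrow> homogeneous_part d p = 0"
  by (rule poly_mapping_eqI) (auto simp: lookup_homogeneous_part homogeneous_def in_keys_iff)

lemma homogeneous_part_eq_0: "d \<notin> mdeg ` Poly_Mapping.keys p \<Longrightarrow> homogeneous_part d p = 0"
  by (rule poly_mapping_eqI) (auto simp: lookup_homogeneous_part in_keys_iff)

text \<open>Terms of \<open>p\<close> outside degree \<open>d\<close> cannot reach degree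
  \<open>m + d\<close> after multiplication by a form of degree \<open>m\<close>.\<close>

lemma homogeneous_part_mult:
  assumes q: "homogeneous m q"
  shows "homogeneous_part (m + d) (q * p) = q * homogeneous_part d p"
proof -
  define r where "r = p - homogeneous_part d p"
  have r: "mdeg t \<noteq> d" if "t \<in> Poly_Mapping.keys r" for t
    using that by (auto simp: r_def in_keys_iff lookup_minus lookup_homogeneous_part split: if_splits)
  have "homogeneous_part (m + d) (q * r) = 0"
  proof (rule poly_mapping_eqI)
    fix t
    have "Poly_Mapping.lookup (q * r) t = 0" if "mdeg t = m + d"
    proof (rule ccontr)
      assume "Poly_Mapping.lookup (q * r) t \<noteq> 0"
      then have "t \<in> Poly_Mapping.keys (q * r)" by (simp add: in_keys_iff)
      then obtain a b where ab: "t = a + b" "a \<in> Poly_Mapping.keys q" "b \<in> Poly_Mapping.keys r"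
        using keys_mult[of q r] by blast
      then have "mdeg a = m" using q by (simp add: homogeneous_def)
      with ab that r show False by (auto simp: mdeg_add)
    qed
    then show "Poly_Mapping.lookup (homogeneous_part (m + d) (q * r)) t = Poly_Mapping.lookup 0 t"
      by (simp add: lookup_homogeneous_part)
  qed
  moreover have "q * p = q * homogeneous_part d p + q * r" by (simp add: r_def algebra_simps)
  ultimately show ?thesis
    using homogeneous_part_id[OF homogeneous_mult[OF q homogeneous_homogeneous_part]]
    by (simp add: homogeneous_part_add)
qed

lemma homogeneous_part_power_mult:
  assumes "homogeneous 1 q"
  shows "homogeneous_part (m + d) (q ^ m * p) = q ^ m * homogeneous_part d p"
  using homogeneous_part_mult[OF homogeneous_linear_power[OF assms]] .

lemma sum_homogeneous_parts:
  "p = (\<Sum>d\<in>mdeg ` Poly_Mapping.keys p. homogeneous_part d p)"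
  by (rule poly_mapping_eqI) (auto simp: lookup_sum lookup_homogeneous_part in_keys_iff)

text \<open>One substitution serves two purposes: with \<open>const\<close> for \<open>h\<close> it
  maps polynomials to polynomials or Laurent polynomials, with the identity it evaluates at points.
  The locale shows once that both are ring homomorphisms.\<close>

locale coeff_hom =
  fixes h :: "complex \<Rightarrow> 'r::comm_ring_1"
  assumes hom_add: "h (a + b) = h a + h b"
    and hom_mult: "h (a * b) = h a * h b"
    and hom_one: "h 1 = 1"
begin

lemma hom_zero: "h 0 = 0"
  using hom_add[of 0 0] by simp

lemma poly_subst_superset:
  assumes "finite X" "Poly_Mapping.keys p \<subseteq> X"
  shows "poly_subst h \<alpha> p =
    (\<Sum>t\<in>X. h (Poly_Mapping.lookup p t) * (\<Prod>v\<in>UNIV. \<alpha> v ^ Poly_Mapping.lookup t v))"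
  unfolding poly_subst_def using assms by (intro sum.mono_neutral_left) (auto simp: in_keys_iff hom_zero)

lemma poly_subst_add: "poly_subst h \<alpha> (p + q) = poly_subst h \<alpha> p + poly_subst h \<alpha> q"
proof -
  let ?X = "Poly_Mapping.keys p \<union> Poly_Mapping.keys q"
  show ?thesis
    using keys_add[of p q]
    by (subst (1 2 3) poly_subst_superset[of ?X]) (auto simp: lookup_add hom_add distrib_right sum.distrib)
qed

lemma poly_subst_zero [simp]: "poly_subst h \<alpha> 0 = 0"
  by (simp add: poly_subst_def)

lemma poly_subst_sum: "poly_subst h \<alpha> (sum f X) = (\<Sum>x\<in>X. poly_subst h \<alpha> (f x))"
  by (induction X rule: infinite_finite_induct) (auto simp: poly_subst_add)

lemma poly_subst_single:
  "poly_subst h \<alpha> (Poly_Mapping.single t c) = h c * (\<Prod>v\<in>UNIV. \<alpha> v ^ Poly_Mapping.lookup t v)"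
  by (subst poly_subst_superset[of "{t}"]) auto

lemma poly_subst_mult: "poly_subst h \<alpha> (p * q) = poly_subst h \<alpha> p * poly_subst h \<alpha> q"
proof -
  have *: "poly_subst h \<alpha> (Poly_Mapping.single s a * Poly_Mapping.single t b) =
      poly_subst h \<alpha> (Poly_Mapping.single s a) * poly_subst h \<alpha> (Poly_Mapping.single t b)" for s t a b
    by (simp add: mult_single poly_subst_single hom_mult lookup_add power_add prod.distrib mult_ac)
  have "poly_subst h \<alpha> ((\<Sum>s\<in>Poly_Mapping.keys p. Poly_Mapping.single s (Poly_Mapping.lookup p s)) *
        (\<Sum>t\<in>Poly_Mapping.keys q. Poly_Mapping.single t (Poly_Mapping.lookup q t))) =
      poly_subst h \<alpha> (\<Sum>s\<in>Poly_Mapping.keys p. Poly_Mapping.single s (Poly_Mapping.lookup p s)) *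
      poly_subst h \<alpha> (\<Sum>t\<in>Poly_Mapping.keys q. Poly_Mapping.single t (Poly_Mapping.lookup q t))"
    by (simp add: sum_product poly_subst_sum *)
  then show ?thesis unfolding poly_eq_sum_single[symmetric] .
qed

lemma poly_subst_const [simp]: "poly_subst h \<alpha> (const c) = h c"
  by (simp add: const_def poly_subst_single)

lemma poly_subst_one [simp]: "poly_subst h \<alpha> 1 = 1"
  using poly_subst_const[of \<alpha> 1] by (simp add: hom_one)

lemma poly_subst_uminus: "poly_subst h \<alpha> (- p) = - poly_subst h \<alpha> p"
  using poly_subst_add[of \<alpha> p "- p"] by (simp add: eq_neg_iff_add_eq_0 add.commute)

lemma poly_subst_diff: "poly_subst h \<alpha> (p - q) = poly_subst h \<alpha> p - poly_subst h \<alpha> q"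
  using poly_subst_add[of \<alpha> p "- q"] by (simp add: poly_subst_uminus)

lemma poly_subst_power: "poly_subst h \<alpha> (p ^ n) = poly_subst h \<alpha> p ^ n"
  by (induction n) (auto simp: poly_subst_mult)

lemma poly_subst_prod: "poly_subst h \<alpha> (prod f X) = (\<Prod>x\<in>X. poly_subst h \<alpha> (f x))"
  by (induction X rule: infinite_finite_induct) (auto simp: poly_subst_mult)

lemma poly_subst_var [simp]: "poly_subst h \<alpha> (var v) = \<alpha> v"
proof -
  have "(\<Prod>w\<in>UNIV. \<alpha> w ^ Poly_Mapping.lookup (Poly_Mapping.single v (1::nat)) w)
      = (\<Prod>w\<in>UNIV. if w = v then \<alpha> v else 1)"
    by (intro prod.cong) (auto simp: lookup_single when_def)
  then show ?thesis by (simp add: var_def poly_subst_single hom_one)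
qed

end

interpretation subst: coeff_hom const
  by unfold_locales auto

interpretation eval: coeff_hom "\<lambda>c. c"
  by unfold_locales auto

lemma poly_at_simps:
  "poly_at (p + q) x = poly_at p x + poly_at q x" "poly_at (p * q) x = poly_at p x * poly_at q x"
  "poly_at (p - q) x = poly_at p x - poly_at q x" "poly_at (- p) x = - poly_at p x"
  "poly_at (p ^ n) x = poly_at p x ^ n"
  "poly_at 0 x = 0" "poly_at 1 x = 1" "poly_at (const c) x = c" "poly_at (var v) x = x $ v"
  unfolding poly_at_def
  by (simp_all only: eval.poly_subst_add eval.poly_subst_mult eval.poly_subst_diff
      eval.poly_subst_uminus eval.poly_subst_power eval.poly_subst_zero eval.poly_subst_one
      eval.poly_subst_const eval.poly_subst_var)

lemma poly_at_sum: "poly_at (sum f X) x = (\<Sum>y\<in>X. poly_at (f y) x)"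
  by (simp add: poly_at_def eval.poly_subst_sum)

lemma poly_at_prod: "poly_at (prod f X) x = (\<Prod>y\<in>X. poly_at (f y) x)"
  by (simp add: poly_at_def eval.poly_subst_prod)

lemma poly_at_subst: "poly_at (poly_subst const \<alpha> p) x = poly_at p (\<chi> v. poly_at (\<alpha> v) x)"
proof -
  have "poly_at (poly_subst const \<alpha> p) x = (\<Sum>t\<in>Poly_Mapping.keys p.
      Poly_Mapping.lookup p t * (\<Prod>v\<in>UNIV. poly_at (\<alpha> v) x ^ Poly_Mapping.lookup t v))"
    unfolding poly_subst_def by (simp only: poly_at_sum poly_at_simps poly_at_prod)
  then show ?thesis by (simp add: poly_at_def[of p] poly_subst_def)
qed

lemma poly_eq_sum_monomials:
  fixes p :: "('a \<Rightarrow>\<^sub>0 'b::comm_monoid_add) \<Rightarrow>\<^sub>0 complex"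
  shows "p = (\<Sum>t\<in>Poly_Mapping.keys p. const (Poly_Mapping.lookup p t) * Poly_Mapping.single t 1)"
proof -
  have "const c * Poly_Mapping.single t 1 = Poly_Mapping.single t c" for t :: "'a \<Rightarrow>\<^sub>0 'b" and c
    unfolding const_def mult_single by simp
  then show ?thesis by (simp only:) (rule poly_eq_sum_single)
qed

lemma single_one_inject:
  "Poly_Mapping.single v (Suc 0) = Poly_Mapping.single w (Suc 0) \<Longrightarrow> v = w"
  by (metis lookup_single_eq lookup_single_not_eq nat.distinct(1))

lemma linear_form_eq:
  assumes "homogeneous 1 (p :: 'v::finite cpoly)"
  shows "\<exists>c. p = (\<Sum>v\<in>UNIV. const (c v) * var v)"
proof
  have "\<exists>v. t = Poly_Mapping.single v 1" if "t \<in> Poly_Mapping.keys p" for t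
  proof -
    have "mdeg t = 1" using assms that by (simp add: homogeneous_def)
    then obtain v where "Poly_Mapping.lookup t v = 1" "\<And>w. w \<noteq> v \<Longrightarrow> Poly_Mapping.lookup t w = 0"
      by (auto simp: mdeg_def sum_eq_Suc0_iff)
    then have "t = Poly_Mapping.single v 1"
      by (intro poly_mapping_eqI) (auto simp: lookup_single when_def)
    then show ?thesis ..
  qed
  then have keys: "Poly_Mapping.keys p \<subseteq> (\<lambda>v. Poly_Mapping.single v 1) ` UNIV" by auto
  have "p = (\<Sum>t\<in>Poly_Mapping.keys p. const (Poly_Mapping.lookup p t) * Poly_Mapping.single t 1)"
    by (rule poly_eq_sum_monomials)
  also have "\<dots> = (\<Sum>t\<in>(\<lambda>v. Poly_Mapping.single v 1) ` UNIV.
      const (Poly_Mapping.lookup p t) * Poly_Mapping.single t 1)"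
    using keys by (intro sum.mono_neutral_left) (auto simp: in_keys_iff)
  also have "\<dots> = (\<Sum>v\<in>UNIV. const (Poly_Mapping.lookup p (Poly_Mapping.single v 1)) * var v)"
    unfolding var_def by (subst sum.reindex) (auto intro!: injI dest: single_one_inject)
  finally show "p = (\<Sum>v\<in>UNIV. const (Poly_Mapping.lookup p (Poly_Mapping.single v 1)) * var v)" .
qed

section \<open>Laurent polynomials and sections\<close>

lemma to_laurent_simps:
  "to_laurent (p + q) = to_laurent p + to_laurent q" "to_laurent (p * q) = to_laurent p * to_laurent q"
  "to_laurent (p - q) = to_laurent p - to_laurent q" "to_laurent (p ^ n) = to_laurent p ^ n"
  "to_laurent 0 = 0" "to_laurent 1 = 1" "to_laurent (const c) = const c" "to_laurent (var v) = var v"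
  unfolding to_laurent_def
  by (simp_all only: subst.poly_subst_add subst.poly_subst_mult subst.poly_subst_diff
      subst.poly_subst_power subst.poly_subst_zero subst.poly_subst_one
      subst.poly_subst_const subst.poly_subst_var)

lemma to_laurent_sum: "to_laurent (sum f X) = (\<Sum>x\<in>X. to_laurent (f x))"
  by (simp add: to_laurent_def subst.poly_subst_sum)

lemma to_laurent_prod: "to_laurent (prod f X) = (\<Prod>x\<in>X. to_laurent (f x))"
  by (simp add: to_laurent_def subst.poly_subst_prod)

lemma lookup_map_int [simp]:
  "Poly_Mapping.lookup (Poly_Mapping.map int t) v = int (Poly_Mapping.lookup t v)"
  by (simp add: Poly_Mapping.map.rep_eq when_def)

lemma map_int_inject: "Poly_Mapping.map int s = Poly_Mapping.map int t \<Longrightarrow> s = t"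
  by (metis lookup_map_int nat_int poly_mapping_eqI)

lemma mdeg_map_int: "mdeg (Poly_Mapping.map int t) = int (mdeg t)"
  by (simp add: mdeg_def)

lemma var_power: "(var v :: 'v claurent) ^ n = Poly_Mapping.single (Poly_Mapping.single v (int n)) 1"
proof (induction n)
  case (Suc n)
  then show ?case by (simp add: var_def mult_single single_add[symmetric])
qed (simp add: single_zero)

lemma prod_single: "finite X \<Longrightarrow> (\<Prod>x\<in>X. Poly_Mapping.single (f x) (1 :: complex)) = Poly_Mapping.single (sum f X) 1"
  by (induction X rule: finite_induct) (auto simp: mult_single)

lemma to_laurent_single:
  "to_laurent (Poly_Mapping.single t c) = Poly_Mapping.single (Poly_Mapping.map int t) c"
proof -
  have "(\<Sum>v\<in>UNIV. Poly_Mapping.single v (int (Poly_Mapping.lookup t v))) = Poly_Mapping.map int t"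
    by (rule poly_mapping_eqI) (simp add: lookup_sum lookup_single when_def)
  then show ?thesis
    by (simp add: to_laurent_def subst.poly_subst_single var_power prod_single const_def mult_single)
qed

lemma lookup_to_laurent:
  "Poly_Mapping.lookup (to_laurent p) (Poly_Mapping.map int t) = Poly_Mapping.lookup p t"
proof -
  have "to_laurent p = (\<Sum>s\<in>Poly_Mapping.keys p.
      Poly_Mapping.single (Poly_Mapping.map int s) (Poly_Mapping.lookup p s))"
    unfolding to_laurent_single[symmetric] to_laurent_sum[symmetric] poly_eq_sum_single[symmetric] ..
  moreover have "(Poly_Mapping.map int s = Poly_Mapping.map int t) = (s = t)" for s
    using map_int_inject by blast
  ultimately show ?thesis by (simp add: lookup_sum lookup_single when_def in_keys_iff)
qed

lemma to_laurent_inject: "to_laurent p = to_laurent q \<Longrightarrow> p = q"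
  by (metis lookup_to_laurent poly_mapping_eqI)

lemma keys_to_laurent: "Poly_Mapping.keys (to_laurent p) = Poly_Mapping.map int ` Poly_Mapping.keys p"
proof
  have "to_laurent p = (\<Sum>s\<in>Poly_Mapping.keys p.
      Poly_Mapping.single (Poly_Mapping.map int s) (Poly_Mapping.lookup p s))"
    unfolding to_laurent_single[symmetric] to_laurent_sum[symmetric] poly_eq_sum_single[symmetric] ..
  then show "Poly_Mapping.keys (to_laurent p) \<subseteq> Poly_Mapping.map int ` Poly_Mapping.keys p"
    using keys_sum[of "\<lambda>s. Poly_Mapping.single (Poly_Mapping.map int s) (Poly_Mapping.lookup p s)"
        "Poly_Mapping.keys p"] by (auto split: if_splits)
qed (auto simp: in_keys_iff lookup_to_laurent)

lemma homogeneous_to_laurent [simp]: "homogeneous (int d) (to_laurent p) = homogeneous d p"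
  by (auto simp: homogeneous_def keys_to_laurent mdeg_map_int)

lemma to_laurent_preimage:
  assumes "\<And>s v. s \<in> Poly_Mapping.keys f \<Longrightarrow> 0 \<le> Poly_Mapping.lookup s v"
  obtains p where "f = to_laurent p"
proof
  have s: "Poly_Mapping.map int (Poly_Mapping.map nat s) = s" if "s \<in> Poly_Mapping.keys f" for s
  proof (rule poly_mapping_eqI)
    show "Poly_Mapping.lookup (Poly_Mapping.map int (Poly_Mapping.map nat s)) v = Poly_Mapping.lookup s v" for v
      using assms[OF that, of v] by (simp add: Poly_Mapping.map.rep_eq when_def)
  qed
  show "f = to_laurent (\<Sum>s\<in>Poly_Mapping.keys f.
      Poly_Mapping.single (Poly_Mapping.map nat s) (Poly_Mapping.lookup f s))"
    unfolding to_laurent_sum to_laurent_single using s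
    by (subst poly_eq_sum_single) (intro sum.cong, auto)
qed

definition ivar :: "'v \<Rightarrow> 'v claurent" where
  "ivar v = Poly_Mapping.single (Poly_Mapping.single v (- 1)) 1"

lemma var_ivar: "var v * ivar v = 1" "ivar v * var v = 1"
  by (simp_all add: var_def ivar_def mult_single single_add[symmetric])

lemma var_ivar_power: "var v ^ n * (ivar v ^ n * f) = f" "ivar v ^ n * (var v ^ n * f) = f"
  by (simp_all add: mult.assoc[symmetric] power_mult_distrib[symmetric] var_ivar)

lemma homogeneous_ivar_power: "homogeneous (- int n) (ivar v ^ n)"
  using homogeneous_power[of "-1" "ivar v" n] by (simp add: ivar_def homogeneous_single)

definition vars :: "'v set \<Rightarrow> 'v::finite cpoly" where
  "vars W = (\<Prod>v\<in>W. var v)"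

lemma to_laurent_vars: "to_laurent (vars W) = (\<Prod>v\<in>W. var v)"
  by (simp add: vars_def to_laurent_prod to_laurent_simps)

lemma vars_singleton [simp]: "vars {v} = var v"
  by (simp add: vars_def)

lemma homogeneous_vars: "homogeneous (card W) (vars W :: 'v::finite cpoly)"
  using homogeneous_prod[of W "\<lambda>_. 1 :: nat" "var"] by (simp add: vars_def)

lemma sections_iff:
  "f \<in> sections I W d \<longleftrightarrow> homogeneous d f \<and> (\<exists>m. \<exists>p\<in>I. to_laurent (vars W ^ m) * f = to_laurent p)"
  by (auto simp: sections_def to_laurent_simps to_laurent_vars image_iff)

lemma sections_homogeneous: "f \<in> sections I W d \<Longrightarrow> homogeneous d f"
  by (simp add: sections_def)

text \<open>Every larger power of the denominator works as well, so that finitely many sections can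
  be brought to one common exponent.\<close>

lemma sections_numerator:
  assumes "f \<in> sections I W d"
  shows "\<exists>m0. \<forall>m\<ge>m0. \<exists>p. to_laurent (vars W ^ m) * f = to_laurent p \<and>
    homogeneous (int (m * card W) + d) (to_laurent p)"
proof -
  have W: "homogeneous (int (m * card W)) (to_laurent (vars W ^ m))" for m
    unfolding homogeneous_to_laurent using homogeneous_power[OF homogeneous_vars[of W], of m] by simp
  obtain m0 p where p: "to_laurent (vars W ^ m0) * f = to_laurent p"
    using assms sections_iff by blast
  have "\<exists>q. to_laurent (vars W ^ m) * f = to_laurent q \<and>
    homogeneous (int (m * card W) + d) (to_laurent q)" if "m \<ge> m0" for m
  proof -
    have "to_laurent (vars W ^ m) * f = to_laurent (vars W ^ (m - m0)) * (to_laurent (vars W ^ m0) * f)"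
      using that by (simp add: to_laurent_simps mult.assoc[symmetric] power_add[symmetric])
    also have "\<dots> = to_laurent (vars W ^ (m - m0) * p)" by (simp add: p[symmetric] to_laurent_simps(2))
    finally have "to_laurent (vars W ^ m) * f = to_laurent (vars W ^ (m - m0) * p)" .
    moreover have "homogeneous (int (m * card W) + d) (to_laurent (vars W ^ m) * f)"
      using W sections_homogeneous[OF assms] by (rule homogeneous_mult)
    ultimately show ?thesis by metis
  qed
  then show ?thesis by blast
qed

locale saturated_ideal =
  fixes I :: "'v::finite cpoly set"
  assumes closed: "closed_subscheme I"
begin

lemma zero_mem [simp]: "0 \<in> I"
  and add_mem: "p \<in> I \<Longrightarrow> q \<in> I \<Longrightarrow> p + q \<in> I"
  and mult_mem: "p \<in> I \<Longrightarrow> r * p \<in> I"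
  and homogeneous_part_mem: "p \<in> I \<Longrightarrow> homogeneous_part d p \<in> I"
  and saturation: "(\<And>v. var v ^ m * p \<in> I) \<Longrightarrow> p \<in> I"
  using closed unfolding closed_subscheme_def by blast+

lemma mult_mem': "p \<in> I \<Longrightarrow> p * r \<in> I"
  using mult_mem[of p r] by (simp add: mult.commute)

lemma uminus_mem: "p \<in> I \<Longrightarrow> - p \<in> I"
  using mult_mem[of p "-1"] by simp

lemma diff_mem: "p \<in> I \<Longrightarrow> q \<in> I \<Longrightarrow> p - q \<in> I"
  using add_mem[of p "- q"] uminus_mem[of q] by simp

lemma sum_mem: "(\<And>x. x \<in> X \<Longrightarrow> f x \<in> I) \<Longrightarrow> sum f X \<in> I"
  by (induction X rule: infinite_finite_induct) (auto intro: add_mem)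

lemma mem_cong: "p - q \<in> I \<Longrightarrow> p \<in> I \<longleftrightarrow> q \<in> I"
  using add_mem[of "p - q" q] diff_mem[of p "p - q"] by auto

lemma power_mem_mono: "q ^ m * p \<in> I \<Longrightarrow> m \<le> n \<Longrightarrow> q ^ n * p \<in> I"
  using mult_mem[of "q ^ m * p" "q ^ (n - m)"] by (simp add: mult.assoc[symmetric] power_add[symmetric])

lemma subspace_I: "module.subspace (\<lambda>c f. const c * f) I"
proof -
  interpret vector_space "\<lambda>c f. const c * (f :: 'v cpoly)" by (rule vector_space_const)
  show ?thesis by (auto simp: subspace_def add_mem mult_mem)
qed

text \<open>Two numerators of one section agree after cross-multiplication with the denominators,
  \<open>to_laurent\<close> being injective. Membership in the localized ideal thus becomes a
  statement about polynomials: the numerator lies in \<open>I\<close> up to a power of the inverted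
  variables.\<close>

lemma sections_mem_iff:
  assumes "homogeneous d f" "to_laurent (vars W ^ m) * f = to_laurent p"
  shows "f \<in> sections I W d \<longleftrightarrow> (\<exists>k. vars W ^ k * p \<in> I)"
proof
  assume "f \<in> sections I W d"
  then obtain k q where q: "q \<in> I" "to_laurent (vars W ^ k) * f = to_laurent q"
    using sections_iff by blast
  have "to_laurent (vars W ^ k * p) = to_laurent (vars W ^ m * q)"
    using assms(2)[symmetric] q(2)[symmetric] by (simp add: to_laurent_simps mult_ac)
  then have "vars W ^ k * p = vars W ^ m * q" by (rule to_laurent_inject)
  then show "\<exists>k. vars W ^ k * p \<in> I" using q(1) mult_mem by metis
next
  assume "\<exists>k. vars W ^ k * p \<in> I"
  then obtain k where "vars W ^ k * p \<in> I" ..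
  moreover have "to_laurent (vars W ^ (k + m)) * f = to_laurent (vars W ^ k * p)"
    using assms(2) by (simp add: to_laurent_simps power_add mult.assoc)
  ultimately show "f \<in> sections I W d" using assms(1) unfolding sections_iff by blast
qed

lemma sections_zero [simp]: "0 \<in> sections I W d"
  unfolding sections_iff using zero_mem by (auto intro!: exI[of _ 0] bexI[of _ 0] simp: to_laurent_simps)

lemma sections_mult:
  assumes "f \<in> sections I W d" "homogeneous d' (to_laurent q)"
  shows "to_laurent q * f \<in> sections I W (d' + d)"
proof -
  obtain k p where p: "p \<in> I" "to_laurent (vars W ^ k) * f = to_laurent p" "homogeneous d f"
    using assms(1) sections_iff by blast
  have "to_laurent (vars W ^ k) * (to_laurent q * f) = to_laurent (q * p)"
    unfolding to_laurent_simps(2) p(2)[symmetric] by (simp add: mult_ac)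
  then show ?thesis unfolding sections_iff using p assms(2) mult_mem homogeneous_mult by blast
qed

lemma sections_const_mult: "f \<in> sections I W d \<Longrightarrow> const c * f \<in> sections I W d"
  using sections_mult[of f W d 0 "const c"] by (simp add: to_laurent_simps)

lemma sections_add:
  assumes "f \<in> sections I W d" "g \<in> sections I W d"
  shows "f + g \<in> sections I W d"
proof -
  obtain k p where p: "p \<in> I" "to_laurent (vars W ^ k) * f = to_laurent p" "homogeneous d f"
    using assms(1) sections_iff by blast
  obtain m q where q: "q \<in> I" "to_laurent (vars W ^ m) * g = to_laurent q" "homogeneous d g"
    using assms(2) sections_iff by blast
  have "to_laurent (vars W ^ (k + m)) * (f + g) = to_laurent (vars W ^ m * p + vars W ^ k * q)"
    using p(2)[symmetric] q(2)[symmetric] by (simp add: to_laurent_simps power_add algebra_simps)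
  moreover have "vars W ^ m * p + vars W ^ k * q \<in> I" using p q by (intro add_mem mult_mem)
  ultimately show ?thesis unfolding sections_iff using p q homogeneous_add by blast
qed

lemma sections_uminus: "f \<in> sections I W d \<Longrightarrow> - f \<in> sections I W d"
  using sections_const_mult[of f W d "-1"] by simp

lemma sections_diff: "f \<in> sections I W d \<Longrightarrow> g \<in> sections I W d \<Longrightarrow> f - g \<in> sections I W d"
  using sections_add[of f W d "- g"] sections_uminus[of g W d] by simp

lemma sections_sum: "(\<And>x. x \<in> X \<Longrightarrow> f x \<in> sections I W d) \<Longrightarrow> sum f X \<in> sections I W d"
  by (induction X rule: infinite_finite_induct) (auto intro: sections_add)

lemma subspace_sections: "module.subspace (\<lambda>c f. const c * f) (sections I W d)"
proof -
  interpret vector_space "\<lambda>c f. const c * (f :: 'v claurent)" by (rule vector_space_const)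
  show ?thesis by (auto simp: subspace_def sections_add sections_const_mult)
qed

text \<open>The definition of saturation asks for one exponent for all variables; the largest of the
  finitely many individual exponents serves.\<close>

lemma saturation_charts:
  assumes "\<And>v. \<exists>m. var v ^ m * p \<in> I"
  shows "p \<in> I"
proof -
  obtain m where m: "\<And>v. var v ^ m v * p \<in> I" using assms by metis
  have "var v ^ (Max (range m)) * p \<in> I" for v
    using m by (rule power_mem_mono) simp
  then show ?thesis by (rule saturation)
qed

end

lemma closed_subscheme_UNIV: "closed_subscheme UNIV"
  by (simp add: closed_subscheme_def)

lemma fraction_mem_sections:
  assumes "homogeneous (int m + d) (to_laurent p)"
  shows "ivar v ^ m * to_laurent p \<in> sections UNIV {v} d"
proof -
  have "homogeneous (- int m + (int m + d)) (ivar v ^ m * to_laurent p)"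
    using assms by (intro homogeneous_mult homogeneous_ivar_power)
  moreover have "to_laurent (vars {v} ^ m) * (ivar v ^ m * to_laurent p) = to_laurent p"
    by (simp add: to_laurent_simps var_ivar_power)
  ultimately show ?thesis unfolding sections_iff by auto
qed

section \<open>Hilbert functions and general linear forms\<close>

text \<open>A lower bound for the Hilbert function of the ring modulo \<open>I\<close>. All of
  \<open>I\<close> may stand in place of its degree \<open>d\<close> part, as combinations of forms
  of degree \<open>d\<close> are again of degree \<open>d\<close>.\<close>

abbreviation hilbert_ge :: "'v::finite cpoly set \<Rightarrow> nat \<Rightarrow> nat \<Rightarrow> bool" where
  "hilbert_ge I d n \<equiv> codim_ge (\<lambda>c f. const c * f) {p. homogeneous d p} I n"

definition hilbert_bounded :: "'v::finite cpoly set \<Rightarrow> nat \<Rightarrow> bool" where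
  "hilbert_bounded I N \<longleftrightarrow> (\<forall>d n. hilbert_ge I d n \<longrightarrow> n \<le> N)"

lemma power_eq_add_multiple: "\<exists>s. x ^ i = y ^ i + (x - y) * s" for x y :: "'a::comm_ring_1"
proof (induction i)
  case (Suc i)
  then obtain s where s: "x ^ i = y ^ i + (x - y) * s" ..
  have "x ^ Suc i = y ^ Suc i + (x - y) * (y ^ i + x * s)"
    by (simp add: s algebra_simps)
  then show ?case ..
qed (auto intro: exI[of _ 0])

text \<open>For fixed \<open>b\<close> these \<open>q\<close> form the radical of the colon ideal of
  \<open>I\<close> by \<open>b\<close>; geometrically, \<open>b\<close> vanishes on the part of the
  scheme where \<open>q\<close> is invertible. Formulated without points, this also covers
  nonreduced schemes.\<close>

definition torsion :: "'v::finite cpoly set \<Rightarrow> 'v cpoly \<Rightarrow> 'v cpoly \<Rightarrow> bool" where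
  "torsion I q b \<longleftrightarrow> (\<exists>m. q ^ m * b \<in> I)"

text \<open>For \<open>degree h \<le> d\<close> this is \<open>q ^ d\<close> times the value of
  \<open>h\<close> at the ratio of \<open>p\<close> and \<open>q\<close>, written without
  division.\<close>

definition homogenization :: "complex poly \<Rightarrow> 'v::finite cpoly \<Rightarrow> 'v cpoly \<Rightarrow> nat \<Rightarrow> 'v cpoly" where
  "homogenization h p q d = (\<Sum>i\<le>d. const (coeff h i) * p ^ i * q ^ (d - i))"

context saturated_ideal
begin

text \<open>Each term of the binomial expansion of the power \<open>m + n\<close> contains
  \<open>p ^ m\<close> or \<open>q ^ n\<close>.\<close>

lemma torsion_add:
  assumes "torsion I p b" "torsion I q b"
  shows "torsion I (p + q) b"
proof -
  obtain m n where m: "p ^ m * b \<in> I" and n: "q ^ n * b \<in> I"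
    using assms unfolding torsion_def by blast
  have "of_nat (m + n choose k) * p ^ k * q ^ (m + n - k) * b \<in> I" if "k \<le> m + n" for k
  proof (cases "k \<ge> m")
    case True
    have "(of_nat (m + n choose k) * q ^ (m + n - k)) * (p ^ k * b) \<in> I"
      using power_mem_mono[OF m True] by (rule mult_mem)
    then show ?thesis by (simp add: mult_ac)
  next
    case False
    then have "n \<le> m + n - k" by simp
    from power_mem_mono[OF n this] have "(of_nat (m + n choose k) * p ^ k) * (q ^ (m + n - k) * b) \<in> I"
      by (rule mult_mem)
    then show ?thesis by (simp add: mult_ac)
  qed
  then have "(p + q) ^ (m + n) * b \<in> I"
    unfolding binomial_ring sum_distrib_right by (intro sum_mem) auto
  then show ?thesis unfolding torsion_def ..
qed

lemma torsion_mult: "torsion I p b \<Longrightarrow> torsion I (r * p) b"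
  unfolding torsion_def using mult_mem[of "p ^ _ * b" "r ^ _"]
  by (auto simp: power_mult_distrib mult.assoc)

lemma torsion_power: "torsion I (q ^ n) b \<Longrightarrow> torsion I q b"
  unfolding torsion_def by (metis power_mult)

lemma torsion_mem: "q \<in> I \<Longrightarrow> torsion I q b"
  unfolding torsion_def by (intro exI[of _ 1]) (simp add: mult_mem')

text \<open>There are \<open>N + 1\<close> monomials of degree \<open>N\<close> in \<open>p\<close>
  and \<open>q\<close>, one more than can be independent modulo \<open>I\<close>. Geometrically, the
  ratio of \<open>p\<close> and \<open>q\<close> takes finitely many values on a finite scheme where
  \<open>q\<close> is nonzero, and they are roots of \<open>h\<close>.\<close>

lemma ex_binary_form:
  assumes bounded: "hilbert_bounded I N" and p: "homogeneous 1 p" and q: "homogeneous 1 q"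
  obtains h where "h \<noteq> 0" "degree h \<le> N" "homogenization h p q N \<in> I"
proof -
  let ?b = "\<lambda>i. p ^ i * q ^ (N - i)"
  have hom: "homogeneous N (?b i)" if "i < Suc N" for i
    using homogeneous_mult[OF homogeneous_linear_power[OF p, of i] homogeneous_linear_power[OF q, of "N - i"]]
      that by simp
  have "\<not> hilbert_ge I N (Suc N)" using bounded unfolding hilbert_bounded_def by (metis Suc_n_not_le_n)
  have "\<not> (\<forall>c. (\<Sum>i<Suc N. const (c i) * ?b i) \<in> I \<longrightarrow> (\<forall>i<Suc N. c i = 0))"
  proof
    assume "\<forall>c. (\<Sum>i<Suc N. const (c i) * ?b i) \<in> I \<longrightarrow> (\<forall>i<Suc N. c i = 0)"
    then have "hilbert_ge I N (Suc N)" using hom by (intro codim_geI[of _ ?b]) auto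
    with \<open>\<not> hilbert_ge I N (Suc N)\<close> show False ..
  qed
  then obtain c where c: "(\<Sum>i\<le>N. const (c i) * ?b i) \<in> I" "\<exists>i\<le>N. c i \<noteq> 0"
    unfolding lessThan_Suc_atMost less_Suc_eq_le by blast
  define h where "h = (\<Sum>i\<le>N. monom (c i) i)"
  have coeff: "coeff h i = (if i \<le> N then c i else 0)" for i by (simp add: h_def coeff_sum)
  show ?thesis
  proof (rule that)
    show "h \<noteq> 0" using c(2) coeff by (metis coeff_0)
    show "degree h \<le> N" by (rule degree_le) (simp add: coeff)
    show "homogenization h p q N \<in> I" using c(1) by (simp add: homogenization_def coeff mult.assoc)
  qed
qed

text \<open>
  Modulo \<open>p + t q\<close> the relation \<open>h(p, q) \<in> I\<close> becomes \<open>h(- t, 1) q\<^sup>N \<in> I\<close>; the exceptional values of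
  \<open>t\<close> are those with \<open>h(- t, 1) = 0\<close>.
\<close>

lemma torsion_pencil:
  assumes bounded: "hilbert_bounded I N" and p: "homogeneous 1 p" and q: "homogeneous 1 q"
  shows "\<exists>F. finite F \<and> (\<forall>t. t \<notin> F \<longrightarrow> (\<forall>b. torsion I (p + const t * q) b \<longrightarrow> torsion I p b \<and> torsion I q b))"
proof -
  obtain h where h: "h \<noteq> 0" "degree h \<le> N" "homogenization h p q N \<in> I"
    using ex_binary_form[OF assms] .
  have "torsion I p b \<and> torsion I q b"
    if t: "poly h (- t) \<noteq> 0" and b: "torsion I (p + const t * q) b" for t b
  proof -
    define w where "w = p + const t * q"
    have w: "w = p - const (- t) * q" by (simp add: w_def)
    have "\<forall>i. \<exists>s. p ^ i = (const (- t) * q) ^ i + w * s" unfolding w using power_eq_add_multiple by blast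
    then obtain s where s: "\<And>i. p ^ i = (const (- t) * q) ^ i + w * s i" by metis
    have "const (coeff h i) * p ^ i * q ^ (N - i) =
        const (coeff h i * (- t) ^ i) * q ^ N + w * (const (coeff h i) * s i * q ^ (N - i))" if "i \<le> N" for i
    proof -
      have "q ^ N = q ^ i * q ^ (N - i)" using that by (simp add: power_add[symmetric])
      moreover have "(const (- t) * q) ^ i = const ((- t) ^ i) * q ^ i"
        by (simp only: power_mult_distrib const_power)
      ultimately show ?thesis unfolding s[of i] const_simps(4) by (simp only:) (simp only: algebra_simps)
    qed
    then have "homogenization h p q N = (\<Sum>i\<le>N. const (coeff h i * (- t) ^ i) * q ^ N
        + w * (const (coeff h i) * s i * q ^ (N - i)))"
      unfolding homogenization_def by (intro sum.cong) auto
    also have "\<dots> = const (\<Sum>i\<le>N. coeff h i * (- t) ^ i) * q ^ N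
        + w * (\<Sum>i\<le>N. const (coeff h i) * s i * q ^ (N - i))"
      by (simp only: sum.distrib const_sum sum_distrib_left sum_distrib_right)
    also have "(\<Sum>i\<le>N. coeff h i * (- t) ^ i) = poly h (- t)"
      unfolding poly_altdef using h(2) by (intro sum.mono_neutral_right) (auto simp: coeff_eq_0)
    finally obtain S where S: "homogenization h p q N = const (poly h (- t)) * q ^ N + w * S" by blast
    have "torsion I (const (poly h (- t)) * q ^ N + w * S) b"
      using h(3) unfolding S by (rule torsion_mem)
    moreover have "torsion I (- S * w) b" using b unfolding w_def by (rule torsion_mult)
    ultimately have "torsion I ((const (poly h (- t)) * q ^ N + w * S) + (- S * w)) b" by (rule torsion_add)
    then have "torsion I (const (poly h (- t)) * q ^ N) b" by (simp add: mult.commute)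
    then have "torsion I (const (inverse (poly h (- t))) * (const (poly h (- t)) * q ^ N)) b" by (rule torsion_mult)
    then have "torsion I (q ^ N) b" unfolding const_mult_cancel[OF t] .
    then have q: "torsion I q b" by (rule torsion_power)
    then have "torsion I (w + (- const t) * q) b"
      by (intro torsion_add[OF b[folded w_def]] torsion_mult)
    with q show ?thesis by (simp add: w_def)
  qed
  moreover have "finite {t. poly h (- t) = 0}"
  proof (rule finite_subset)
    show "{t. poly h (- t) = 0} \<subseteq> uminus ` {t. poly h t = 0}"
      by (auto intro!: image_eqI[of _ _ "- _"])
  qed (use h(1) in \<open>auto intro: poly_roots_finite\<close>)
  ultimately show ?thesis by (intro exI[of _ "{t. poly h (- t) = 0}"]) auto
qed

text \<open>
  Geometrically, a general combination vanishes at no point of the scheme where some \<open>p v j\<close> does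
  not.  For decomposable forms \<open>e\<^sub>j \<otimes> g\<close> on a Segre variety the same \<open>g\<close> has to serve all \<open>j\<close>.
\<close>

lemma general_combination:
  assumes bounded: "hilbert_bounded I N" and "finite W" "finite J"
    and p: "\<And>v j. v \<in> W \<Longrightarrow> j \<in> J \<Longrightarrow> homogeneous 1 (p v j)"
  shows "\<exists>c. \<forall>j\<in>J. \<forall>b. torsion I (\<Sum>v\<in>W. const (c v) * p v j) b \<longrightarrow> (\<forall>v\<in>W. torsion I (p v j) b)"
  using \<open>finite W\<close> p
proof (induction W rule: finite_induct)
  case (insert v W)
  have "\<exists>c. \<forall>j\<in>J. \<forall>b. torsion I (\<Sum>v\<in>W. const (c v) * p v j) b \<longrightarrow> (\<forall>v\<in>W. torsion I (p v j) b)"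
    by (rule insert.IH) (use insert.prems in auto)
  then obtain c where c: "\<forall>j\<in>J. \<forall>b. torsion I (\<Sum>v\<in>W. const (c v) * p v j) b \<longrightarrow>
      (\<forall>v\<in>W. torsion I (p v j) b)" ..
  let ?s = "\<lambda>j. \<Sum>v\<in>W. const (c v) * p v j"
  have "\<exists>F. finite F \<and> (\<forall>t. t \<notin> F \<longrightarrow>
      (\<forall>b. torsion I (?s j + const t * p v j) b \<longrightarrow> torsion I (?s j) b \<and> torsion I (p v j) b))"
    if "j \<in> J" for j
    using insert.prems that
    by (intro torsion_pencil[OF bounded] homogeneous_sum homogeneous_const_mult) auto
  then have "\<forall>j\<in>J. \<exists>F. finite F \<and> (\<forall>t. t \<notin> F \<longrightarrow>
      (\<forall>b. torsion I (?s j + const t * p v j) b \<longrightarrow> torsion I (?s j) b \<and> torsion I (p v j) b))" ..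
  from bchoice[OF this] obtain F where F: "\<And>j. j \<in> J \<Longrightarrow> finite (F j)"
    "\<And>j t b. j \<in> J \<Longrightarrow> t \<notin> F j \<Longrightarrow> torsion I (?s j + const t * p v j) b \<Longrightarrow>
      torsion I (?s j) b \<and> torsion I (p v j) b"
    by blast
  have "finite (\<Union>j\<in>J. F j)" using F(1) \<open>finite J\<close> by blast
  then obtain t where t: "t \<notin> (\<Union>j\<in>J. F j)" using ex_new_if_finite infinite_UNIV_char_0 by blast
  have eq: "(\<Sum>w\<in>insert v W. const ((c(v := t)) w) * p w j) = ?s j + const t * p v j" for j
    using insert.hyps by (simp add: add.commute) (intro sum.cong, auto)
  have "torsion I (p w j) b"
    if "j \<in> J" "torsion I (\<Sum>w\<in>insert v W. const ((c(v := t)) w) * p w j) b" "w \<in> insert v W" for j b w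
  proof -
    have "torsion I (?s j) b \<and> torsion I (p v j) b" using that F(2) t unfolding eq by blast
    with c that show ?thesis by blast
  qed
  then show ?case by (intro exI[of _ "c(v := t)"]) blast
qed auto

section \<open>Nonzerodivisors among the linear forms\<close>

lemma torsion_vars_imp_mem:
  assumes "\<And>v. torsion I (var v) b"
  shows "b \<in> I"
  using assms saturation_charts unfolding torsion_def by blast

text \<open>Whatever a general combination of the coordinates kills up to a power is killed by a
  power of every coordinate, and a saturated ideal contains it.\<close>

lemma ex_nonzerodivisor:
  assumes "hilbert_bounded I N"
  obtains l where "homogeneous 1 l" "\<And>b. torsion I l b \<Longrightarrow> b \<in> I"
proof -
  obtain c where c: "\<And>b v. torsion I (\<Sum>v\<in>UNIV. const (c v) * var v) b \<Longrightarrow> torsion I (var v) b"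
    using general_combination[OF assms, of UNIV "{()}" "\<lambda>v _. var v"] by auto
  show ?thesis
  proof (rule that)
    show "homogeneous 1 (\<Sum>v\<in>UNIV. const (c v) * var v :: 'v cpoly)"
      by (intro homogeneous_sum homogeneous_const_mult homogeneous_var)
  qed (use c torsion_vars_imp_mem in blast)
qed

text \<open>Dividing forms of degree \<open>d\<close> by \<open>var v ^ d\<close> maps them to all
  charts at once, and by saturation only those in \<open>I\<close> die on every chart. So no graded
  piece exceeds the sum of the dimensions of the chart rings.\<close>

lemma zero_dimensional_imp_bounded:
  assumes "zero_dimensional I"
  obtains N where "hilbert_bounded I N"
proof -
  obtain D where D: "\<And>v. quotient_dim (\<lambda>c f. const c * f) (sections UNIV {v} 0) (sections I {v} 0) (D v)"
    using assms unfolding zero_dimensional_def by metis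
  have "n \<le> (\<Sum>v\<in>UNIV. D v)" if "hilbert_ge I d n" for d n
  proof (rule ccontr)
    assume "\<not> n \<le> (\<Sum>v\<in>UNIV. D v)"
    \<comment> \<open>One equation for each chart and each generator of its ring; more forms than
      that admit a combination vanishing on all charts.\<close>
    then have card: "card (SIGMA v:UNIV. {..<D v}) < n" by simp
    obtain b where b: "\<And>i. i < n \<Longrightarrow> homogeneous d (b i)"
      "\<And>c. (\<Sum>i<n. const (c i) * b i) \<in> I \<Longrightarrow> \<forall>i<n. c i = 0"
      using \<open>hilbert_ge I d n\<close> unfolding codim_ge_def by blast
    define g where "g v i = ivar v ^ d * to_laurent (b i)" for v i
    have g: "g v i \<in> sections UNIV {v} 0" if "i < n" for v i
      using b(1)[OF that] unfolding g_def by (intro fraction_mem_sections) simp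
    have "\<exists>\<beta>. \<forall>f\<in>sections UNIV {v} 0. \<exists>c. f - (\<Sum>j<D v. const (c j) * \<beta> j) \<in> sections I {v} 0" for v
      by (rule quotient_dim_spanning[OF D])
    then have "\<forall>v. \<exists>\<beta>. \<forall>f\<in>sections UNIV {v} 0. \<exists>c. f - (\<Sum>j<D v. const (c j) * \<beta> j) \<in> sections I {v} 0" ..
    from choice[OF this] obtain \<beta> where \<beta>: "\<forall>v. \<forall>f\<in>sections UNIV {v} 0.
        \<exists>c. f - (\<Sum>j<D v. const (c j) * \<beta> v j) \<in> sections I {v} 0" ..
    have "\<exists>c. i < n \<longrightarrow> g v i - (\<Sum>j<D v. const (c j) * \<beta> v j) \<in> sections I {v} 0" for v i
      using bspec[OF spec[OF \<beta>] g, of i v] by (cases "i < n") auto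
    then have "\<forall>v. \<forall>i. \<exists>c. i < n \<longrightarrow> g v i - (\<Sum>j<D v. const (c j) * \<beta> v j) \<in> sections I {v} 0"
      by (intro allI)
    then have "\<exists>c. \<forall>v i. i < n \<longrightarrow> g v i - (\<Sum>j<D v. const (c v i j) * \<beta> v j) \<in> sections I {v} 0"
      unfolding choice_iff .
    then obtain c where c: "\<And>v i. i < n \<Longrightarrow> g v i - (\<Sum>j<D v. const (c v i j) * \<beta> v j) \<in> sections I {v} 0"
      by blast
    obtain x where x: "\<exists>i<n. x i \<noteq> 0"
      "\<And>vj. vj \<in> (SIGMA v:UNIV. {..<D v}) \<Longrightarrow> (\<Sum>i<n. x i * c (fst vj) i (snd vj)) = 0"
      using homogeneous_system_nat[of "SIGMA v:UNIV. {..<D v}" n "\<lambda>i vj. c (fst vj) i (snd vj)"] card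
      by auto
    have "(\<Sum>i<n. const (x i) * b i) \<in> I"
    proof (rule saturation_charts)
      fix v
      have "(\<Sum>i<n. const (x i) * (g v i - (\<Sum>j<D v. const (c v i j) * \<beta> v j))) \<in> sections I {v} 0"
        using c by (intro sections_sum sections_const_mult) auto
      moreover have "(\<Sum>i<n. const (x i) * (\<Sum>j<D v. const (c v i j) * \<beta> v j)) =
          (\<Sum>j<D v. const (\<Sum>i<n. x i * c v i j) * \<beta> v j)"
        unfolding sum_distrib_left const_sum sum_distrib_right
        by (subst sum.swap) (simp add: mult.assoc)
      moreover have "\<dots> = 0" using x(2)[of "(v, _)"] by simp
      ultimately have "(\<Sum>i<n. const (x i) * g v i) \<in> sections I {v} 0"
        by (simp add: right_diff_distrib sum_subtractf)
      moreover have "to_laurent (vars {v} ^ d) * (\<Sum>i<n. const (x i) * g v i)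
          = to_laurent (\<Sum>i<n. const (x i) * b i)"
        unfolding g_def sum_distrib_left
        by (simp add: to_laurent_sum to_laurent_simps sum_distrib_left mult.left_commute[of _ "const _"] var_ivar_power)
      ultimately show "\<exists>m. var v ^ m * (\<Sum>i<n. const (x i) * b i) \<in> I"
        using sections_mem_iff[of 0 _ "{v}" d] sections_homogeneous by fastforce
    qed
    with b(2) x(1) show False by blast
  qed
  then show ?thesis using that unfolding hilbert_bounded_def by blast
qed

text \<open>Functions on a chart that are independent modulo the ideal have a common denominator
  \<open>var v ^ m\<close>, and their numerators are equally many independent forms of degree
  \<open>m\<close>.\<close>

lemma bounded_imp_zero_dimensional:
  assumes "hilbert_bounded I N"
  shows "zero_dimensional I"
  unfolding zero_dimensional_def
proof
  fix v
  show "\<exists>d. quotient_dim (\<lambda>c f. const c * f) (sections UNIV {v} 0) (sections I {v} 0) d"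
  proof (rule ex_quotient_dim[OF vector_space_const subspace_sections])
    fix n assume "codim_ge (\<lambda>c f. const c * f) (sections UNIV {v} 0) (sections I {v} 0) n"
    then obtain b where b: "\<And>i. i < n \<Longrightarrow> b i \<in> sections UNIV {v} 0"
      "\<And>c. (\<Sum>i<n. const (c i) * b i) \<in> sections I {v} 0 \<Longrightarrow> \<forall>i<n. c i = 0"
      unfolding codim_ge_def by blast
    have "\<exists>m0. \<forall>m\<ge>m0. \<exists>p. to_laurent (vars {v} ^ m) * b i = to_laurent p \<and>
      homogeneous (int (m * card {v}) + 0) (to_laurent p)" if "i < n" for i
      using sections_numerator[OF b(1)[OF that]] .
    then obtain m0 where m0: "\<And>i m. i < n \<Longrightarrow> m \<ge> m0 i \<Longrightarrow> \<exists>p. to_laurent (vars {v} ^ m) * b i = to_laurent p \<and>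
      homogeneous (int (m * card {v}) + 0) (to_laurent p)" by metis
    define m where "m = Max (insert 0 (m0 ` {..<n}))"
    have "\<exists>p. to_laurent (vars {v} ^ m) * b i = to_laurent p \<and> homogeneous m p" if "i < n" for i
    proof -
      have "m0 i \<le> m" using that unfolding m_def by (intro Max_ge) auto
      from m0[OF that this] show ?thesis by simp
    qed
    then obtain p where p: "\<And>i. i < n \<Longrightarrow> to_laurent (vars {v} ^ m) * b i = to_laurent (p i) \<and> homogeneous m (p i)"
      by metis
    have "hilbert_ge I m n"
    proof (rule codim_geI)
      fix c assume "(\<Sum>i<n. const (c i) * p i) \<in> I"
      then have "vars {v} ^ 0 * (\<Sum>i<n. const (c i) * p i) \<in> I" by simp
      moreover have "to_laurent (vars {v} ^ m) * (\<Sum>i<n. const (c i) * b i) = to_laurent (\<Sum>i<n. const (c i) * p i)"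
        unfolding to_laurent_sum sum_distrib_left using p
        by (intro sum.cong) (auto simp: to_laurent_simps(2,7) mult.left_commute[of _ "const _"])
      moreover have "homogeneous 0 (\<Sum>i<n. const (c i) * b i)"
        using b(1) by (intro homogeneous_sum homogeneous_const_mult) (auto dest: sections_homogeneous)
      ultimately have "(\<Sum>i<n. const (c i) * b i) \<in> sections I {v} 0"
        using sections_mem_iff by blast
      then show "\<forall>i<n. c i = 0" by (rule b(2))
    qed (use p in auto)
    then show "n \<le> N" using assms unfolding hilbert_bounded_def by blast
  qed
qed

end

section \<open>Length and first cohomology\<close>

lemma var_power_nat: "(var v :: 'v cpoly) ^ n = Poly_Mapping.single (Poly_Mapping.single v n) 1"
proof (induction n)
  case (Suc n)
  then show ?case by (simp add: var_def mult_single single_add[symmetric])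
qed simp

lemma ivar_power: "ivar v ^ n = Poly_Mapping.single (Poly_Mapping.single v (- int n)) 1"
proof (induction n)
  case (Suc n)
  then show ?case by (simp add: ivar_def mult_single single_add[symmetric])
qed simp

lemma monomial_split:
  assumes "N \<le> Poly_Mapping.lookup t v"
  shows "Poly_Mapping.single t (1 :: complex) = var v ^ N * Poly_Mapping.single (t - Poly_Mapping.single v N) 1"
    and "N + mdeg (t - Poly_Mapping.single v N) = mdeg (t :: 'v::finite \<Rightarrow>\<^sub>0 nat)"
proof -
  have t: "t = Poly_Mapping.single v N + (t - Poly_Mapping.single v N)"
    using assms by (intro poly_mapping_eqI) (auto simp: lookup_add lookup_minus lookup_single when_def)
  show "Poly_Mapping.single t (1 :: complex) = var v ^ N * Poly_Mapping.single (t - Poly_Mapping.single v N) 1"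
    using t by (simp add: var_power_nat mult_single)
  show "N + mdeg (t - Poly_Mapping.single v N) = mdeg t"
    using arg_cong[OF t, of mdeg] by (simp add: mdeg_add)
qed

text \<open>Pigeonhole on the exponents. It transfers what holds on each chart after multiplication
  by \<open>var v ^ N\<close> to every form of large degree.\<close>

lemma monomial_divisible:
  assumes "N * CARD('v) \<le> mdeg t"
  obtains v t' where "Poly_Mapping.single (t :: 'v::finite \<Rightarrow>\<^sub>0 nat) (1 :: complex) = var v ^ N * Poly_Mapping.single t' 1"
    and "N + mdeg t' = mdeg t"
proof -
  have "\<exists>v. N \<le> Poly_Mapping.lookup t v"
  proof (rule ccontr)
    assume "\<nexists>v. N \<le> Poly_Mapping.lookup t v"
    then have "(\<Sum>v\<in>UNIV. Poly_Mapping.lookup t v) < (\<Sum>v\<in>(UNIV::'v set). N)"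
      by (intro sum_strict_mono) (auto simp: not_le)
    with assms show False by (simp add: mdeg_def mult.commute)
  qed
  then show ?thesis using monomial_split that by blast
qed

text \<open>On the chart of \<open>i\<close> only the exponent of \<open>var i\<close> can be
  negative, and any second chart excludes that.\<close>

lemma global_section:
  assumes s: "\<And>i. s \<in> sections UNIV {i :: 'v::finite} (int d)"
  obtains P where "s = to_laurent P" "homogeneous d P"
proof -
  have *: "0 \<le> Poly_Mapping.lookup t v" if t: "t \<in> Poly_Mapping.keys s" and "v \<noteq> i" for t v i
  proof -
    obtain m p where "to_laurent (vars {i} ^ m) * s = to_laurent p" using s[of i] sections_iff by blast
    then have "s = ivar i ^ m * to_laurent p"
      by (metis to_laurent_simps(4,8) vars_singleton var_ivar_power(2))
    then obtain a b where "t = a + b" "a \<in> Poly_Mapping.keys (ivar i ^ m)" "b \<in> Poly_Mapping.keys (to_laurent p)"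
      using keys_mult[of "ivar i ^ m" "to_laurent p"] t by blast
    then show ?thesis using \<open>v \<noteq> i\<close>
      by (auto simp: ivar_power keys_to_laurent lookup_add lookup_single when_def)
  qed
  have "0 \<le> Poly_Mapping.lookup t v" if t: "t \<in> Poly_Mapping.keys s" for t v
  proof (cases "\<exists>i. i \<noteq> v")
    case False
    \<comment> \<open>With a single variable there is no second chart; its exponent is then the
      degree \<open>d\<close>, a natural number.\<close>
    then have "UNIV = {v}" by auto
    have "Poly_Mapping.lookup t v = mdeg t" unfolding mdeg_def \<open>UNIV = {v}\<close> by simp
    also have "\<dots> = int d" using s t by (auto simp: sections_def homogeneous_def)
    finally show ?thesis by simp
  next
    case True
    then obtain i where "v \<noteq> i" by metis
    from *[OF t this] show ?thesis .
  qed
  then obtain P where "s = to_laurent P" using to_laurent_preimage by blast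
  moreover have "homogeneous (int d) s" using s sections_homogeneous by blast
  ultimately show ?thesis using that by simp
qed

interpretation whole: saturated_ideal UNIV
  by unfold_locales (rule closed_subscheme_UNIV)

context saturated_ideal
begin

lemma sections_restrict:
  assumes "W \<subseteq> W'" "f \<in> sections I W d"
  shows "f \<in> sections I W' d"
proof -
  obtain k p where p: "p \<in> I" "to_laurent (vars W ^ k) * f = to_laurent p" "homogeneous d f"
    using assms(2) sections_iff by blast
  have "vars W' = vars (W' - W) * vars W"
    using prod.subset_diff[OF assms(1), of var] by (simp add: vars_def)
  then have "to_laurent (vars W' ^ k) * f = to_laurent (vars (W' - W) ^ k) * (to_laurent (vars W ^ k) * f)"
    by (simp add: power_mult_distrib to_laurent_simps mult.assoc)
  also have "\<dots> = to_laurent (vars (W' - W) ^ k * p)"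
    unfolding to_laurent_simps(2) p(2) ..
  finally show ?thesis unfolding sections_iff using p mult_mem by blast
qed

lemma sections_polynomial_iff:
  assumes "homogeneous M F"
  shows "to_laurent F \<in> sections I {v} (int M) \<longleftrightarrow> (\<exists>k. var v ^ k * F \<in> I)"
  using sections_mem_iff[of "int M" "to_laurent F" "{v}" 0 F] assms by (simp add: to_laurent_simps)

lemma sections_all_charts:
  assumes "homogeneous M F" "\<And>v. to_laurent F \<in> sections I {v} (int M)"
  shows "F \<in> I"
  using assms sections_polynomial_iff saturation_charts by blast

lemma subspace_length_zero:
  "module.subspace (\<lambda>c f. const c *s f) {f :: 'v claurent ^ 'v. \<forall>i. f $ i \<in> sections I {i} 0}"
proof -
  interpret vector_space "\<lambda>c f. const c *s (f :: 'v claurent ^ 'v)" by (rule vector_space_const_vec)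
  show ?thesis by (auto simp: subspace_def sections_add sections_const_mult)
qed

end

text \<open>The maximum of the Hilbert function with a degree that attains it. Given a linear
  nonzerodivisor, the value persists in all higher degrees and is the length of the scheme.\<close>

definition hilbert_limit :: "'v::finite cpoly set \<Rightarrow> nat \<Rightarrow> nat \<Rightarrow> bool" where
  "hilbert_limit I d0 r \<longleftrightarrow> hilbert_ge I d0 r \<and> (\<forall>d. \<not> hilbert_ge I d (Suc r))"

lemma ex_hilbert_limit:
  assumes "hilbert_bounded I N"
  obtains d0 r where "hilbert_limit I d0 r"
proof -
  define P where "P n \<longleftrightarrow> (\<exists>d. hilbert_ge I d n)" for n
  have "hilbert_ge I 0 0" by (rule codim_geI) auto
  then have 0: "P 0" unfolding P_def ..
  have b: "n \<le> N" if "P n" for n using assms that unfolding P_def hilbert_bounded_def by blast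
  have P: "P (GREATEST n. P n)" by (rule GreatestI_nat[of P 0 N, OF 0 b])
  have "n \<le> (GREATEST n. P n)" if "P n" for n by (rule Greatest_le_nat[of P n N, OF that b])
  then have "\<not> P (Suc (GREATEST n. P n))" by fastforce
  with P show ?thesis using that unfolding P_def hilbert_limit_def by blast
qed

text \<open>The hyperplane of \<open>l\<close> misses the scheme. So \<open>l\<close> can be
  cancelled modulo \<open>I\<close>, in polynomials and in sections, and it trivializes the twists
  of the structure sheaf.\<close>

locale regular_section = saturated_ideal I for I :: "'v::finite cpoly set" +
  fixes l :: "'v cpoly"
  assumes linear: "homogeneous 1 l" and regular: "torsion I l b \<Longrightarrow> b \<in> I"
begin

lemma power_cancel: "l ^ m * b \<in> I \<Longrightarrow> b \<in> I"
  using regular unfolding torsion_def by blast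

lemma homogeneous_l_power: "homogeneous k (l ^ k)"
  using linear by (rule homogeneous_linear_power)

lemma homogeneous_l_power_mult: "homogeneous d p \<Longrightarrow> homogeneous (k + d) (l ^ k * p)"
  using homogeneous_l_power by (rule homogeneous_mult)

lemma hilbert_ge_mono:
  assumes "hilbert_ge I d n"
  shows "hilbert_ge I (k + d) n"
  using assms
proof (rule codim_ge_transfer[where R = "\<lambda>v v'. v' = l ^ k * v"])
  fix c and b b' :: "nat \<Rightarrow> 'v cpoly"
  assume "\<And>i. i < n \<Longrightarrow> b' i = l ^ k * b i" "(\<Sum>i<n. const (c i) * b' i) \<in> I"
  then have "l ^ k * (\<Sum>i<n. const (c i) * b i) \<in> I" by (simp add: sum_distrib_left mult.left_commute)
  then show "(\<Sum>i<n. const (c i) * b i) \<in> I" by (rule power_cancel)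
qed (auto intro: homogeneous_l_power_mult)

lemma hilbert_limit_mono: "hilbert_limit I d0 r \<Longrightarrow> d0 \<le> d \<Longrightarrow> hilbert_limit I d r"
  using hilbert_ge_mono[of d0 r "d - d0"] unfolding hilbert_limit_def by simp

text \<open>Multiplication by \<open>l ^ k\<close> carries \<open>r\<close> independent elements of
  degree \<open>d\<close> to independent ones of degree \<open>k + d\<close>; as \<open>r\<close> is
  the maximum, these span, and every form of that degree is divisible by \<open>l ^ k\<close> modulo
  \<open>I\<close>.\<close>

lemma hilbert_limit_lift:
  assumes "hilbert_limit I d r" "homogeneous (k + d) F"
  obtains F' where "homogeneous d F'" "F - l ^ k * F' \<in> I"
proof -
  obtain b where b: "\<And>i. i < r \<Longrightarrow> homogeneous d (b i)"
    "\<And>c. (\<Sum>i<r. const (c i) * b i) \<in> I \<Longrightarrow> \<forall>i<r. c i = 0"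
    using assms(1) unfolding hilbert_limit_def codim_ge_def by blast
  have sum: "(\<Sum>i<r. const (c i) * (l ^ k * b i)) = l ^ k * (\<Sum>i<r. const (c i) * b i)" for c
    by (simp add: sum_distrib_left mult.left_commute)
  have "\<exists>c. F - (\<Sum>i<r. const (c i) * (l ^ k * b i)) \<in> I"
  proof (rule dependent_extension[OF vector_space_const subspace_I])
    show "\<not> hilbert_ge I (k + d) (Suc r)" using assms(1) by (simp add: hilbert_limit_def)
    show "(\<Sum>i<r. const (c i) * (l ^ k * b i)) \<in> I \<Longrightarrow> \<forall>i<r. c i = 0" for c
      unfolding sum by (rule b(2)[OF power_cancel])
  qed (use b assms in \<open>auto intro: homogeneous_l_power_mult\<close>)
  then obtain c where c: "F - l ^ k * (\<Sum>i<r. const (c i) * b i) \<in> I" unfolding sum ..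
  have "homogeneous d (\<Sum>i<r. const (c i) * b i)"
    using b(1) by (intro homogeneous_sum homogeneous_const_mult) auto
  then show ?thesis using c that by blast
qed

lemma sections_cancel:
  assumes f: "f \<in> sections UNIV W d" and lf: "to_laurent (l ^ k) * f \<in> sections I W d'"
  shows "f \<in> sections I W d"
proof -
  obtain m p where p: "to_laurent (vars W ^ m) * f = to_laurent p" using f sections_iff by blast
  have "to_laurent (vars W ^ m) * (to_laurent (l ^ k) * f) = to_laurent (l ^ k * p)"
    unfolding to_laurent_simps(2) p[symmetric] by (simp add: mult_ac)
  then obtain j where "vars W ^ j * (l ^ k * p) \<in> I"
    using sections_mem_iff[OF sections_homogeneous[OF lf]] lf by blast
  then have "l ^ k * (vars W ^ j * p) \<in> I" by (simp add: mult_ac)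
  then have "vars W ^ j * p \<in> I" by (rule power_cancel)
  then show ?thesis using sections_mem_iff[OF sections_homogeneous[OF f] p] by blast
qed

text \<open>The \<open>f i\<close> represent the quotient of \<open>F\<close> by
  \<open>l ^ k\<close>. On each chart a power of the variable raises \<open>F\<close> to a degree
  where \<open>hilbert_limit_lift\<close> can divide; on overlaps the quotients agree modulo the
  ideal because \<open>l\<close> cancels.\<close>

lemma local_quotients:
  assumes lim: "hilbert_limit I d0 r" and F: "homogeneous M F" and M: "int M = int k + e"
  obtains f where "\<And>i. f i \<in> sections UNIV {i} e"
    and "\<And>i. to_laurent (l ^ k) * f i - to_laurent F \<in> sections I {i} (int M)"
    and "\<And>i j. f i - f j \<in> sections I {i, j} e"
proof -
  \<comment> \<open>\<open>e\<close> may be negative; the absolute value still makes the degree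
    \<open>D\<close> of the numerators, which is \<open>N + e\<close>, at least
    \<open>d0\<close>.\<close>
  define N where "N = nat (int d0 + \<bar>e\<bar>)"
  define D where "D = nat (int N + e)"
  have D: "int D = int N + e" "d0 \<le> D" "k + D = N + M" using M unfolding D_def N_def by auto
  have "\<exists>g. homogeneous D g \<and> var i ^ N * F - l ^ k * g \<in> I" for i
  proof -
    have "homogeneous (k + D) (var i ^ N * F)"
      unfolding D(3) by (intro homogeneous_mult homogeneous_linear_power homogeneous_var F)
    from hilbert_limit_lift[OF hilbert_limit_mono[OF lim D(2)] this] show ?thesis by blast
  qed
  then obtain g where g: "\<And>i. homogeneous D (g i)" "\<And>i. var i ^ N * F - l ^ k * g i \<in> I" by metis
  define f where "f i = ivar i ^ N * to_laurent (g i)" for i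
  have f: "f i \<in> sections UNIV {i} e" for i
    unfolding f_def using g(1)[of i] by (intro fraction_mem_sections) (simp add: D(1)[symmetric])
  have lf: "to_laurent (l ^ k) * f i - to_laurent F \<in> sections I {i} (int M)" for i
  proof -
    have "homogeneous (int k + e) (to_laurent (l ^ k) * f i)"
      using sections_homogeneous[OF f] homogeneous_l_power by (intro homogeneous_mult) auto
    then have "homogeneous (int M) (to_laurent (l ^ k) * f i - to_laurent F)"
      unfolding M[symmetric] using F by (intro homogeneous_diff) auto
    moreover have "to_laurent (vars {i} ^ N) * (to_laurent (l ^ k) * f i - to_laurent F)
        = to_laurent (l ^ k * g i - var i ^ N * F)"
      by (simp add: f_def to_laurent_simps right_diff_distrib mult.left_commute[of _ "to_laurent l ^ k"] var_ivar_power)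
    moreover have "vars {i} ^ 0 * (l ^ k * g i - var i ^ N * F) \<in> I"
      using uminus_mem[OF g(2)[of i]] by simp
    ultimately show ?thesis using sections_mem_iff by blast
  qed
  have "f i - f j \<in> sections I {i, j} e" for i j
  proof (rule sections_cancel)
    show "f i - f j \<in> sections UNIV {i, j} e"
      by (rule whole.sections_diff) (rule whole.sections_restrict[OF _ f], simp)+
    have "(to_laurent (l ^ k) * f i - to_laurent F) - (to_laurent (l ^ k) * f j - to_laurent F)
        \<in> sections I {i, j} (int M)"
      by (rule sections_diff) (rule sections_restrict[OF _ lf], simp)+
    then show "to_laurent (l ^ k) * (f i - f j) \<in> sections I {i, j} (int M)"
      by (simp add: right_diff_distrib)
  qed
  with f lf show ?thesis using that by blast
qed

text \<open>Agreement on an overlap gives a congruence of numerators only after multiplication by a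
  power of \<open>var i * var j\<close>. Expanding all fractions by \<open>K\<close>, the largest
  exponent needed, makes the congruence hold outright.\<close>

lemma common_denominator:
  assumes f: "\<And>i. f i \<in> sections UNIV {i} 0" and comp: "\<And>i j. f i - f j \<in> sections I {i, j} 0"
  obtains N p where "\<And>i. homogeneous N (p i)" "\<And>i. to_laurent (vars {i} ^ N) * f i = to_laurent (p i)"
    "\<And>i j. var j ^ N * p i - var i ^ N * p j \<in> I"
proof -
  have "\<exists>m0. \<forall>m\<ge>m0. \<exists>p. to_laurent (vars {i} ^ m) * f i = to_laurent p \<and>
      homogeneous (int (m * card {i}) + 0) (to_laurent p)" for i
    by (rule sections_numerator[OF f])
  then obtain m0 where m0: "\<And>i m. m \<ge> m0 i \<Longrightarrow> \<exists>p. to_laurent (vars {i} ^ m) * f i = to_laurent p \<and>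
      homogeneous (int (m * card {i}) + 0) (to_laurent p)" by metis
  define N where "N = Max (range m0)"
  have "\<exists>p. to_laurent (vars {i} ^ N) * f i = to_laurent p \<and> homogeneous N p" for i
    using m0[of i N] unfolding N_def by simp
  then obtain p where p: "\<And>i. to_laurent (vars {i} ^ N) * f i = to_laurent (p i)" "\<And>i. homogeneous N (p i)"
    by metis
  have "\<exists>k. (var i * var j) ^ k * (var j ^ N * p i - var i ^ N * p j) \<in> I" for i j
  proof (cases "i = j")
    case False
    then have ij: "vars {i, j} = var i * var j" by (simp add: vars_def)
    have "to_laurent (vars {i, j} ^ N) * (f i - f j)
        = to_laurent (var j ^ N) * (to_laurent (vars {i} ^ N) * f i) -
          to_laurent (var i ^ N) * (to_laurent (vars {j} ^ N) * f j)"
      unfolding ij by (simp add: to_laurent_simps power_mult_distrib algebra_simps)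
    also have "\<dots> = to_laurent (var j ^ N * p i - var i ^ N * p j)"
      unfolding p(1) by (simp add: to_laurent_simps)
    finally have "to_laurent (vars {i, j} ^ N) * (f i - f j) = to_laurent (var j ^ N * p i - var i ^ N * p j)" .
    from sections_mem_iff[OF sections_homogeneous[OF comp] this] show ?thesis
      using comp[of i j] unfolding ij by blast
  qed auto
  then obtain k where k: "\<And>i j. (var i * var j) ^ k i j * (var j ^ N * p i - var i ^ N * p j) \<in> I" by metis
  define K where "K = Max (range (case_prod k))"
  have K: "(var i * var j) ^ K * (var j ^ N * p i - var i ^ N * p j) \<in> I" for i j
  proof (rule power_mem_mono[OF k])
    have "case_prod k (i, j) \<le> K" unfolding K_def by (intro Max_ge) auto
    then show "k i j \<le> K" by simp
  qed
  show ?thesis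
  proof (rule that[of "K + N" "\<lambda>i. var i ^ K * p i"])
    show "homogeneous (K + N) (var i ^ K * p i)" for i
      by (intro homogeneous_mult homogeneous_linear_power homogeneous_var p)
    show "to_laurent (vars {i} ^ (K + N)) * f i = to_laurent (var i ^ K * p i)" for i
      unfolding to_laurent_simps(2) p(1)[symmetric] by (simp add: power_add to_laurent_simps mult.assoc)
    show "var j ^ (K + N) * (var i ^ K * p i) - var i ^ (K + N) * (var j ^ K * p j) \<in> I" for i j
      using K[of i j] by (simp add: power_add power_mult_distrib algebra_simps)
  qed
qed

text \<open>Every monomial of a high power of \<open>l\<close> contains some
  \<open>var v ^ N\<close>. Replacing this factor by the numerator \<open>p v\<close> produces a
  form that represents \<open>l ^ (k + M)\<close> times the function on every chart, by the
  congruences between the numerators; maximality in degree \<open>M\<close> then divides it by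
  \<open>l ^ k\<close>.\<close>

lemma glue:
  assumes lim: "hilbert_limit I M r"
    and f: "\<And>i. f i \<in> sections UNIV {i} 0" and comp: "\<And>i j. f i - f j \<in> sections I {i, j} 0"
  obtains F where "homogeneous M F" "\<And>i. to_laurent (l ^ M) * f i - to_laurent F \<in> sections I {i} (int M)"
proof -
  obtain N p where p: "\<And>i. homogeneous N (p i)" "\<And>i. to_laurent (vars {i} ^ N) * f i = to_laurent (p i)"
    "\<And>i j. var j ^ N * p i - var i ^ N * p j \<in> I"
    using common_denominator[OF f comp] by blast
  \<comment> \<open>Large enough for \<open>monomial_divisible\<close> in degree
    \<open>k + M\<close>; the excess \<open>k\<close> is divided out again at the end.\<close>
  define k where "k = N * CARD('v)"
  have mon: "\<exists>G. homogeneous (k + M) G \<and> (\<forall>j. var j ^ N * G - Poly_Mapping.single t 1 * p j \<in> I)"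
    if t: "t \<in> Poly_Mapping.keys (l ^ (k + M))" for t
  proof -
    have deg: "mdeg t = k + M" using homogeneous_l_power[of "k + M"] t by (simp add: homogeneous_def)
    then obtain v t' where t': "Poly_Mapping.single t 1 = var v ^ N * Poly_Mapping.single t' (1 :: complex)" "N + mdeg t' = mdeg t"
      using monomial_divisible[of N t] unfolding k_def by auto
    have "homogeneous (mdeg t' + N) (Poly_Mapping.single t' 1 * p v)"
      by (intro homogeneous_mult p homogeneous_single refl)
    moreover have "var j ^ N * (Poly_Mapping.single t' 1 * p v) - Poly_Mapping.single t 1 * p j
        = Poly_Mapping.single t' 1 * (var j ^ N * p v - var v ^ N * p j)" for j
      unfolding t'(1) by (simp add: algebra_simps)
    ultimately show ?thesis using mult_mem[OF p(3)] t'(2) deg by (metis add.commute)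
  qed
  have "\<forall>t\<in>Poly_Mapping.keys (l ^ (k + M)).
      \<exists>G. homogeneous (k + M) G \<and> (\<forall>j. var j ^ N * G - Poly_Mapping.single t 1 * p j \<in> I)"
    using mon ..
  from bchoice[OF this] obtain G where G: "\<And>t. t \<in> Poly_Mapping.keys (l ^ (k + M)) \<Longrightarrow> homogeneous (k + M) (G t)"
    "\<And>t j. t \<in> Poly_Mapping.keys (l ^ (k + M)) \<Longrightarrow> var j ^ N * G t - Poly_Mapping.single t 1 * p j \<in> I"
    by blast
  define F' where "F' = (\<Sum>t\<in>Poly_Mapping.keys (l ^ (k + M)). const (Poly_Mapping.lookup (l ^ (k + M)) t) * G t)"
  have F': "homogeneous (k + M) F'"
    unfolding F'_def using G by (intro homogeneous_sum homogeneous_const_mult)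
  have glued: "var j ^ N * F' - l ^ (k + M) * p j \<in> I" for j
  proof -
    have "l ^ (k + M) * p j = (\<Sum>t\<in>Poly_Mapping.keys (l ^ (k + M)).
        const (Poly_Mapping.lookup (l ^ (k + M)) t) * (Poly_Mapping.single t 1 * p j))"
      using arg_cong[OF poly_eq_sum_monomials[of "l ^ (k + M)"], of "\<lambda>x. x * p j"]
      by (simp only: sum_distrib_right mult.assoc)
    then have "var j ^ N * F' - l ^ (k + M) * p j = (\<Sum>t\<in>Poly_Mapping.keys (l ^ (k + M)).
        const (Poly_Mapping.lookup (l ^ (k + M)) t) * (var j ^ N * G t - Poly_Mapping.single t 1 * p j))"
      by (simp only: F'_def sum_distrib_left right_diff_distrib sum_subtractf mult.left_commute[of "var j ^ N"])
    then show ?thesis using G(2) by (simp only:) (intro sum_mem mult_mem)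
  qed
  obtain F where F: "homogeneous M F" "F' - l ^ k * F \<in> I" using hilbert_limit_lift[OF lim F'] by blast
  have "to_laurent (l ^ M) * f i - to_laurent F \<in> sections I {i} (int M)" for i
  proof -
    have "homogeneous (int M + 0) (to_laurent (l ^ M) * f i)"
      using sections_homogeneous[OF f] homogeneous_l_power[of M] by (intro homogeneous_mult) auto
    then have hom: "homogeneous (int M) (to_laurent (l ^ M) * f i - to_laurent F)"
      using F by (intro homogeneous_diff) auto
    have "to_laurent (vars {i} ^ N) * (to_laurent (l ^ M) * f i - to_laurent F)
        = to_laurent (l ^ M) * (to_laurent (vars {i} ^ N) * f i) - to_laurent (var i ^ N * F)"
      by (simp add: to_laurent_simps algebra_simps)
    then have num: "to_laurent (vars {i} ^ N) * (to_laurent (l ^ M) * f i - to_laurent F)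
        = to_laurent (l ^ M * p i - var i ^ N * F)"
      unfolding p(2) by (simp only: to_laurent_simps)
    have "l ^ k * (l ^ M * p i - var i ^ N * F) =
        var i ^ N * (F' - l ^ k * F) - (var i ^ N * F' - l ^ (k + M) * p i)"
      by (simp add: algebra_simps power_add)
    then have "l ^ k * (l ^ M * p i - var i ^ N * F) \<in> I"
      by (simp only:) (rule diff_mem[OF mult_mem[OF F(2)] glued])
    then have "l ^ M * p i - var i ^ N * F \<in> I" by (rule power_cancel)
    then have "vars {i} ^ 0 * (l ^ M * p i - var i ^ N * F) \<in> I" by simp
    then show ?thesis using sections_mem_iff[OF hom num] by blast
  qed
  with F(1) show ?thesis using that by blast
qed

text \<open>A function \<open>f\<close> on the scheme corresponds to the form
  \<open>l ^ M * f\<close> modulo \<open>I\<close>: \<open>glue\<close> finds the form for given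
  \<open>f\<close>, \<open>local_quotients\<close> the function for a given form. Neither choice is
  unique, hence the relation \<open>R\<close>.\<close>

lemma length_codim_iff:
  assumes lim: "hilbert_limit I M r"
  shows "codim_ge (\<lambda>c f. const c *s f)
       {f :: 'v claurent ^ 'v. (\<forall>i. f $ i \<in> sections UNIV {i} 0) \<and> (\<forall>i j. f $ i - f $ j \<in> sections I {i, j} 0)}
       {f. \<forall>i. f $ i \<in> sections I {i} 0} n \<longleftrightarrow> hilbert_ge I M n"
    (is "codim_ge _ ?V ?U n \<longleftrightarrow> _")
proof
  define R where "R f F \<longleftrightarrow> (\<forall>i. to_laurent (l ^ M) * f $ i - to_laurent F \<in> sections I {i} (int M))"
    for f :: "'v claurent ^ 'v" and F
  have R_sum: "to_laurent (l ^ M) * (\<Sum>i<n. const (c i) * f i $ v) - to_laurent (\<Sum>i<n. const (c i) * F i)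
      \<in> sections I {v} (int M)"
    if "\<And>i. i < n \<Longrightarrow> R (f i) (F i)" for c f F v
  proof -
    have "(\<Sum>i<n. const (c i) * (to_laurent (l ^ M) * f i $ v - to_laurent (F i))) \<in> sections I {v} (int M)"
      using that unfolding R_def by (intro sections_sum sections_const_mult) auto
    then show ?thesis
      by (simp add: right_diff_distrib sum_subtractf sum_distrib_left to_laurent_sum to_laurent_simps mult.left_commute)
  qed
  have nth: "(\<Sum>i<n. const (c i) *s f i) $ v = (\<Sum>i<n. const (c i) * f i $ v)" for c v and f :: "nat \<Rightarrow> 'v claurent ^ 'v"
    by simp
  show "hilbert_ge I M n" if "codim_ge (\<lambda>c f. const c *s f) ?V ?U n"
    using that
  proof (rule codim_ge_transfer[where R = R])
    show "\<exists>F\<in>{p. homogeneous M p}. R f F" if "f \<in> ?V" for f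
    proof -
      obtain F where "homogeneous M F" "\<And>i. to_laurent (l ^ M) * f $ i - to_laurent F \<in> sections I {i} (int M)"
        using glue[OF lim, of "\<lambda>i. f $ i"] \<open>f \<in> ?V\<close> by blast
      then show ?thesis unfolding R_def by blast
    qed
    fix c b b'
    assume b: "\<And>i. i < n \<Longrightarrow> b i \<in> ?V" and b': "\<And>i. i < n \<Longrightarrow> b' i \<in> {p. homogeneous M p}"
      and R: "\<And>i. i < n \<Longrightarrow> R (b i) (b' i)" and I: "(\<Sum>i<n. const (c i) * b' i) \<in> I"
    have "homogeneous M (\<Sum>i<n. const (c i) * b' i)"
      using b' by (intro homogeneous_sum homogeneous_const_mult) auto
    moreover have "\<exists>k. var v ^ k * (\<Sum>i<n. const (c i) * b' i) \<in> I" for v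
      using I by (intro exI[of _ 0]) simp
    ultimately have "to_laurent (\<Sum>i<n. const (c i) * b' i) \<in> sections I {v} (int M)" for v
      using sections_polynomial_iff by blast
    from sections_add[OF R_sum[where f = b and F = b' and c = c, OF R] this]
    have "to_laurent (l ^ M) * (\<Sum>i<n. const (c i) * b i $ v) \<in> sections I {v} (int M)" for v
      by simp
    moreover have "(\<Sum>i<n. const (c i) * b i $ v) \<in> sections UNIV {v} 0" for v
      using b by (intro whole.sections_sum whole.sections_const_mult) auto
    ultimately have "(\<Sum>i<n. const (c i) * b i $ v) \<in> sections I {v} 0" for v
      using sections_cancel by blast
    then show "(\<Sum>i<n. const (c i) *s b i) \<in> ?U" unfolding mem_Collect_eq nth by blast
  qed
  show "codim_ge (\<lambda>c f. const c *s f) ?V ?U n" if "hilbert_ge I M n"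
    using that
  proof (rule codim_ge_transfer[where R = "\<lambda>F f. R f F"])
    show "\<exists>f\<in>?V. R f F" if "F \<in> {p. homogeneous M p}" for F
    proof -
      have "homogeneous M F" "int M = int M + 0" using that by auto
      then obtain f where f: "\<And>i. f i \<in> sections UNIV {i} 0"
        "\<And>i. to_laurent (l ^ M) * f i - to_laurent F \<in> sections I {i} (int M)"
        "\<And>i j. f i - f j \<in> sections I {i, j} 0"
        using local_quotients[OF lim] by blast
      then show ?thesis unfolding R_def by (intro bexI[of _ "\<chi> i. f i"]) auto
    qed
    fix c b b'
    assume b: "\<And>i. i < n \<Longrightarrow> b i \<in> {p. homogeneous M p}"
      and R: "\<And>i. i < n \<Longrightarrow> R (b' i) (b i)" and U: "(\<Sum>i<n. const (c i) *s b' i) \<in> ?U"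
    show "(\<Sum>i<n. const (c i) * b i) \<in> I"
    proof (rule sections_all_charts)
      show "homogeneous M (\<Sum>i<n. const (c i) * b i)"
        using b by (intro homogeneous_sum homogeneous_const_mult) auto
      fix v
      have "(\<Sum>i<n. const (c i) * b' i $ v) \<in> sections I {v} 0"
        using U unfolding mem_Collect_eq nth by blast
      then have "to_laurent (l ^ M) * (\<Sum>i<n. const (c i) * b' i $ v) \<in> sections I {v} (int M + 0)"
        by (rule sections_mult) (simp add: homogeneous_l_power)
      then have "to_laurent (l ^ M) * (\<Sum>i<n. const (c i) * b' i $ v) \<in> sections I {v} (int M)"
        by simp
      from sections_diff[OF this R_sum[where f = b' and F = b and c = c and v = v, OF R]] show "to_laurent (\<Sum>i<n. const (c i) * b i) \<in> sections I {v} (int M)"        by simp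
    qed
  qed
qed

lemma hilbert_limit_imp_has_length:
  assumes "hilbert_limit I M r"
  shows "has_length I r"
  unfolding has_length_def
proof (rule quotient_dimI[OF vector_space_const_vec subspace_length_zero])
qed (use assms in \<open>simp_all only: length_codim_iff[OF assms] hilbert_limit_def, simp_all\<close>)

text \<open>A hypothesis supplies a length only through the relation \<open>has_length\<close>; this
  ties it to the stable value of the Hilbert function.\<close>

lemma has_length_unique:
  assumes lim: "hilbert_limit I M r" and len: "has_length I r'"
  shows "r' = r"
proof (rule antisym)
  have "hilbert_ge I M r'"
    unfolding length_codim_iff[OF lim, symmetric]
    by (rule quotient_dim_imp_codim_ge[OF vector_space_const_vec _ subspace_length_zero len[unfolded has_length_def]])
      simp
  moreover have "\<not> hilbert_ge I M (Suc r)" using lim by (simp add: hilbert_limit_def)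
  ultimately show "r' \<le> r" using codim_ge_mono[OF vector_space_const] by (metis not_less_eq_eq)
  have "hilbert_ge I M r" using lim by (simp add: hilbert_limit_def)
  then show "r \<le> r'"
    unfolding length_codim_iff[OF lim, symmetric]
    by (rule quotient_dim_bound[OF vector_space_const_vec subspace_length_zero len[unfolded has_length_def]])
qed

text \<open>Surjectivity of restriction from H^0(O(d)) to H^0(O_Z(d)). The local quotients of
  \<open>F\<close> by \<open>l ^ (d0 + k)\<close> have degree \<open>e\<close> and differ by a
  cocycle of the ideal sheaf; a coboundary corrects them to a global section \<open>s\<close>, and
  \<open>P\<close> is \<open>l ^ k * s\<close>. In this way vanishing in degree \<open>e\<close>
  alone serves every \<open>d\<close> with \<open>e \<le> int d\<close>.\<close>

lemma has_h1_zero_lift: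
  assumes lim: "hilbert_limit I d0 r" and h1: "has_h1 I e 0" and d: "e \<le> int d"
    and F: "homogeneous (d0 + d) F"
  obtains P where "homogeneous d P" "l ^ d0 * P - F \<in> I"
proof -
  define k where "k = nat (int d - e)"
  have M: "int (d0 + d) = int (d0 + k) + e" using d unfolding k_def by simp
  obtain f where f: "\<And>i. f i \<in> sections UNIV {i} e"
    "\<And>i. to_laurent (l ^ (d0 + k)) * f i - to_laurent F \<in> sections I {i} (int (d0 + d))"
    "\<And>i j. f i - f j \<in> sections I {i, j} e"
    using local_quotients[OF lim F M] by blast
  define z :: "'v claurent ^ ('v \<times> 'v)" where "z = (\<chi> ij. f (snd ij) - f (fst ij))"
  have "f j - f i \<in> sections I {i, j} e" for i j
    using f(3)[of j i] by (simp add: insert_commute)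
  then have "z \<in> cech_cocycles1 I e"
    unfolding z_def cech_cocycles1_def by auto
  \<comment> \<open>In dimension 0 the sum in \<open>quotient_dim\<close> is empty, so each cocycle
    is itself a coboundary.\<close>
  then have "z \<in> cech_coboundaries1 I e"
    using h1 unfolding has_h1_def quotient_dim_def by auto
  then obtain g where g: "\<And>i. g i \<in> sections I {i} e" "z = (\<chi> ij. g (snd ij) - g (fst ij))"
    unfolding cech_coboundaries1_def by blast
  have fg: "f j - f i = g j - g i" for i j
    using arg_cong[OF g(2), of "\<lambda>x. x $ (i, j)"] by (simp add: z_def)
  \<comment> \<open>\<open>undefined\<close> is an arbitrary chart; by \<open>fg\<close> every other
    chart gives the same \<open>s\<close>.\<close>
  define s where "s = f undefined - g undefined"
  have s: "s = f i - g i" for i using fg[of i undefined] by (simp add: s_def algebra_simps)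
  have g': "g i \<in> sections UNIV {i} e" for i using g(1)[of i] unfolding sections_iff by blast
  have "to_laurent (l ^ k) * s \<in> sections UNIV {i} (int k + e)" for i
    unfolding s[of i] using f(1) g' homogeneous_l_power[of k]
    by (intro whole.sections_mult whole.sections_diff) auto
  moreover have "int k + e = int d" using d by (simp add: k_def)
  ultimately have "to_laurent (l ^ k) * s \<in> sections UNIV {i} (int d)" for i by simp
  then obtain P where P: "to_laurent (l ^ k) * s = to_laurent P" "homogeneous d P"
    using global_section by blast
  have "l ^ d0 * P - F \<in> I"
  proof (rule sections_all_charts)
    show "homogeneous (d0 + d) (l ^ d0 * P - F)"
      using homogeneous_l_power_mult[OF P(2)] F by (rule homogeneous_diff)
    fix i
    have "to_laurent (l ^ (d0 + k)) * g i \<in> sections I {i} (int (d0 + k) + e)"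
      by (intro sections_mult g) (simp only: homogeneous_to_laurent homogeneous_l_power)
    then have "(to_laurent (l ^ (d0 + k)) * f i - to_laurent F) - to_laurent (l ^ (d0 + k)) * g i
        \<in> sections I {i} (int (d0 + d))"
      unfolding M[symmetric] by (intro sections_diff f)
    also have "(to_laurent (l ^ (d0 + k)) * f i - to_laurent F) - to_laurent (l ^ (d0 + k)) * g i
        = to_laurent (l ^ d0) * (to_laurent (l ^ k) * s) - to_laurent F"
      unfolding s[of i] by (simp add: power_add to_laurent_simps algebra_simps)
    finally show "to_laurent (l ^ d0 * P - F) \<in> sections I {i} (int (d0 + d))"
      unfolding P(1) by (simp only: to_laurent_simps)
  qed
  with P(2) show ?thesis using that by blast
qed

text \<open>Independent forms of degree \<open>d0 + d\<close> lift to degree \<open>d\<close>, and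
  multiplication by \<open>l ^ d0\<close> turns a relation between the lifts into one between the
  original forms.\<close>

lemma has_h1_zero_hilbert_ge:
  assumes lim: "hilbert_limit I d0 r" and h1: "has_h1 I e 0" and d: "e \<le> int d"
  shows "hilbert_ge I d r"
proof -
  have "hilbert_ge I (d0 + d) r" using hilbert_limit_mono[OF lim, of "d0 + d"] by (simp add: hilbert_limit_def)
  then show ?thesis
  proof (rule codim_ge_transfer[where R = "\<lambda>F P. l ^ d0 * P - F \<in> I"])
    show "\<exists>P\<in>{p. homogeneous d p}. l ^ d0 * P - F \<in> I" if "F \<in> {p. homogeneous (d0 + d) p}" for F
      using has_h1_zero_lift[OF lim h1 d, of F] that by blast
    fix c b b'
    assume R: "\<And>i. i < r \<Longrightarrow> l ^ d0 * b' i - b i \<in> I" and I: "(\<Sum>i<r. const (c i) * b' i) \<in> I"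
    have "(\<Sum>i<r. const (c i) * (l ^ d0 * b' i - b i)) \<in> I" using R by (intro sum_mem mult_mem) auto
    moreover have "(\<Sum>i<r. const (c i) * (l ^ d0 * b' i - b i))
        = l ^ d0 * (\<Sum>i<r. const (c i) * b' i) - (\<Sum>i<r. const (c i) * b i)"
      by (simp add: right_diff_distrib sum_subtractf sum_distrib_left mult.left_commute)
    ultimately have "l ^ d0 * (\<Sum>i<r. const (c i) * b' i) - (\<Sum>i<r. const (c i) * b i) \<in> I" by simp
    with mem_cong mult_mem[OF I] show "(\<Sum>i<r. const (c i) * b i) \<in> I" by blast
  qed
qed

end

section \<open>Veronese and Segre coordinates\<close>

text \<open>The variables of a monomial, listed with multiplicity, are placed on the positions
  \<open>J\<close> in some order; this is how forms of degree \<open>card J\<close> come from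
  tensors.\<close>

lemma monomial_eq_prod_vars:
  assumes "finite J" "mdeg t = card J"
  shows "\<exists>P\<in>J \<rightarrow>\<^sub>E UNIV. Poly_Mapping.single t (1 :: complex) = (\<Prod>j\<in>J. var (P j :: 'v::finite))"
  using assms
proof (induction J arbitrary: t rule: finite_induct)
  case empty
  then have "t = 0" by (intro poly_mapping_eqI) (simp add: mdeg_def)
  then show ?case by simp
next
  case (insert j J)
  obtain v where v: "1 \<le> Poly_Mapping.lookup t v"
    using insert by (auto simp: mdeg_def Suc_le_eq) (metis gr0I nat.distinct(1) sum.neutral)
  note split = monomial_split[OF v]
  have "mdeg (t - Poly_Mapping.single v 1) = card J" using split(2) insert by simp
  from insert.IH[OF this] obtain P where P: "P \<in> J \<rightarrow>\<^sub>E UNIV"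
    "Poly_Mapping.single (t - Poly_Mapping.single v 1) (1 :: complex) = (\<Prod>j\<in>J. var (P j))" ..
  have "(\<Prod>i\<in>J. var ((P(j := v)) i)) = (\<Prod>i\<in>J. var (P i) :: 'v cpoly)"
    using insert.hyps by (intro prod.cong) auto
  then have "Poly_Mapping.single t (1 :: complex) = (\<Prod>i\<in>insert j J. var ((P(j := v)) i))"
    using insert.hyps unfolding split(1) P(2) by simp
  moreover have "P(j := v) \<in> insert j J \<rightarrow>\<^sub>E UNIV" using P(1) by (auto simp: PiE_def extensional_def)
  ultimately show ?case by blast
qed

lemma prod_var_power: "(\<Prod>v\<in>UNIV. var v ^ Poly_Mapping.lookup t v) = Poly_Mapping.single (t :: 'v::finite \<Rightarrow>\<^sub>0 nat) 1"
proof -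
  have "(\<Sum>v\<in>UNIV. Poly_Mapping.single v (Poly_Mapping.lookup t v)) = t"
    by (rule poly_mapping_eqI) (simp add: lookup_sum lookup_single when_def)
  then show ?thesis by (simp add: var_power_nat prod_single)
qed

text \<open>Dedekind's argument: distinct monomials are distinct characters of the torus.\<close>

lemma monomials_independent:
  fixes X :: "('v::finite \<Rightarrow>\<^sub>0 nat) set"
  assumes "finite X"
    and "\<And>x :: 'v \<Rightarrow> complex. (\<And>v. x v \<noteq> 0) \<Longrightarrow> (\<Sum>t\<in>X. c t * (\<Prod>v\<in>UNIV. x v ^ Poly_Mapping.lookup t v)) = 0"
  shows "\<forall>t\<in>X. c t = 0"
  using assms
proof (induction X arbitrary: c rule: finite_induct)
  case (insert s X)
  define mon where "mon t x = (\<Prod>v\<in>UNIV. x v ^ Poly_Mapping.lookup t v)" for t and x :: "'v \<Rightarrow> complex"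
  have mult: "mon t (\<lambda>v. x v * y v) = mon t x * mon t y" for t x y
    by (simp add: mon_def power_mult_distrib prod.distrib)
  have zero: "c s * mon s x + (\<Sum>t\<in>X. c t * mon t x) = 0" if "\<And>v. x v \<noteq> 0" for x
    using insert.prems[OF that] insert.hyps by (simp add: mon_def)
  have "c t0 = 0" if "t0 \<in> X" for t0
  proof -
    have "t0 \<noteq> s" using that insert.hyps by auto
    then obtain w where w: "Poly_Mapping.lookup t0 w \<noteq> Poly_Mapping.lookup s w"
      using poly_mapping_eqI[of t0 s] by auto
    \<comment> \<open>Translation by \<open>y\<close> multiplies the monomial \<open>t\<close> by 2
      to the power of its exponent at \<open>w\<close>; distinct powers of 2 separate
      \<open>t0\<close> from \<open>s\<close>.\<close>
    define y where "y v = (if v = w then 2 else 1 :: complex)" for v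
    have y: "mon t y = 2 ^ Poly_Mapping.lookup t w" for t
    proof -
      have "mon t y = (\<Prod>v\<in>UNIV. if v = w then 2 ^ Poly_Mapping.lookup t w else 1)"
        unfolding mon_def y_def by (intro prod.cong) auto
      then show ?thesis by simp
    qed
    have "\<forall>t\<in>X. c t * (mon t y - mon s y) = 0"
    proof (rule insert.IH)
      fix x :: "'v \<Rightarrow> complex" assume x: "\<And>v. x v \<noteq> 0"
      have "(\<Sum>t\<in>X. c t * (mon t y - mon s y) * mon t x) =
          (\<Sum>t\<in>X. c t * mon t (\<lambda>v. x v * y v)) - mon s y * (\<Sum>t\<in>X. c t * mon t x)"
        by (simp add: mult sum_distrib_left sum_subtractf[symmetric] algebra_simps)
      also have "\<dots> = - (c s * mon s (\<lambda>v. x v * y v)) + mon s y * (c s * mon s x)"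
        using zero[of x] zero[of "\<lambda>v. x v * y v"] x
        by (simp add: y_def add_eq_0_iff)
      finally show "(\<Sum>t\<in>X. c t * (mon t y - mon s y) * (\<Prod>v\<in>UNIV. x v ^ Poly_Mapping.lookup t v)) = 0"
        by (simp add: mult mon_def[symmetric])
    qed
    then have "c t0 * (mon t0 y - mon s y) = 0" using that by blast
    moreover have "(2 :: complex) ^ Poly_Mapping.lookup t0 w \<noteq> 2 ^ Poly_Mapping.lookup s w"
    proof
      assume "(2 :: complex) ^ Poly_Mapping.lookup t0 w = 2 ^ Poly_Mapping.lookup s w"
      then have "norm ((2 :: complex) ^ Poly_Mapping.lookup t0 w) = norm ((2 :: complex) ^ Poly_Mapping.lookup s w)"
        by simp
      with w show False by (simp add: norm_power)
    qed
    ultimately show ?thesis by (simp add: y)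
  qed
  moreover have "c s = 0"
    using zero[of "\<lambda>_. 1"] calculation by (simp add: mon_def)
  ultimately show ?case by blast
qed simp

lemma poly_eq_zeroI:
  assumes "\<And>x. (\<And>v. x $ v \<noteq> 0) \<Longrightarrow> poly_at p x = 0"
  shows "p = 0"
proof -
  have "\<forall>t\<in>Poly_Mapping.keys p. Poly_Mapping.lookup p t = 0"
  proof (rule monomials_independent)
    fix x :: "'a \<Rightarrow> complex" assume "\<And>v. x v \<noteq> 0"
    then have "poly_at p (\<chi> v. x v) = 0" by (intro assms) simp
    then show "(\<Sum>t\<in>Poly_Mapping.keys p. Poly_Mapping.lookup p t * (\<Prod>v\<in>UNIV. x v ^ Poly_Mapping.lookup t v)) = 0"
      by (simp add: poly_at_def poly_subst_def)
  qed simp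
  then show ?thesis by (intro poly_mapping_eqI) (auto simp: in_keys_iff)
qed

section \<open>Pullback of forms to the diagonal\<close>

abbreviation veronese_subst :: "('k::finite \<Rightarrow> 'n::finite) cpoly \<Rightarrow> 'n cpoly" where
  "veronese_subst \<equiv> poly_subst const (\<lambda>K. \<Prod>j\<in>UNIV. var (K j))"

lemma poly_at_veronese_subst: "poly_at (veronese_subst p) x = poly_at p (pure_tensor (\<lambda>_. x))"
  by (simp add: poly_at_subst poly_at_prod poly_at_simps pure_tensor_def)

lemma homogeneous_veronese_subst:
  fixes p :: "('k::finite \<Rightarrow> 'n::finite) cpoly"
  assumes "homogeneous d p"
  shows "homogeneous (CARD('k) * d) (veronese_subst p)"
  unfolding poly_subst_def
proof (intro homogeneous_sum homogeneous_const_mult)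
  fix t assume "t \<in> Poly_Mapping.keys p"
  then have t: "mdeg t = d" using assms by (simp add: homogeneous_def)
  have "homogeneous (\<Sum>j\<in>(UNIV :: 'k set). 1 :: nat) (\<Prod>j\<in>UNIV. var (K j) :: 'n cpoly)" for K :: "'k \<Rightarrow> 'n"
    by (intro homogeneous_prod homogeneous_var)
  then have "homogeneous (\<Sum>K\<in>UNIV. of_nat (Poly_Mapping.lookup t K) * (\<Sum>j\<in>(UNIV :: 'k set). 1 :: nat))
      (\<Prod>K\<in>UNIV. (\<Prod>j\<in>UNIV. var (K j) :: 'n cpoly) ^ Poly_Mapping.lookup t K)"
    by (rule homogeneous_prod[OF homogeneous_power])
  also have "(\<Sum>K\<in>UNIV. of_nat (Poly_Mapping.lookup t K) * (\<Sum>j\<in>(UNIV :: 'k set). 1 :: nat)) = CARD('k) * d"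
    using t by (simp add: mdeg_def sum_distrib_right[symmetric])
  finally show "homogeneous (CARD('k) * d)
      (\<Prod>K\<in>UNIV. (\<Prod>j\<in>UNIV. var (K j) :: 'n cpoly) ^ Poly_Mapping.lookup t K)" .
qed

text \<open>A monomial of degree \<open>CARD('k) * d\<close> is cut into \<open>d\<close> blocks of
  \<open>CARD('k)\<close> variables, each the image of one coordinate.\<close>

lemma veronese_subst_surj:
  fixes p :: "'n::finite cpoly"
  assumes "homogeneous (CARD('k) * d) p"
  shows "\<exists>q. homogeneous d q \<and> veronese_subst (q :: ('k::finite \<Rightarrow> 'n) cpoly) = p"
proof -
  have mon: "\<exists>q. homogeneous d q \<and> veronese_subst (q :: ('k \<Rightarrow> 'n) cpoly) = Poly_Mapping.single t 1"
    if "t \<in> Poly_Mapping.keys p" for t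
  proof -
    have "mdeg t = card ({..<d} \<times> (UNIV :: 'k set))"
      using assms that by (simp add: homogeneous_def card_cartesian_product)
    from monomial_eq_prod_vars[OF _ this] obtain P where
      P: "Poly_Mapping.single t (1 :: complex) = (\<Prod>ij\<in>{..<d} \<times> (UNIV :: 'k set). var (P ij))" by auto
    have "homogeneous (\<Sum>i<d. 1 :: nat) (\<Prod>i<d. var (\<lambda>j. P (i, j)) :: ('k \<Rightarrow> 'n) cpoly)"
      by (intro homogeneous_prod homogeneous_var)
    moreover have "veronese_subst (\<Prod>i<d. var (\<lambda>j. P (i, j)) :: ('k \<Rightarrow> 'n) cpoly) = Poly_Mapping.single t 1"
      unfolding P by (simp add: subst.poly_subst_prod prod.cartesian_product)
    ultimately show ?thesis by auto
  qed
  then have "\<forall>t\<in>Poly_Mapping.keys p. \<exists>q. homogeneous d q \<and> veronese_subst (q :: ('k \<Rightarrow> 'n) cpoly) = Poly_Mapping.single t 1" ..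
  from bchoice[OF this] obtain q where q: "\<And>t. t \<in> Poly_Mapping.keys p \<Longrightarrow>
      homogeneous d (q t) \<and> veronese_subst (q t :: ('k \<Rightarrow> 'n) cpoly) = Poly_Mapping.single t 1" by blast
  let ?q = "\<Sum>t\<in>Poly_Mapping.keys p. const (Poly_Mapping.lookup p t) * q t"
  have "homogeneous d ?q" using q by (intro homogeneous_sum homogeneous_const_mult) auto
  moreover have "veronese_subst ?q = (\<Sum>t\<in>Poly_Mapping.keys p. const (Poly_Mapping.lookup p t) * Poly_Mapping.single t 1)"
    using q by (simp add: subst.poly_subst_sum subst.poly_subst_mult)
  ultimately show ?thesis unfolding poly_eq_sum_monomials[symmetric] by blast
qed

section \<open>Tensors split along a set of factors\<close>

definition merge :: "'k set \<Rightarrow> ('k \<Rightarrow> 'n) \<Rightarrow> ('k \<Rightarrow> 'n) \<Rightarrow> 'k \<Rightarrow> 'n" where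
  "merge J P Q = (\<lambda>j. if j \<in> J then P j else Q j)"

text \<open>
  Coefficient families \<open>f\<close> on \<open>J \<rightarrow>\<^sub>E UNIV\<close> are elements of the \<open>J\<close>-th tensor power of the space of
  linear forms.  \<open>outer J f g\<close> is the linear form \<open>f \<otimes> g\<close> on the ambient space of the Segre variety,
  and \<open>multiform\<close> evaluates a multilinear form when \<open>\<alpha> j\<close> is substituted in the factor \<open>j\<close>.
\<close>

definition outer ::
  "'k set \<Rightarrow> (('k::finite \<Rightarrow> 'n::finite) \<Rightarrow> complex) \<Rightarrow> (('k \<Rightarrow> 'n) \<Rightarrow> complex) \<Rightarrow> ('k \<Rightarrow> 'n) cpoly" where
  "outer J f g = (\<Sum>P\<in>J \<rightarrow>\<^sub>E UNIV. \<Sum>Q\<in>- J \<rightarrow>\<^sub>E UNIV. const (f P * g Q) * var (merge J P Q))"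

definition multiform ::
  "(complex \<Rightarrow> 'r::comm_ring_1) \<Rightarrow> ('k \<Rightarrow> 'n \<Rightarrow> 'r) \<Rightarrow> 'k set \<Rightarrow> (('k \<Rightarrow> 'n) \<Rightarrow> complex) \<Rightarrow> 'r" where
  "multiform h \<alpha> J f = (\<Sum>P\<in>J \<rightarrow>\<^sub>E UNIV. h (f P) * (\<Prod>j\<in>J. \<alpha> j (P j)))"

abbreviation diagonal_form :: "'k set \<Rightarrow> (('k \<Rightarrow> 'n::finite) \<Rightarrow> complex) \<Rightarrow> 'n cpoly" where
  "diagonal_form \<equiv> multiform const (\<lambda>_. var)"

lemma finite_PiE_UNIV: "finite ((J :: 'k::finite set) \<rightarrow>\<^sub>E (UNIV :: 'n::finite set))"
  by (intro finite_PiE) auto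

lemma (in coeff_hom) poly_subst_outer:
  "poly_subst h (\<lambda>K. \<Prod>j\<in>UNIV. \<alpha> j (K j)) (outer J f g) = multiform h \<alpha> J f * multiform h \<alpha> (- J) g"
proof -
  have merge: "(\<Prod>j\<in>UNIV. \<alpha> j (merge J P Q j)) = (\<Prod>j\<in>J. \<alpha> j (P j)) * (\<Prod>j\<in>- J. \<alpha> j (Q j))" for P Q
  proof -
    have "(\<Prod>j\<in>UNIV. \<alpha> j (merge J P Q j)) =
        (\<Prod>j\<in>J. \<alpha> j (merge J P Q j)) * (\<Prod>j\<in>- J. \<alpha> j (merge J P Q j))"
      by (subst prod.union_disjoint[symmetric]) (auto intro: arg_cong2[of _ _ _ _ prod])
    also have "\<dots> = (\<Prod>j\<in>J. \<alpha> j (P j)) * (\<Prod>j\<in>- J. \<alpha> j (Q j))"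
      by (intro arg_cong2[of _ _ _ _ "(*)"] prod.cong) (auto simp: merge_def)
    finally show ?thesis .
  qed
  show ?thesis
    unfolding outer_def multiform_def sum_product
    by (simp add: poly_subst_sum poly_subst_mult merge hom_mult mult_ac)
qed

lemma veronese_subst_outer: "veronese_subst (outer J f g) = diagonal_form J f * diagonal_form (- J) g"
  by (rule subst.poly_subst_outer)

lemma poly_at_outer:
  "poly_at (outer J f g) (pure_tensor x) =
    multiform (\<lambda>c. c) (\<lambda>j v. x j $ v) J f * multiform (\<lambda>c. c) (\<lambda>j v. x j $ v) (- J) g"
  using eval.poly_subst_outer[of "\<lambda>j v. x j $ v" J f g] by (simp add: poly_at_def pure_tensor_def)

lemma homogeneous_outer: "homogeneous 1 (outer J f g)"
  unfolding outer_def by (intro homogeneous_sum homogeneous_const_mult homogeneous_var)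

lemma outer_sum_left: "outer J (\<lambda>P. \<Sum>i<n. c i * f i P) g = (\<Sum>i<n. const (c i) * outer J (f i) g)"
  unfolding outer_def const_sum sum_distrib_left sum_distrib_right
  by (subst (2) sum.swap, rule sum.cong[OF refl], subst (2) sum.swap) (simp add: const_sum sum_distrib_right mult.assoc)

lemma multiform_sum:
  "multiform const \<alpha> J (\<lambda>P. \<Sum>i<n. c i * f i P) = (\<Sum>i<n. const (c i) * multiform const \<alpha> J (f i))"
  "multiform (\<lambda>c. c) \<beta> J (\<lambda>P. \<Sum>i<n. c i * f i P) = (\<Sum>i<n. c i * multiform (\<lambda>c. c) \<beta> J (f i))"
  unfolding multiform_def const_sum sum_distrib_left sum_distrib_right
  by (subst sum.swap, simp add: mult.assoc)+

lemma outer_indicator: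
  assumes "P \<in> J \<rightarrow>\<^sub>E UNIV"
  shows "outer J (\<lambda>P'. if P' = P then 1 else 0) g = (\<Sum>Q\<in>- J \<rightarrow>\<^sub>E UNIV. const (g Q) * var (merge J P Q))"
proof -
  have "outer J (\<lambda>P'. if P' = P then 1 else 0) g = (\<Sum>P'\<in>J \<rightarrow>\<^sub>E UNIV.
      if P' = P then (\<Sum>Q\<in>- J \<rightarrow>\<^sub>E UNIV. const (g Q) * var (merge J P Q)) else 0)"
    unfolding outer_def by (intro sum.cong) auto
  then show ?thesis using assms finite_PiE_UNIV by simp
qed

lemma homogeneous_diagonal_form: "homogeneous (card J) (diagonal_form (J :: 'k::finite set) f)"
proof -
  have "homogeneous (\<Sum>j\<in>J. 1 :: nat) (\<Prod>j\<in>J. var (P j) :: 'n::finite cpoly)" for P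
    by (intro homogeneous_prod homogeneous_var)
  then show ?thesis unfolding multiform_def by (intro homogeneous_sum homogeneous_const_mult) simp
qed

text \<open>One multi-index \<open>P t\<close> is chosen for each monomial, so \<open>f\<close> is
  in general not symmetric; \<open>p\<close> determines only its symmetrization.\<close>

lemma diagonal_form_surj:
  fixes J :: "'k::finite set" and p :: "'n::finite cpoly"
  assumes "homogeneous (card J) p"
  shows "\<exists>f. p = diagonal_form J f"
proof -
  have "\<forall>t\<in>Poly_Mapping.keys p. \<exists>P. P \<in> J \<rightarrow>\<^sub>E UNIV \<and> Poly_Mapping.single t (1 :: complex) = (\<Prod>j\<in>J. var (P j))"
  proof
    fix t assume "t \<in> Poly_Mapping.keys p"
    then have "mdeg t = card J" using assms by (simp add: homogeneous_def)
    from monomial_eq_prod_vars[OF finite this]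
    show "\<exists>P. P \<in> J \<rightarrow>\<^sub>E UNIV \<and> Poly_Mapping.single t (1 :: complex) = (\<Prod>j\<in>J. var (P j))"
      unfolding Bex_def .
  qed
  from bchoice[OF this] obtain P where "\<forall>t\<in>Poly_Mapping.keys p. P t \<in> J \<rightarrow>\<^sub>E UNIV \<and>
      Poly_Mapping.single t (1 :: complex) = (\<Prod>j\<in>J. var (P t j))" ..
  then have P: "\<And>t. t \<in> Poly_Mapping.keys p \<Longrightarrow> P t \<in> J \<rightarrow>\<^sub>E UNIV"
    "\<And>t. t \<in> Poly_Mapping.keys p \<Longrightarrow> Poly_Mapping.single t (1 :: complex) = (\<Prod>j\<in>J. var (P t j))" by auto
  define f where "f Q = (\<Sum>t\<in>{t \<in> Poly_Mapping.keys p. P t = Q}. Poly_Mapping.lookup p t)" for Q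
  have "p = (\<Sum>t\<in>Poly_Mapping.keys p. const (Poly_Mapping.lookup p t) * Poly_Mapping.single t 1)"
    by (rule poly_eq_sum_monomials)
  also have "\<dots> = (\<Sum>Q\<in>J \<rightarrow>\<^sub>E UNIV. \<Sum>t\<in>{t \<in> Poly_Mapping.keys p. P t = Q}.
      const (Poly_Mapping.lookup p t) * Poly_Mapping.single t 1)"
    using P(1) by (intro sum.group[symmetric]) (auto simp: finite_PiE_UNIV)
  also have "\<dots> = diagonal_form J f"
    unfolding multiform_def f_def const_sum sum_distrib_right using P(2) by (intro sum.cong) auto
  finally show ?thesis by (intro exI[of _ f])
qed

text \<open>The substitution multiplies degrees by \<open>CARD('k)\<close>, so it respects
  homogeneous parts. For saturation the coordinates with constant multi-index suffice: they become
  the powers \<open>var v ^ CARD('k)\<close>.\<close>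

lemma closed_veronese_image:
  assumes "closed_subscheme (A :: 'n::finite cpoly set)"
  shows "closed_subscheme (veronese_image A :: ('k::finite \<Rightarrow> 'n) cpoly set)"
proof -
  interpret A: saturated_ideal A by unfold_locales fact
  have part: "veronese_subst (homogeneous_part d p) = homogeneous_part (CARD('k) * d) (veronese_subst p)"
    for p :: "('k \<Rightarrow> 'n) cpoly" and d
  proof -
    have "homogeneous_part (CARD('k) * d) (veronese_subst p) = (\<Sum>e\<in>mdeg ` Poly_Mapping.keys p.
        homogeneous_part (CARD('k) * d) (veronese_subst (homogeneous_part e p)))"
      by (subst sum_homogeneous_parts[of p]) (simp add: subst.poly_subst_sum homogeneous_part_sum)
    also have "\<dots> = (\<Sum>e\<in>mdeg ` Poly_Mapping.keys p. if e = d then veronese_subst (homogeneous_part d p) else 0)"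
      by (intro sum.cong refl) (auto simp: homogeneous_part_id homogeneous_veronese_subst
          intro!: homogeneous_part_other[OF homogeneous_veronese_subst[OF homogeneous_homogeneous_part]])
    also have "\<dots> = veronese_subst (homogeneous_part d p)"
      using homogeneous_part_eq_0[of d p] by (cases "d \<in> mdeg ` Poly_Mapping.keys p") auto
    finally show ?thesis ..
  qed
  have sat: "veronese_subst p \<in> A" if p: "\<forall>K. veronese_subst (var K ^ m * p :: ('k \<Rightarrow> 'n) cpoly) \<in> A" for p m
  proof (rule A.saturation)
    fix v
    have "veronese_subst (var (\<lambda>_ :: 'k. v) ^ m * p) = var v ^ (CARD('k) * m) * veronese_subst p"
      by (simp add: subst.poly_subst_mult subst.poly_subst_power power_mult)
    with p show "var v ^ (CARD('k) * m) * veronese_subst p \<in> A" by metis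
  qed
  show ?thesis
    unfolding closed_subscheme_def veronese_image_def mem_Collect_eq
    using A.add_mem A.mult_mem A.homogeneous_part_mem sat part
    by (simp add: subst.poly_subst_add subst.poly_subst_mult) blast
qed

text \<open>The image ideal is the preimage of \<open>A\<close>, and the substitution is onto in
  each degree; so it induces isomorphisms of the graded pieces of the quotients.\<close>

lemma veronese_image_hilbert_ge:
  fixes A :: "'n::finite cpoly set"
  shows "hilbert_ge (veronese_image A :: ('k::finite \<Rightarrow> 'n) cpoly set) d n \<longleftrightarrow> hilbert_ge A (CARD('k) * d) n"
proof
  let ?G = "veronese_image A :: ('k \<Rightarrow> 'n) cpoly set"
  have sum: "(\<Sum>i<n. const (c i) * veronese_subst (b i)) = veronese_subst (\<Sum>i<n. const (c i) * b i)"
    for c and b :: "nat \<Rightarrow> ('k \<Rightarrow> 'n) cpoly"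
    by (simp add: subst.poly_subst_sum subst.poly_subst_mult)
  show "hilbert_ge A (CARD('k) * d) n" if "hilbert_ge ?G d n"
    using that
  proof (rule codim_ge_transfer[where R = "\<lambda>p q. veronese_subst p = q"])
    fix c and b :: "nat \<Rightarrow> ('k \<Rightarrow> 'n) cpoly" and b'
    assume R: "\<And>i. i < n \<Longrightarrow> veronese_subst (b i) = b' i" and A: "(\<Sum>i<n. const (c i) * b' i) \<in> A"
    have "veronese_subst (\<Sum>i<n. const (c i) * b i) = (\<Sum>i<n. const (c i) * b' i)"
      unfolding sum[symmetric] using R by simp
    with A show "(\<Sum>i<n. const (c i) * b i) \<in> ?G" by (simp only: veronese_image_def mem_Collect_eq)
  qed (auto intro: homogeneous_veronese_subst)
  show "hilbert_ge ?G d n" if "hilbert_ge A (CARD('k) * d) n"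
    using that
  proof (rule codim_ge_transfer[where R = "\<lambda>q p. veronese_subst p = q"])
    show "\<exists>q\<in>{q. homogeneous d q}. veronese_subst (q :: ('k \<Rightarrow> 'n) cpoly) = p" if "p \<in> {p. homogeneous (CARD('k) * d) p}" for p
      using veronese_subst_surj[where 'k = 'k, of d p] that by blast
    fix c b and b' :: "nat \<Rightarrow> ('k \<Rightarrow> 'n) cpoly"
    assume R: "\<And>i. i < n \<Longrightarrow> veronese_subst (b' i) = b i" and G: "(\<Sum>i<n. const (c i) * b' i) \<in> ?G"
    have "veronese_subst (\<Sum>i<n. const (c i) * b' i) = (\<Sum>i<n. const (c i) * b i)"
      unfolding sum[symmetric] using R by simp
    with G show "(\<Sum>i<n. const (c i) * b i) \<in> A" by (simp only: veronese_image_def mem_Collect_eq)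
  qed
qed

section \<open>Apolarity and flattenings\<close>

lemma card_add_card_Compl: "card J + card (- J) = CARD('k)" for J :: "'k::finite set"
  using card_Un_disjoint[of J "- J"] by simp

section \<open>Lines, linear forms and spans\<close>

lemma proj_space_line:
  assumes "T \<in> proj_space"
  obtains \<tau> where "\<tau> \<noteq> 0" "T = vec.span {\<tau>}"
proof -
  have T: "vec.subspace T" "vec.dim T = 1" using assms by (auto simp: proj_space_def)
  obtain B where B: "B \<subseteq> T" "vec.independent B" "T \<subseteq> vec.span B" "card B = vec.dim T"
    using vec.basis_exists by blast
  then obtain \<tau> where \<tau>: "B = {\<tau>}" using T(2) by (auto simp: card_1_singleton_iff)
  show ?thesis
  proof (rule that)
    show "\<tau> \<noteq> 0" using B(2) unfolding \<tau> by simp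
    show "T = vec.span {\<tau>}" using vec.span_minimal[OF B(1) T(1)] B(3) unfolding \<tau> by blast
  qed
qed

lemma span_singleton_proj_space:
  assumes "\<tau> \<noteq> (0 :: complex ^ 'v)"
  shows "vec.span {\<tau>} \<in> proj_space"
  using assms by (simp add: proj_space_def)

lemma linear_form_kernel:
  assumes "homogeneous 1 l"
  shows "vec.subspace {x. poly_at l x = 0}"
proof -
  obtain c where "l = (\<Sum>v\<in>UNIV. const (c v) * var v)" using linear_form_eq[OF assms] ..
  then have "poly_at l x = (\<Sum>v\<in>UNIV. c v * x $ v)" for x by (simp add: poly_at_sum poly_at_simps)
  then show ?thesis
    by (simp add: vec.subspace_def distrib_left sum.distrib mult.left_commute sum_distrib_left[symmetric])
qed

lemma linear_form_vanishes_on_span: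
  assumes "homogeneous 1 l" "\<And>x. x \<in> S \<Longrightarrow> poly_at l x = 0" "y \<in> vec.span S"
  shows "poly_at l y = 0"
  using vec.span_minimal[OF _ linear_form_kernel[OF assms(1)], of S] assms by blast

lemma scheme_span_line_iff:
  assumes "\<tau> \<noteq> 0"
  shows "vec.span {\<tau>} \<in> scheme_span I \<longleftrightarrow> (\<forall>l\<in>I. homogeneous 1 l \<longrightarrow> poly_at l \<tau> = 0)"
proof
  assume "vec.span {\<tau>} \<in> scheme_span I"
  moreover have "\<tau> \<in> vec.span {\<tau>}" by (rule vec.span_base) simp
  ultimately show "\<forall>l\<in>I. homogeneous 1 l \<longrightarrow> poly_at l \<tau> = 0" unfolding scheme_span_def by blast
next
  assume "\<forall>l\<in>I. homogeneous 1 l \<longrightarrow> poly_at l \<tau> = 0"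
  then have "\<forall>l\<in>I. homogeneous 1 l \<longrightarrow> (\<forall>x\<in>vec.span {\<tau>}. poly_at l x = 0)"
    using linear_form_vanishes_on_span[of _ "{\<tau>}"] by auto
  then show "vec.span {\<tau>} \<in> scheme_span I"
    using span_singleton_proj_space[OF assms] unfolding scheme_span_def by blast
qed

text \<open>A polynomial vanishing on all pure tensors vanishes on those with equal factors; its
  pullback is zero at all points of the torus, hence zero.\<close>

lemma segre_ideal_subset_veronese_image:
  fixes A :: "'n::finite cpoly set"
  assumes "closed_subscheme A"
  shows "segre_ideal \<subseteq> (veronese_image A :: ('k::finite \<Rightarrow> 'n) cpoly set)"
proof
  interpret saturated_ideal A by unfold_locales fact
  fix p :: "('k \<Rightarrow> 'n) cpoly" assume p: "p \<in> segre_ideal"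
  have "veronese_subst p = 0"
  proof (rule poly_eq_zeroI)
    fix x :: "complex ^ 'n" assume "\<And>v. x $ v \<noteq> 0"
    then have "x \<noteq> 0" by auto
    then have "(\<lambda>_. vec.span {x}) \<in> (multi_proj_space :: ('k \<Rightarrow> (complex ^ 'n) set) set)"
      by (simp add: multi_proj_space_def span_singleton_proj_space)
    moreover have "pure_tensor (\<lambda>_ :: 'k. x) \<in> segre (\<lambda>_. vec.span {x})"
      unfolding segre_def using vec.span_base[of x "{x}"] by blast
    ultimately show "poly_at (veronese_subst p) x = 0"
      using p unfolding poly_at_veronese_subst segre_ideal_def by blast
  qed
  then show "p \<in> veronese_image A" by (simp add: veronese_image_def)
qed

text \<open>Each monomial of \<open>q\<close> is a multiple of some \<open>var v ^ m\<close>, to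
  which the hypothesis for that \<open>v\<close> applies; the cofactors add up.\<close>

lemma (in saturated_ideal) multiple_mod_large_degree:
  assumes charts: "\<And>v. \<exists>w. var v ^ m * u - y * w \<in> I" and q: "homogeneous Q q" "m * CARD('v) \<le> Q"
  shows "\<exists>w. q * u - y * w \<in> I"
proof -
  obtain w where w: "\<And>v. var v ^ m * u - y * w v \<in> I" using charts by metis
  have mon: "\<exists>z. Poly_Mapping.single t 1 * u - y * z \<in> I" if t: "t \<in> Poly_Mapping.keys q" for t
  proof -
    have "m * CARD('v) \<le> mdeg t" using q t by (simp add: homogeneous_def)
    then obtain v t' where t': "Poly_Mapping.single t (1 :: complex) = var v ^ m * Poly_Mapping.single t' 1"
      by (rule monomial_divisible)
    have "Poly_Mapping.single t 1 * u - y * (Poly_Mapping.single t' 1 * w v)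
        = Poly_Mapping.single t' 1 * (var v ^ m * u - y * w v)"
      unfolding t' by (simp add: algebra_simps)
    then show ?thesis using mult_mem[OF w] by metis
  qed
  then have "\<forall>t\<in>Poly_Mapping.keys q. \<exists>z. Poly_Mapping.single t 1 * u - y * z \<in> I" ..
  from bchoice[OF this] obtain z where z: "\<forall>t\<in>Poly_Mapping.keys q. Poly_Mapping.single t 1 * u - y * z t \<in> I" ..
  have "q * u = (\<Sum>t\<in>Poly_Mapping.keys q. const (Poly_Mapping.lookup q t) * (Poly_Mapping.single t 1 * u))"
    using arg_cong[OF poly_eq_sum_monomials[of q], of "\<lambda>x. x * u"] by (simp only: sum_distrib_right mult.assoc)
  then have "q * u - y * (\<Sum>t\<in>Poly_Mapping.keys q. const (Poly_Mapping.lookup q t) * z t) =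
      (\<Sum>t\<in>Poly_Mapping.keys q. const (Poly_Mapping.lookup q t) * (Poly_Mapping.single t 1 * u - y * z t))"
    by (simp only: sum_distrib_left right_diff_distrib sum_subtractf mult.left_commute[of y])
  moreover have "(\<Sum>t\<in>Poly_Mapping.keys q. const (Poly_Mapping.lookup q t) * (Poly_Mapping.single t 1 * u - y * z t)) \<in> I"
    using z by (intro sum_mem mult_mem) blast
  ultimately show ?thesis by metis
qed

text \<open>The saturation of the ideal generated by \<open>I\<close> and \<open>y\<close>, that is,
  the subscheme cut out by \<open>y\<close>.\<close>

definition add_generator :: "'v::finite cpoly set \<Rightarrow> 'v cpoly \<Rightarrow> 'v cpoly set" where
  "add_generator I y = {p. \<exists>m. \<forall>v. \<exists>w. var v ^ m * p - y * w \<in> I}"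

lemma (in saturated_ideal) add_generator_mono_exponent:
  assumes "\<exists>w. var v ^ m * p - y * w \<in> I" "m \<le> n"
  shows "\<exists>w. var v ^ n * p - y * w \<in> I"
proof -
  obtain w where w: "var v ^ m * p - y * w \<in> I" using assms(1) ..
  have "var v ^ n = var v ^ (n - m) * var v ^ m" using assms(2) by (simp add: power_add[symmetric])
  then have "var v ^ n * p - y * (var v ^ (n - m) * w) = var v ^ (n - m) * (var v ^ m * p - y * w)"
    unfolding \<open>var v ^ n = _\<close> by (simp add: algebra_simps)
  then show ?thesis using mult_mem[OF w] by metis
qed

lemma (in saturated_ideal) closed_add_generator:
  assumes y: "homogeneous a y"
  shows "closed_subscheme (add_generator I y)"
proof -
  have "p + q \<in> add_generator I y" if p: "p \<in> add_generator I y" and q: "q \<in> add_generator I y" for p q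
  proof -
    obtain m where m: "\<And>v. \<exists>w. var v ^ m * p - y * w \<in> I" using p unfolding add_generator_def by blast
    obtain n where n: "\<And>v. \<exists>w. var v ^ n * q - y * w \<in> I" using q unfolding add_generator_def by blast
    have "\<exists>w. var v ^ (m + n) * (p + q) - y * w \<in> I" for v
    proof -
      obtain w w' where "var v ^ (m + n) * p - y * w \<in> I" "var v ^ (m + n) * q - y * w' \<in> I"
        using add_generator_mono_exponent[OF m, of "m + n" v] add_generator_mono_exponent[OF n, of "m + n" v]
        by auto
      then have "var v ^ (m + n) * (p + q) - y * (w + w') \<in> I"
        using add_mem by (fastforce simp: algebra_simps)
      then show ?thesis ..
    qed
    then show ?thesis unfolding add_generator_def by blast
  qed
  moreover have "r * p \<in> add_generator I y" if p: "p \<in> add_generator I y" for p r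
  proof -
    obtain m where m: "\<And>v. \<exists>w. var v ^ m * p - y * w \<in> I" using p unfolding add_generator_def by blast
    have "\<exists>w. var v ^ m * (r * p) - y * w \<in> I" for v
    proof -
      obtain w where "var v ^ m * p - y * w \<in> I" using m by blast
      from mult_mem[OF this, of r] have "var v ^ m * (r * p) - y * (r * w) \<in> I"
        by (simp add: algebra_simps)
      then show ?thesis ..
    qed
    then show ?thesis unfolding add_generator_def by blast
  qed
  moreover have "homogeneous_part d p \<in> add_generator I y" if p: "p \<in> add_generator I y" for p d
  proof -
    obtain m where m: "\<And>v. \<exists>w. var v ^ m * p - y * w \<in> I" using p unfolding add_generator_def by blast
    \<comment> \<open>The extra exponent \<open>a\<close>, the degree of \<open>y\<close>, keeps the
      total degree at least \<open>a\<close>, so that the matching component of \<open>w\<close> has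
      a natural number as its degree.\<close>
    have "\<exists>w. var v ^ (a + m) * homogeneous_part d p - y * w \<in> I" for v
    proof -
      obtain w where "var v ^ (a + m) * p - y * w \<in> I"
        using add_generator_mono_exponent[OF m, of "a + m" v] by auto
      then have "homogeneous_part (a + m + d) (var v ^ (a + m) * p - y * w) \<in> I"
        by (rule homogeneous_part_mem)
      also have "homogeneous_part (a + m + d) (var v ^ (a + m) * p - y * w) =
          var v ^ (a + m) * homogeneous_part d p - y * homogeneous_part (m + d) w"
        unfolding homogeneous_part_diff homogeneous_part_power_mult[OF homogeneous_var]
        using homogeneous_part_mult[OF y, of "m + d" w] by (simp add: add.assoc)
      finally show ?thesis ..
    qed
    then show ?thesis unfolding add_generator_def by blast
  qed
  moreover have "p \<in> add_generator I y" if p: "\<And>v. var v ^ m * p \<in> add_generator I y" for p m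
  proof -
    have "\<forall>v. \<exists>n. \<forall>u. \<exists>w. var u ^ n * (var v ^ m * p) - y * w \<in> I"
      using p unfolding add_generator_def by blast
    then obtain n where n: "\<And>v u. \<exists>w. var u ^ n v * (var v ^ m * p) - y * w \<in> I" by metis
    define M where "M = Max (range n)"
    have "\<exists>w. var v ^ (M + m) * p - y * w \<in> I" for v
      using add_generator_mono_exponent[OF n[of v v], of M] by (simp add: M_def power_add mult.assoc)
    then show ?thesis unfolding add_generator_def by blast
  qed
  moreover have "0 \<in> add_generator I y" unfolding add_generator_def by (auto intro: exI[of _ 0])
  ultimately show ?thesis unfolding closed_subscheme_def by blast
qed

lemma (in saturated_ideal) add_generator_superset:
  assumes "y \<notin> I"
  shows "I \<subset> add_generator I y"
proof -
  have "\<forall>v. \<exists>w. var v ^ 0 * y - y * w \<in> I" by (intro allI exI[of _ 1]) simp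
  then have "y \<in> add_generator I y" unfolding add_generator_def by blast
  moreover have "\<forall>v. \<exists>w. var v ^ 0 * p - y * w \<in> I" if "p \<in> I" for p
    using that by (intro allI exI[of _ 0]) simp
  then have "I \<subseteq> add_generator I y" unfolding add_generator_def by blast
  ultimately show ?thesis using assms by blast
qed

text \<open>Saturation only makes \<open>l ^ Q * u\<close> a multiple of \<open>y\<close> modulo
  \<open>I\<close>. The cofactor has degree \<open>Q + b\<close>; as the Hilbert function is maximal
  in degree \<open>b\<close>, it is itself divisible by \<open>l ^ Q\<close>, which then
  cancels.\<close>

lemma (in regular_section) add_generator_homogeneous:
  assumes lim: "hilbert_limit I b r" and y: "homogeneous a y" and u: "homogeneous (a + b) u"
    and mem: "u \<in> add_generator I y"
  obtains w where "homogeneous b w" "u - y * w \<in> I"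
proof -
  obtain m where m: "\<And>v. \<exists>w. var v ^ m * u - y * w \<in> I" using mem unfolding add_generator_def by blast
  define Q where "Q = m * CARD('v)"
  obtain w where "l ^ Q * u - y * w \<in> I"
    using multiple_mod_large_degree[OF m homogeneous_l_power[of Q]] unfolding Q_def by blast
  then have "homogeneous_part (a + (Q + b)) (l ^ Q * u - y * w) \<in> I" by (rule homogeneous_part_mem)
  moreover have "homogeneous_part (a + (Q + b)) (l ^ Q * u) = l ^ Q * u"
    using homogeneous_l_power_mult[OF u, of Q] by (intro homogeneous_part_id) (simp add: add.left_commute)
  ultimately have w: "l ^ Q * u - y * homogeneous_part (Q + b) w \<in> I"
    by (simp add: homogeneous_part_diff homogeneous_part_mult[OF y])
  obtain w' where w': "homogeneous b w'" "homogeneous_part (Q + b) w - l ^ Q * w' \<in> I"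
    using hilbert_limit_lift[OF lim homogeneous_homogeneous_part] by blast
  have "l ^ Q * (u - y * w') = (l ^ Q * u - y * homogeneous_part (Q + b) w) + y * (homogeneous_part (Q + b) w - l ^ Q * w')"
    by (simp add: algebra_simps)
  then have "l ^ Q * (u - y * w') \<in> I" using add_mem[OF w mult_mem[OF w'(2)]] by simp
  then have "u - y * w' \<in> I" by (rule power_cancel)
  with w'(1) show ?thesis by (rule that)
qed

text \<open>
  The elements pairing to zero with everything generate the ideal of a subscheme of \<open>A\<close> whose span
  still contains \<open>T\<close>, so minimality of \<open>A\<close> makes the apolar pairing nondegenerate.
\<close>

lemma (in regular_section) pairing_nondegenerate:
  fixes J :: "'k::finite set" and \<tau> :: "complex ^ ('k \<Rightarrow> 'v)"
  assumes lim: "hilbert_limit I (card (- J)) r"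
    and \<tau>: "\<And>p. homogeneous 1 p \<Longrightarrow> veronese_subst p \<in> I \<Longrightarrow> poly_at p \<tau> = 0"
    and minimal: "\<And>A'. closed_subscheme A' \<Longrightarrow> I \<subset> A' \<Longrightarrow>
      \<exists>p. homogeneous 1 p \<and> veronese_subst p \<in> A' \<and> poly_at p \<tau> \<noteq> 0"
    and f: "\<And>g. poly_at (outer J f g) \<tau> = 0"
  shows "diagonal_form J f \<in> I"
proof (rule ccontr)
  let ?y = "diagonal_form J f"
  assume "?y \<notin> I"
  then obtain p where p: "homogeneous 1 p" "veronese_subst p \<in> add_generator I ?y" "poly_at p \<tau> \<noteq> 0"
    using minimal[OF closed_add_generator[OF homogeneous_diagonal_form] add_generator_superset] by blast
  have "homogeneous (card J + card (- J)) (veronese_subst p)"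
    unfolding card_add_card_Compl using homogeneous_veronese_subst[OF p(1)] by simp
  then obtain w where w: "homogeneous (card (- J)) w" "veronese_subst p - ?y * w \<in> I"
    using add_generator_homogeneous[OF lim homogeneous_diagonal_form _ p(2)] by blast
  obtain g where "w = diagonal_form (- J) g" using diagonal_form_surj[OF w(1)] ..
  then have "veronese_subst (p - outer J f g) \<in> I"
    using w(2) by (simp add: subst.poly_subst_diff veronese_subst_outer)
  then have "poly_at (p - outer J f g) \<tau> = 0"
    by (intro \<tau> homogeneous_diff p homogeneous_outer)
  with f p(3) show False by (simp add: poly_at_simps)
qed

text \<open>The contractions of \<tau> with the tensors \<open>f i\<close> are independent; such
  \<open>f\<close> exist exactly when the flattening of \<tau> along \<open>J\<close> has rank at
  least \<open>n\<close>.\<close>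

definition flattening_independent ::
  "'k::finite set \<Rightarrow> complex ^ ('k \<Rightarrow> 'n::finite) \<Rightarrow> nat \<Rightarrow> (nat \<Rightarrow> ('k \<Rightarrow> 'n) \<Rightarrow> complex) \<Rightarrow> bool" where
  "flattening_independent J \<tau> n f \<longleftrightarrow>
    (\<forall>c. (\<forall>g. poly_at (outer J (\<lambda>P. \<Sum>i<n. c i * f i P) g) \<tau> = 0) \<longrightarrow> (\<forall>i<n. c i = 0))"

lemma (in regular_section) ex_flattening_independent:
  fixes J :: "'k::finite set" and \<tau> :: "complex ^ ('k \<Rightarrow> 'v)"
  assumes lim: "hilbert_limit I (card (- J)) r" and n: "hilbert_ge I (card J) n"
    and \<tau>: "\<And>p. homogeneous 1 p \<Longrightarrow> veronese_subst p \<in> I \<Longrightarrow> poly_at p \<tau> = 0"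
    and minimal: "\<And>A'. closed_subscheme A' \<Longrightarrow> I \<subset> A' \<Longrightarrow>
      \<exists>p. homogeneous 1 p \<and> veronese_subst p \<in> A' \<and> poly_at p \<tau> \<noteq> 0"
  obtains f where "flattening_independent J \<tau> n f"
proof -
  obtain b where b: "\<And>i. i < n \<Longrightarrow> homogeneous (card J) (b i)"
    "\<And>c. (\<Sum>i<n. const (c i) * b i) \<in> I \<Longrightarrow> \<forall>i<n. c i = 0"
    using n unfolding codim_ge_def by blast
  have "\<forall>i. \<exists>f. i < n \<longrightarrow> b i = diagonal_form J f" using diagonal_form_surj[OF b(1)] by blast
  then obtain f where f: "\<And>i. i < n \<Longrightarrow> b i = diagonal_form J (f i)" by metis
  have "flattening_independent J \<tau> n f"
    unfolding flattening_independent_def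
  proof (intro allI impI)
    fix c assume "\<forall>g. poly_at (outer J (\<lambda>P. \<Sum>i<n. c i * f i P) g) \<tau> = 0"
    then have "diagonal_form J (\<lambda>P. \<Sum>i<n. c i * f i P) \<in> I"
      using pairing_nondegenerate[OF lim \<tau> minimal] by blast
    then have "(\<Sum>i<n. const (c i) * b i) \<in> I" using f by (simp add: multiform_sum)
    then show "c i = 0" if "i < n" for i using b(2) that by blast
  qed
  then show ?thesis by (rule that)
qed

lemma hilbert_ge_of_flattening:
  fixes G :: "('k::finite \<Rightarrow> 'n::finite) cpoly set" and \<tau> :: "complex ^ ('k \<Rightarrow> 'n)"
  assumes "closed_subscheme G" and bounded: "hilbert_bounded G N" and segre: "segre_ideal \<subseteq> G"
    and \<tau>: "\<And>p. homogeneous 1 p \<Longrightarrow> p \<in> G \<Longrightarrow> poly_at p \<tau> = 0"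
    and f: "flattening_independent J \<tau> n f"
  shows "hilbert_ge G 1 n"
proof -
  interpret saturated_ideal G by unfold_locales fact
  let ?e = "\<lambda>P P'. if P' = P then 1 else 0 :: complex"
  \<comment> \<open>This is the general \<open>g\<^sub>0\<close>, serving all basis tensors
    \<open>P\<close> at once: the coordinate \<open>var (merge J P Q)\<close> is the product of the
    basis tensors \<open>P\<close> and \<open>Q\<close>.\<close>
  obtain h where h: "\<forall>P\<in>J \<rightarrow>\<^sub>E UNIV. \<forall>b. torsion G (\<Sum>Q\<in>- J \<rightarrow>\<^sub>E UNIV. const (h Q) * var (merge J P Q)) b \<longrightarrow>
      (\<forall>Q\<in>- J \<rightarrow>\<^sub>E UNIV. torsion G (var (merge J P Q)) b)"
    using general_combination[where p = "\<lambda>Q P. var (merge J P Q)",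
        OF bounded finite_PiE_UNIV finite_PiE_UNIV homogeneous_var] ..
  have swap: "outer J u g \<in> G" if u: "outer J u h \<in> G" for u g
  proof (rule torsion_vars_imp_mem)
    fix K :: "'k \<Rightarrow> 'n"
    let ?P = "restrict K J" and ?Q = "restrict K (- J)"
    \<comment> \<open>On a pure tensor both products consist of the same four factors.\<close>
    have "outer J (?e ?P) h * outer J u g - outer J u h * outer J (?e ?P) g \<in> segre_ideal"
      unfolding segre_ideal_def segre_def
      by (auto simp: poly_at_simps poly_at_outer)
    then have "outer J (?e ?P) h * outer J u g - outer J u h * outer J (?e ?P) g \<in> G" using segre by blast
    then have "outer J (?e ?P) h ^ 1 * outer J u g \<in> G"
      using mem_cong mult_mem'[OF u] by simp
    then have "torsion G (outer J (?e ?P) h) (outer J u g)" unfolding torsion_def ..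
    then have "torsion G (var (merge J ?P ?Q)) (outer J u g)"
      using h by (subst (asm) outer_indicator) auto
    moreover have "merge J ?P ?Q = K" by (auto simp: merge_def fun_eq_iff)
    ultimately show "torsion G (var K) (outer J u g)" by simp
  qed
  show ?thesis
  proof (rule codim_geI)
    fix c assume "(\<Sum>i<n. const (c i) * outer J (f i) h) \<in> G"
    then have "outer J (\<lambda>P. \<Sum>i<n. c i * f i P) h \<in> G" by (simp add: outer_sum_left)
    then have "outer J (\<lambda>P. \<Sum>i<n. c i * f i P) g \<in> G" for g by (rule swap)
    then have "\<forall>g. poly_at (outer J (\<lambda>P. \<Sum>i<n. c i * f i P) g) \<tau> = 0"
      using \<tau> homogeneous_outer by blast
    then show "\<forall>i<n. c i = 0" using f unfolding flattening_independent_def by blast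
  qed (use homogeneous_outer in blast)
qed

text \<open>Each point imposes one linear condition on combinations of the \<open>f i\<close>: to
  vanish on its factors in \<open>J\<close>. With fewer than \<open>n\<close> points a nontrivial
  combination meets them all, and its product with any \<open>g\<close> vanishes on the
  span.\<close>

lemma card_ge_of_flattening:
  fixes \<tau> :: "complex ^ ('k::finite \<Rightarrow> 'n::finite)"
  assumes "finite S" and S: "S \<subseteq> multi_proj_space" and \<tau>: "\<tau> \<in> vec.span (\<Union>(segre ` S))"
    and f: "flattening_independent J \<tau> n f"
  shows "n \<le> card S"
proof (rule ccontr)
  assume "\<not> n \<le> card S"
  then have "card S < n" by simp
  have "\<exists>u. y j = vec.span {u}" if "y \<in> S" for y j
    using that S proj_space_line unfolding multi_proj_space_def by blast
  then obtain u where u: "\<And>y j. y \<in> S \<Longrightarrow> y j = vec.span {u y j}" by metis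
  let ?m = "\<lambda>x. multiform (\<lambda>c. c) (\<lambda>j v. x j $ v) J"
  obtain c where c: "\<exists>i<n. c i \<noteq> 0" "\<And>y. y \<in> S \<Longrightarrow> (\<Sum>i<n. c i * ?m (u y) (f i)) = 0"
    using homogeneous_system_nat[OF \<open>finite S\<close> \<open>card S < n\<close>, of "\<lambda>i y. ?m (u y) (f i)"] by blast
  have "poly_at (outer J (\<lambda>P. \<Sum>i<n. c i * f i P) g) \<tau> = 0" for g
  proof (rule linear_form_vanishes_on_span[OF homogeneous_outer _ \<tau>])
    fix t assume "t \<in> \<Union>(segre ` S)"
    then obtain y x where y: "y \<in> S" and t: "t = pure_tensor x" and x: "\<And>j. x j \<in> y j"
      unfolding segre_def by blast
    have "\<exists>a. x j = a *s u y j" for j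
    proof -
      have "x j \<in> vec.span {u y j}" using x[of j] u[OF y, of j] by simp
      then show ?thesis unfolding vec.span_singleton by auto
    qed
    then obtain a where a: "\<And>j. x j = a j *s u y j" by metis
    \<comment> \<open>Other representatives of the lines change the value by a scalar only, so one
      choice \<open>u\<close> per point suffices.\<close>
    have "?m x q = (\<Prod>j\<in>J. a j) * ?m (u y) q" for q
      unfolding multiform_def a sum_distrib_left
      by (simp add: prod.distrib mult_ac)
    then have "?m x (\<lambda>P. \<Sum>i<n. c i * f i P) = (\<Prod>j\<in>J. a j) * ?m (u y) (\<lambda>P. \<Sum>i<n. c i * f i P)" .
    also have "?m (u y) (\<lambda>P. \<Sum>i<n. c i * f i P) = 0"
      unfolding multiform_sum(2) by (rule c(2)[OF y])
    finally have "?m x (\<lambda>P. \<Sum>i<n. c i * f i P) = 0" by simp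
    then show "poly_at (outer J (\<lambda>P. \<Sum>i<n. c i * f i P) g) t = 0"
      unfolding t poly_at_outer by simp
  qed
  then have "\<forall>i<n. c i = 0" using f unfolding flattening_independent_def by blast
  with c(1) show False by blast
qed

section \<open>Reduced schemes and the rank\<close>

lemma homogenization_root:
  assumes "degree h \<le> d"
  shows "homogenization ([:- s, 1:] * h) p q (Suc d) = (p - const s * q) * homogenization h p q d"
proof -
  have "homogenization (pCons 0 h) p q (Suc d) = p * homogenization h p q d"
    unfolding homogenization_def sum.atMost_Suc_shift by (simp add: sum_distrib_left mult_ac)
  moreover have "homogenization (smult s h) p q (Suc d) = const s * q * homogenization h p q d"
  proof -
    have "coeff h (Suc d) = 0" using assms by (simp add: coeff_eq_0)
    then have "homogenization (smult s h) p q (Suc d) = (\<Sum>i\<le>d. const (s * coeff h i) * p ^ i * q ^ (Suc d - i))"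
      by (simp add: homogenization_def)
    also have "\<dots> = const s * q * homogenization h p q d"
      unfolding homogenization_def sum_distrib_left by (intro sum.cong) (auto simp: Suc_diff_le mult_ac)
    finally show ?thesis .
  qed
  moreover have "[:- s, 1:] * h = pCons 0 h - smult s h" by simp
  ultimately show ?thesis
    by (simp add: homogenization_def sum_subtractf left_diff_distrib)
qed

context regular_section
begin

text \<open>A nonzero constant homogenizes to a nonzero multiple of \<open>l ^ d\<close>, which
  annihilates nothing outside \<open>I\<close>.\<close>

lemma degree_annihilating_form:
  assumes "\<beta> \<notin> I" "h \<noteq> 0" "homogenization h p l d * \<beta> \<in> I"
  shows "degree h \<noteq> 0"
proof
  assume "degree h = 0"
  then obtain a where a: "h = [:a:]" by (rule degree_eq_zeroE)
  then have "a \<noteq> 0" using assms by simp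
  have "homogenization h p l d = (\<Sum>i\<le>d. if i = 0 then const a * l ^ d else 0)"
    unfolding homogenization_def a by (intro sum.cong) (auto simp: coeff_pCons split: nat.split)
  then have "const (inverse a) * (const a * (l ^ d * \<beta>)) \<in> I"
    using assms(3) by (intro mult_mem[of _ "const (inverse a)"]) (simp add: mult.assoc)
  then have "l ^ d * \<beta> \<in> I" unfolding const_mult_cancel[OF \<open>a \<noteq> 0\<close>] .
  with assms(1) show False using power_cancel by blast
qed

text \<open>\<open>h\<close> acts as an annihilating polynomial for multiplication by the ratio of
  \<open>p\<close> and \<open>l\<close>. Roots are split off one by one; the first cofactor that no
  longer annihilates \<beta> maps it to an eigenvector. Here the field has to be algebraically
  closed.\<close>

lemma eigenvector_step:
  assumes "\<beta> \<notin> I" "h \<noteq> 0" "degree h \<le> d" "homogenization h p l d * \<beta> \<in> I"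
  shows "\<exists>y s. y * \<beta> \<notin> I \<and> (p - const s * l) * (y * \<beta>) \<in> I"
  using assms(2-)
proof (induction d arbitrary: h)
  case 0
  with degree_annihilating_form[OF assms(1)] show ?case by blast
next
  case (Suc d)
  have "\<not> constant (poly h)"
    using degree_annihilating_form[OF assms(1)] Suc.prems unfolding constant_degree by blast
  then obtain s where "poly h s = 0" using fundamental_theorem_of_algebra by blast
  then obtain h' where h': "h = [:- s, 1:] * h'" unfolding poly_eq_0_iff_dvd by (elim dvdE)
  then have "h' \<noteq> 0" using Suc.prems by auto
  then have "degree h' \<le> d" using Suc.prems(2) unfolding h' by (subst (asm) degree_mult_eq) auto
  then have root: "homogenization h p l (Suc d) = (p - const s * l) * homogenization h' p l d"
    unfolding h' by (rule homogenization_root)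
  show ?case
  proof (cases "homogenization h' p l d * \<beta> \<in> I")
    case True
    with \<open>h' \<noteq> 0\<close> \<open>degree h' \<le> d\<close> show ?thesis by (rule Suc.IH)
  next
    case False
    with Suc.prems(3) show ?thesis unfolding root by (auto simp: mult.assoc)
  qed
qed

text \<open>Multiplications commute: passing to a further multiple for the next variable keeps the
  eigenvector property for the earlier ones.\<close>

lemma simultaneous_eigenvector:
  assumes bounded: "hilbert_bounded I N" and "\<beta> \<notin> I" and "finite W"
  shows "\<exists>b. b * \<beta> \<notin> I \<and> (\<forall>v\<in>W. \<exists>s. (var v - const s * l) * (b * \<beta>) \<in> I)"
  using \<open>finite W\<close>
proof (induction W rule: finite_induct)
  case empty
  then show ?case using \<open>\<beta> \<notin> I\<close> by (intro exI[of _ 1]) simp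
next
  case (insert w W)
  then obtain b where b: "b * \<beta> \<notin> I" "\<And>v. v \<in> W \<Longrightarrow> \<exists>s. (var v - const s * l) * (b * \<beta>) \<in> I" by blast
  obtain h where h: "h \<noteq> 0" "degree h \<le> N" "homogenization h (var w) l N \<in> I"
    using ex_binary_form[OF bounded homogeneous_var linear] .
  obtain y s where y: "y * (b * \<beta>) \<notin> I" "(var w - const s * l) * (y * (b * \<beta>)) \<in> I"
    using eigenvector_step[OF b(1) h(1,2) mult_mem'[OF h(3)]] by blast
  have "\<exists>s. (var v - const s * l) * (y * (b * \<beta>)) \<in> I" if "v \<in> insert w W" for v
  proof (cases "v = w")
    case True
    with y(2) show ?thesis by blast
  next
    case False
    then have "v \<in> W" using that by simp
    then obtain s where "(var v - const s * l) * (b * \<beta>) \<in> I" using b(2) by blast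
    from mult_mem[OF this, of y] show ?thesis by (intro exI[of _ s]) (simp only: mult.left_commute)
  qed
  with y(1) show ?case by (intro exI[of _ "y * b"]) (simp add: mult.assoc)
qed

text \<open>Modulo the annihilator of \<beta> each variable is a scalar times \<open>l\<close>, so a
  form of degree \<open>d\<close> is its value at these scalars times \<open>l ^ d\<close>.\<close>

lemma evaluation_congruence:
  assumes c: "\<And>v. (var v - const (c v) * l) * \<beta> \<in> I" and g: "homogeneous d g"
  shows "(g - const (poly_at g (\<chi> v. c v)) * l ^ d) * \<beta> \<in> I"
proof -
  have mult: "(p * q - p' * q') * \<beta> \<in> I" if "(p - p') * \<beta> \<in> I" "(q - q') * \<beta> \<in> I" for p p' q q'
  proof -
    have "(p * q - p' * q') * \<beta> = q * ((p - p') * \<beta>) + p' * ((q - q') * \<beta>)"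
      by (simp add: algebra_simps)
    then show ?thesis using add_mem[OF mult_mem[OF that(1)] mult_mem[OF that(2)]] by simp
  qed
  have power: "(p ^ n - p' ^ n) * \<beta> \<in> I" if "(p - p') * \<beta> \<in> I" for p p' n
    by (induction n) (auto intro: mult that)
  have prod: "((\<Prod>x\<in>X. f x) - (\<Prod>x\<in>X. f' x)) * \<beta> \<in> I" if "\<And>x. (f x - f' x) * \<beta> \<in> I" for f f' and X :: "'v set"
    by (induction X rule: infinite_finite_induct) (auto intro: mult that)
  have mon: "(Poly_Mapping.single t 1 - const (\<Prod>v\<in>UNIV. c v ^ Poly_Mapping.lookup t v) * l ^ d) * \<beta> \<in> I"
    if t: "t \<in> Poly_Mapping.keys g" for t
  proof -
    have deg: "(\<Sum>v\<in>UNIV. Poly_Mapping.lookup t v) = d" using g t by (simp add: homogeneous_def mdeg_def)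
    have "(\<Prod>v\<in>UNIV. (const (c v) * l) ^ Poly_Mapping.lookup t v)
        = (\<Prod>v\<in>UNIV. const (c v ^ Poly_Mapping.lookup t v)) * (\<Prod>v\<in>UNIV. l ^ Poly_Mapping.lookup t v)"
      by (simp add: power_mult_distrib prod.distrib)
    also have "\<dots> = const (\<Prod>v\<in>UNIV. c v ^ Poly_Mapping.lookup t v) * l ^ d"
      unfolding power_sum[symmetric] deg const_prod ..
    finally have eq: "(\<Prod>v\<in>UNIV. (const (c v) * l) ^ Poly_Mapping.lookup t v)
        = const (\<Prod>v\<in>UNIV. c v ^ Poly_Mapping.lookup t v) * l ^ d" .
    have "((\<Prod>v\<in>UNIV. var v ^ Poly_Mapping.lookup t v) -
        (\<Prod>v\<in>UNIV. (const (c v) * l) ^ Poly_Mapping.lookup t v)) * \<beta> \<in> I"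
      by (rule prod[OF power[OF c]])
    then show ?thesis unfolding eq prod_var_power .
  qed
  have "g - const (poly_at g (\<chi> v. c v)) * l ^ d = (\<Sum>t\<in>Poly_Mapping.keys g. const (Poly_Mapping.lookup g t) *
      (Poly_Mapping.single t 1 - const (\<Prod>v\<in>UNIV. c v ^ Poly_Mapping.lookup t v) * l ^ d))"
    unfolding right_diff_distrib sum_subtractf poly_eq_sum_monomials[symmetric]
    by (simp add: poly_at_def poly_subst_def const_sum sum_distrib_right mult.assoc)
  then have "(g - const (poly_at g (\<chi> v. c v)) * l ^ d) * \<beta> = (\<Sum>t\<in>Poly_Mapping.keys g. const (Poly_Mapping.lookup g t) *
      ((Poly_Mapping.single t 1 - const (\<Prod>v\<in>UNIV. c v ^ Poly_Mapping.lookup t v) * l ^ d) * \<beta>))"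
    by (simp only: sum_distrib_right mult.assoc)
  also have "\<dots> \<in> I" by (intro sum_mem) (rule mult_mem[OF mon])
  finally show ?thesis .
qed

text \<open>A Nullstellensatz for finite schemes: the joint eigenvalues of the variables are the
  coordinates of a point. Looking for the eigenvector among the multiples of \<open>f\<close> gives
  a point where \<open>f\<close> is nonzero.\<close>

lemma common_zero:
  assumes bounded: "hilbert_bounded I N" and reduced: "reduced_subscheme I"
    and f: "homogeneous d f" "f \<notin> I"
  obtains x where "x \<noteq> 0" "poly_at f x \<noteq> 0" "\<And>g e. g \<in> I \<Longrightarrow> homogeneous e g \<Longrightarrow> poly_at g x = 0"
proof -
  obtain b where b: "b * f \<notin> I" "\<And>v. \<exists>s. (var v - const s * l) * (b * f) \<in> I"
    using simultaneous_eigenvector[OF bounded f(2), of UNIV] by auto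
  obtain c where c: "\<And>v. (var v - const (c v) * l) * (b * f) \<in> I" using b(2) by metis
  have eval: "(g - const (poly_at g (\<chi> v. c v)) * l ^ e) * (b * f) \<in> I" if "homogeneous e g" for g e
    using evaluation_congruence[OF c that] .
  have zero: "poly_at g (\<chi> v. c v) = 0" if "homogeneous e g" "g * (b * f) \<in> I" for g e
  proof (rule ccontr)
    assume nz: "poly_at g (\<chi> v. c v) \<noteq> 0"
    have "g * (b * f) - const (poly_at g (\<chi> v. c v)) * (l ^ e * (b * f)) \<in> I"
      using eval[OF that(1)] by (simp add: left_diff_distrib mult.assoc)
    then have "const (poly_at g (\<chi> v. c v)) * (l ^ e * (b * f)) \<in> I" using mem_cong that(2) by blast
    then have "const (inverse (poly_at g (\<chi> v. c v))) * (const (poly_at g (\<chi> v. c v)) * (l ^ e * (b * f))) \<in> I"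
      by (rule mult_mem)
    then have "l ^ e * (b * f) \<in> I" unfolding const_mult_cancel[OF nz] .
    with b(1) power_cancel show False by blast
  qed
  show ?thesis
  proof (rule that)
    show "(\<chi> v. c v) \<noteq> 0"
    proof
      assume 0: "(\<chi> v. c v) = 0"
      \<comment> \<open>If all eigenvalues were 0, \<open>l\<close> would annihilate
        \<open>b * f\<close> modulo \<open>I\<close>, contrary to its being a
        nonzerodivisor.\<close>
      have "poly_at l (0 :: complex ^ 'v) = 0" using vec.subspace_0[OF linear_form_kernel[OF linear]] by simp
      then have "l ^ 1 * (b * f) \<in> I" using eval[OF linear] unfolding 0 by simp
      with b(1) power_cancel show False by blast
    qed
    show "poly_at f (\<chi> v. c v) \<noteq> 0"
    proof
      \<comment> \<open>Then \<open>f\<close> would annihilate \<open>b * f\<close> modulo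
        \<open>I\<close>, making \<open>b * f\<close> nilpotent but nonzero in the quotient;
        reducedness forbids this.\<close>
      assume 0: "poly_at f (\<chi> v. c v) = 0"
      have "b * (f * (b * f)) \<in> I" using eval[OF f(1)] unfolding 0 by (intro mult_mem[of _ b]) simp
      then have "(b * f) ^ 2 \<in> I" by (simp add: power2_eq_square mult_ac)
      with b(1) reduced show False unfolding reduced_subscheme_def by blast
    qed
    show "poly_at g (\<chi> v. c v) = 0" if "g \<in> I" "homogeneous e g" for g e
      using zero[OF that(2) mult_mem'[OF that(1)]] .
  qed
qed

end

section \<open>Linear forms with prescribed values\<close>

lemma interpolating_form:
  fixes B :: "(complex ^ 'v) set"
  assumes "vec.independent B"
  shows "\<exists>p. homogeneous 1 p \<and> (\<forall>b\<in>B. poly_at p b = \<phi> b)"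
proof -
  interpret pair: vector_space_pair "(*s) :: complex \<Rightarrow> complex ^ 'v \<Rightarrow> complex ^ 'v" "(*) :: complex \<Rightarrow> complex \<Rightarrow> complex"
    by unfold_locales (auto simp: algebra_simps)
  obtain g where g: "Vector_Spaces.linear (*s) (*) g" "\<forall>b\<in>B. g b = \<phi> b"
    using pair.linear_independent_extend[OF assms] by blast
  interpret g: Vector_Spaces.linear "(*s) :: complex \<Rightarrow> complex ^ 'v \<Rightarrow> complex ^ 'v" "(*) :: complex \<Rightarrow> complex \<Rightarrow> complex" g
    by (rule g(1))
  let ?p = "\<Sum>v\<in>UNIV. const (g (axis v 1)) * var v"
  have "poly_at ?p x = g x" for x
  proof -
    have "g x = g (\<Sum>v\<in>UNIV. x $ v *s axis v 1)" by (simp add: basis_expansion)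
    also have "\<dots> = poly_at ?p x" by (simp add: g.sum g.scale poly_at_sum poly_at_simps mult.commute)
    finally show ?thesis ..
  qed
  then have "\<forall>b\<in>B. poly_at ?p b = \<phi> b" using g(2) by simp
  moreover have "homogeneous 1 ?p" by (intro homogeneous_sum homogeneous_const_mult homogeneous_var)
  ultimately show ?thesis by (intro exI[of _ ?p] conjI)
qed

lemma separating_form:
  assumes "y \<notin> vec.span E"
  shows "\<exists>p. homogeneous 1 p \<and> (\<forall>x\<in>E. poly_at p x = 0) \<and> poly_at p y \<noteq> 0"
proof -
  obtain B where B: "B \<subseteq> E" "vec.independent B" "E \<subseteq> vec.span B"
    using vec.maximal_independent_subset by blast
  have y: "y \<notin> vec.span B" using assms vec.span_mono[OF B(1)] by blast
  then have "vec.independent (insert y B)" using B(2) by (rule vec.independent_insertI)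
  from interpolating_form[OF this, of "\<lambda>b. if b = y then 1 else 0"]
  obtain p where p: "homogeneous 1 p" "\<forall>b\<in>insert y B. poly_at p b = (if b = y then 1 else 0)" by blast
  have "y \<notin> B" using y vec.span_base by blast
  then have "poly_at p b = 0" if "b \<in> B" for b using p(2) that by auto
  then have "poly_at p x = 0" if "x \<in> E" for x
    using linear_form_vanishes_on_span[OF p(1), of B] B(3) that by blast
  moreover have "poly_at p y \<noteq> 0" using p(2) by simp
  ultimately show ?thesis using p(1) by blast
qed

text \<open>By \<open>common_zero\<close>, a linear form vanishing on the Veronese images of the
  points of the scheme pulls back into \<open>I\<close>, so these images span \<tau>. Instead of
  counting all points, a basis of the span is extracted.\<close>

lemma (in regular_section) tensor_rank_upper:
  fixes \<tau> :: "complex ^ ('k::finite \<Rightarrow> 'v)"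
  assumes bounded: "hilbert_bounded I N" and reduced: "reduced_subscheme I"
    and dim: "\<not> hilbert_ge I CARD('k) (Suc r)" and "\<tau> \<noteq> 0"
    and \<tau>: "\<And>p. homogeneous 1 p \<Longrightarrow> veronese_subst p \<in> I \<Longrightarrow> poly_at p \<tau> = 0"
  obtains S where "finite S" "S \<subseteq> multi_proj_space" "card S \<le> r" "vec.span {\<tau>} \<in> points_span (segre ` S)"
proof -
  define E :: "(complex ^ ('k \<Rightarrow> 'v)) set" where
    "E = {pure_tensor (\<lambda>_. x) | x. x \<noteq> 0 \<and> (\<forall>g e. g \<in> I \<longrightarrow> homogeneous e g \<longrightarrow> poly_at g x = 0)}"
  have "\<tau> \<in> vec.span E"
  proof (rule ccontr)
    assume "\<tau> \<notin> vec.span E"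
    then obtain p where p: "homogeneous 1 p" "\<And>x. x \<in> E \<Longrightarrow> poly_at p x = 0" "poly_at p \<tau> \<noteq> 0"
      using separating_form by blast
    then have "veronese_subst p \<notin> I" using \<tau> by blast
    from common_zero[OF bounded reduced homogeneous_veronese_subst[OF p(1)] this]
    obtain x where x: "x \<noteq> 0" "poly_at (veronese_subst p) x \<noteq> 0"
      "\<And>g e. g \<in> I \<Longrightarrow> homogeneous e g \<Longrightarrow> poly_at g x = 0" by blast
    have "pure_tensor (\<lambda>_. x) \<in> E" unfolding E_def using x(1,3) by blast
    with p(2) x(2) show False unfolding poly_at_veronese_subst by blast
  qed
  obtain B where B: "B \<subseteq> E" "vec.independent B" "E \<subseteq> vec.span B"
    using vec.maximal_independent_subset by blast
  have "finite B" using B(2) by (rule vec.finiteI_independent)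
  have "\<forall>b\<in>B. \<exists>x. b = pure_tensor (\<lambda>_. x) \<and> x \<noteq> 0 \<and> (\<forall>g e. g \<in> I \<longrightarrow> homogeneous e g \<longrightarrow> poly_at g x = 0)"
    using B(1) unfolding E_def by blast
  from bchoice[OF this] obtain x where x: "\<And>b. b \<in> B \<Longrightarrow> b = pure_tensor (\<lambda>_. x b)" "\<And>b. b \<in> B \<Longrightarrow> x b \<noteq> 0"
    "\<And>b g e. b \<in> B \<Longrightarrow> g \<in> I \<Longrightarrow> homogeneous e g \<Longrightarrow> poly_at g (x b) = 0" by blast
  \<comment> \<open>Linear forms dual to \<open>B\<close> pull back to forms of degree
    \<open>CARD('k)\<close>, and evaluation at the points \<open>x b\<close> shows their
    independence modulo \<open>I\<close>.\<close>
  have "hilbert_ge I CARD('k) (card B)"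
  proof -
    obtain \<beta> where \<beta>: "bij_betw \<beta> {..<card B} B"
      using ex_bij_betw_nat_finite[OF \<open>finite B\<close>] by (auto simp: atLeast0LessThan)
    have "\<forall>i. \<exists>p. homogeneous 1 p \<and> (\<forall>b\<in>B. poly_at p b = (if b = \<beta> i then 1 else 0))"
      by (intro allI interpolating_form B)
    then obtain p where p: "\<And>i. homogeneous 1 (p i)" "\<And>i b. b \<in> B \<Longrightarrow> poly_at (p i) b = (if b = \<beta> i then 1 else 0)"
      by metis
    have hom: "homogeneous CARD('k) (veronese_subst (p i))" for i
      using homogeneous_veronese_subst[OF p(1)[of i]] by simp
    show ?thesis
    proof (rule codim_geI)
      fix c assume mem: "(\<Sum>i<card B. const (c i) * veronese_subst (p i)) \<in> I"
      show "\<forall>i<card B. c i = 0"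
      proof (intro allI impI)
        fix j assume j: "j < card B"
        then have "\<beta> j \<in> B" using \<beta> by (auto simp: bij_betw_def)
        have "homogeneous CARD('k) (\<Sum>i<card B. const (c i) * veronese_subst (p i))"
          by (intro homogeneous_sum homogeneous_const_mult hom)
        then have "0 = poly_at (\<Sum>i<card B. const (c i) * veronese_subst (p i)) (x (\<beta> j))"
          using x(3)[OF \<open>\<beta> j \<in> B\<close> mem] by simp
        also have "\<dots> = (\<Sum>i<card B. c i * poly_at (p i) (\<beta> j))"
          by (simp add: poly_at_sum poly_at_simps poly_at_veronese_subst x(1)[OF \<open>\<beta> j \<in> B\<close>, symmetric])
        also have "\<dots> = (\<Sum>i<card B. if i = j then c j else 0)"
          using p(2)[OF \<open>\<beta> j \<in> B\<close>] \<beta> j by (intro sum.cong) (auto simp: bij_betw_def inj_on_def)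
        finally show "c j = 0" using j by simp
      qed
    qed (use hom in simp)
  qed
  then have "card B \<le> r" using dim codim_ge_mono[OF vector_space_const] by (metis not_less_eq_eq)
  define S :: "('k \<Rightarrow> (complex ^ 'v) set) set" where "S = (\<lambda>b _. vec.span {x b}) ` B"
  show ?thesis
  proof (rule that)
    show "finite S" unfolding S_def using \<open>finite B\<close> by simp
    show "S \<subseteq> multi_proj_space"
      unfolding S_def multi_proj_space_def using x(2) span_singleton_proj_space by auto
    show "card S \<le> r" unfolding S_def using card_image_le[OF \<open>finite B\<close>] \<open>card B \<le> r\<close> by (rule le_trans)
    have "b \<in> segre (\<lambda>_ :: 'k. vec.span {x b})" if "b \<in> B" for b
      unfolding segre_def using x(1)[OF that] vec.span_base[of "x b" "{x b}"] by blast
    then have "B \<subseteq> \<Union> (segre ` S)" unfolding S_def by blast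
    then have "vec.span B \<subseteq> vec.span (\<Union> (segre ` S))" by (rule vec.span_mono)
    moreover have "\<tau> \<in> vec.span B"
      using \<open>\<tau> \<in> vec.span E\<close> vec.span_minimal[OF B(3) vec.subspace_span] by blast
    ultimately have "vec.span {\<tau>} \<subseteq> vec.span (\<Union> (segre ` S))"
      by (intro vec.span_minimal vec.subspace_span) auto
    then show "vec.span {\<tau>} \<in> points_span (segre ` S)"
      using span_singleton_proj_space[OF \<open>\<tau> \<noteq> 0\<close>] unfolding points_span_def by blast
  qed
qed

theorem corollary3p10:
  fixes A :: "'n::finite cpoly set"
    and T :: "(complex ^ ('k::finite \<Rightarrow> 'n)) set"
    and c :: nat and e :: int
  assumes "closed_subscheme A"
    and "zero_dimensional A"
    and "has_length A (c + 1)"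
    and "has_h1 A e 0"
    and "real_of_int e \<le> real CARD('k) / 2"
    and "T \<in> scheme_span (veronese_image A)"
    and "\<And>A'. closed_subscheme A' \<Longrightarrow> A \<subset> A' \<Longrightarrow> T \<notin> scheme_span (veronese_image A')"
  shows "cactus_rank T = c + 1 \<and> (reduced_subscheme A \<longrightarrow> tensor_rank T = c + 1)"
proof -
  interpret saturated_ideal A by unfold_locales fact
  obtain N where bounded: "hilbert_bounded A N" using zero_dimensional_imp_bounded[OF assms(2)] .
  obtain l where "homogeneous 1 l" "\<And>b. torsion A l b \<Longrightarrow> b \<in> A" using ex_nonzerodivisor[OF bounded] by blast
  then interpret regular_section A l by unfold_locales
  obtain d0 r where "hilbert_limit A d0 r" using ex_hilbert_limit[OF bounded] .
  with has_length_unique[OF this assms(3)] have lim: "hilbert_limit A d0 (c + 1)" by simp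
  have limit: "hilbert_limit A d (c + 1)" if "e \<le> int d" for d
    using has_h1_zero_hilbert_ge[OF lim assms(4) that] lim by (simp add: hilbert_limit_def)

  obtain \<tau> where "\<tau> \<noteq> 0" and T: "T = vec.span {\<tau>}"
    using assms(6) proj_space_line unfolding scheme_span_def by blast
  have \<tau>: "poly_at p \<tau> = 0" if "homogeneous 1 p" "veronese_subst p \<in> A" for p
    using assms(6) that unfolding T scheme_span_line_iff[OF \<open>\<tau> \<noteq> 0\<close>] veronese_image_def by blast
  have minimal: "\<exists>p. homogeneous 1 p \<and> veronese_subst p \<in> A' \<and> poly_at p \<tau> \<noteq> 0"
    if "closed_subscheme A'" "A \<subset> A'" for A'
    using assms(7)[OF that] unfolding T scheme_span_line_iff[OF \<open>\<tau> \<noteq> 0\<close>] veronese_image_def by blast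

  \<comment> \<open>The half is rounded down, but \<open>e\<close> is an integer, so it is still at
    most \<open>card J\<close>.\<close>
  obtain J :: "'k set" where J: "card J = CARD('k) div 2"
    using obtain_subset_with_card_n[of "CARD('k) div 2" "UNIV :: 'k set"] by auto
  have "card J + card (- J) = CARD('k)" by (rule card_add_card_Compl)
  with assms(5) J have e: "e \<le> int (card J)" "e \<le> int (card (- J))" "e \<le> int CARD('k)"
    by linarith+
  obtain f where f: "flattening_independent J \<tau> (c + 1) f"
    using ex_flattening_independent[OF limit[OF e(2)] _ \<tau> minimal] limit[OF e(1)]
    unfolding hilbert_limit_def by blast

  have "cactus_rank T = c + 1"
    unfolding cactus_rank_def
  proof (rule Least_equality)
    let ?G = "veronese_image A :: ('k \<Rightarrow> 'n) cpoly set"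
    have closed: "closed_subscheme ?G" by (rule closed_veronese_image[OF assms(1)])
    interpret G: saturated_ideal ?G by unfold_locales (rule closed)
    have "hilbert_bounded ?G N"
      using bounded unfolding hilbert_bounded_def veronese_image_hilbert_ge by blast
    then have "zero_dimensional ?G" by (rule G.bounded_imp_zero_dimensional)
    obtain m where "homogeneous 1 m" "\<And>b. torsion ?G m b \<Longrightarrow> b \<in> ?G"
      using G.ex_nonzerodivisor[OF \<open>hilbert_bounded ?G N\<close>] by blast
    then interpret G: regular_section ?G m by unfold_locales
    \<comment> \<open>Degree 1 on the image is degree \<open>CARD('k)\<close> on \<open>A\<close>,
      where the Hilbert function is already maximal.\<close>
    have "hilbert_limit ?G 1 (c + 1)"
      using limit[OF e(3)] by (simp add: hilbert_limit_def veronese_image_hilbert_ge)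
    then have "has_length ?G (c + 1)" by (rule G.hilbert_limit_imp_has_length)
    with closed \<open>zero_dimensional ?G\<close> assms(6) segre_ideal_subset_veronese_image[OF assms(1)]
    show "\<exists>G. closed_subscheme G \<and> segre_ideal \<subseteq> G \<and> zero_dimensional G \<and> has_length G (c + 1) \<and> T \<in> scheme_span G"
      by blast
  next
    fix r assume "\<exists>G. closed_subscheme G \<and> segre_ideal \<subseteq> G \<and> zero_dimensional G \<and> has_length G r \<and> T \<in> scheme_span G"
    then obtain G where G: "closed_subscheme G" "segre_ideal \<subseteq> G" "zero_dimensional G" "has_length G r"
      "T \<in> scheme_span G" by blast
    interpret G: saturated_ideal G by unfold_locales fact
    obtain N' where bG: "hilbert_bounded G N'" using G.zero_dimensional_imp_bounded[OF G(3)] .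
    obtain m where "homogeneous 1 m" "\<And>b. torsion G m b \<Longrightarrow> b \<in> G" using G.ex_nonzerodivisor[OF bG] by blast
    then interpret G: regular_section G m by unfold_locales
    obtain d1 r' where limG: "hilbert_limit G d1 r'" using ex_hilbert_limit[OF bG] .
    \<comment> \<open>The length is the maximum of the Hilbert function, so it also bounds the
      linear forms on \<open>G\<close>.\<close>
    with G.has_length_unique[OF this G(4)] have "\<not> hilbert_ge G 1 (Suc r)" by (simp add: hilbert_limit_def)
    moreover have "hilbert_ge G 1 (c + 1)"
      using G(5) by (intro hilbert_ge_of_flattening[OF G(1) bG G(2) _ f])
        (simp add: T scheme_span_line_iff[OF \<open>\<tau> \<noteq> 0\<close>])
    ultimately show "c + 1 \<le> r" using codim_ge_mono[OF vector_space_const] by (metis not_less_eq_eq)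
  qed
  moreover have "tensor_rank T = c + 1" if reduced: "reduced_subscheme A"
    unfolding tensor_rank_def
  proof (rule Least_equality)
    have lower: "c + 1 \<le> card S" if "finite S" "S \<subseteq> multi_proj_space" "T \<in> points_span (segre ` S)" for S
    proof (rule card_ge_of_flattening[OF that(1,2) _ f])
      show "\<tau> \<in> vec.span (\<Union> (segre ` S))"
        using that(3) vec.span_base[of \<tau> "{\<tau>}"] unfolding points_span_def T by blast
    qed
    show "c + 1 \<le> r" if "\<exists>S. finite S \<and> S \<subseteq> multi_proj_space \<and> card S = r \<and> T \<in> points_span (segre ` S)" for r
      using that lower by blast
    have "\<not> hilbert_ge A CARD('k) (Suc (c + 1))" using lim by (simp add: hilbert_limit_def)
    then obtain S where S: "finite S" "S \<subseteq> multi_proj_space" "card S \<le> c + 1" "T \<in> points_span (segre ` S)"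
      using tensor_rank_upper[OF bounded reduced _ \<open>\<tau> \<noteq> 0\<close> \<tau>] unfolding T by blast
    with lower show "\<exists>S. finite S \<and> S \<subseteq> multi_proj_space \<and> card S = c + 1 \<and> T \<in> points_span (segre ` S)"
      by (metis le_antisym)
  qed
  ultimately show ?thesis by blast
qed

end
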